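(* Suppose a topological group $G$ carries a compatible left-invariant metrically proper stable metric. Then $G$ admits a metrically proper continuous affine isometric action on a reflexive Banach space.
   Context: A metric on a topological group $G$ is compatible if it induces the topology of $G$, and left-invariant if $d(hg,hf)=d(g,f)$ for all $g,f,h\in G$. A sequence $(g_n)$ in $G$ tends to infinity, written $g_n\to\infty$, if there is a compatible left-invariant metric $\partial$ on $G$ with $\partial(g_n,1)\to\infty$. A compatible left-invariant metric $d$ is metrically proper if $d(g_n,1)\to\infty$ whenever $g_n\to\infty$. A metric $d$ on a set $X$ is stable if, for all $d$-bounded sequences $(x_n)$ and $(y_m)$ in $X$ and all ultrafilters $\mathcal{U}$ and $\mathcal{V}$ on $\mathbb{N}$, $\lim_{n\to\mathcal{U}}\lim_{m\to\mathcal{V}}d(x_n,y_m)=\lim_{m\to\mathcal{V}}\lim_{n\to\mathcal{U}}d(x_n,y_m)$. An affine isometric action of $G$ on a Banach space $X$ is an action $\alpha$ of the form $\alpha(g)\xi=\pi(g)\xi+b(g)$, where $\pi$ is a representation of $G$ by invertible linear isometries of $X$ and $b\colon G\to X$ satisfies $b(gf)=\pi(g)b(f)+b(g)$. The action is metrically proper if for all $\xi\in X$ one has $\|\alpha(g_n)\xi-\xi\|\to\infty$ whenever $g_n\to\infty$ in $G$. *)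

theory Defs
  imports "HOL-Analysis.Analysis" "HOL-Library.Function_Algebras"
begin

text \<open>
  Topological groups are types of class \<open>topological_group_add\<close>. That class is not commutative;
  it is only written additively, so the group product is \<open>g + h\<close>, the unit is \<open>0\<close> and the
  inverse is \<open>- g\<close>. No separation axiom is assumed.
\<close>

definition compatible_metric :: "('g::topological_group_add \<Rightarrow> 'g \<Rightarrow> real) \<Rightarrow> bool" where
  "compatible_metric d \<longleftrightarrow> Metric_space UNIV d \<and> Metric_space.mtopology UNIV d = euclidean"

definition left_invariant :: "('g::topological_group_add \<Rightarrow> 'g \<Rightarrow> real) \<Rightarrow> bool" where
  "left_invariant d \<longleftrightarrow> (\<forall>h g f. d (h + g) (h + f) = d g f)"

definition tends_to_infinity :: "(nat \<Rightarrow> 'g::topological_group_add) \<Rightarrow> bool" where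
  "tends_to_infinity g \<longleftrightarrow>
     (\<exists>d. compatible_metric d \<and> left_invariant d \<and> filterlim (\<lambda>n. d (g n) 0) at_top sequentially)"

definition metrically_proper_metric :: "('g::topological_group_add \<Rightarrow> 'g \<Rightarrow> real) \<Rightarrow> bool" where
  "metrically_proper_metric d \<longleftrightarrow>
     compatible_metric d \<and> left_invariant d \<and>
     (\<forall>g. tends_to_infinity g \<longrightarrow> filterlim (\<lambda>n. d (g n) 0) at_top sequentially)"

definition ultrafilter :: "'a filter \<Rightarrow> bool" where
  "ultrafilter F \<longleftrightarrow> F \<noteq> bot \<and> (\<forall>P. eventually P F \<or> eventually (\<lambda>x. \<not> P x) F)"

definition stable_metric :: "'a set \<Rightarrow> ('a \<Rightarrow> 'a \<Rightarrow> real) \<Rightarrow> bool" where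
  "stable_metric M d \<longleftrightarrow> Metric_space M d \<and>
     (\<forall>(x :: nat \<Rightarrow> 'a) (y :: nat \<Rightarrow> 'a).
        Metric_space.mbounded M d (range x) \<and> Metric_space.mbounded M d (range y) \<longrightarrow>
        (\<forall>U V. ultrafilter U \<and> ultrafilter V \<longrightarrow>
           Lim U (\<lambda>n. Lim V (\<lambda>m. d (x n) (y m))) = Lim V (\<lambda>m. Lim U (\<lambda>n. d (x n) (y m)))))"

text \<open>
  A normed space is a linear subspace \<open>X\<close> of some ambient real vector space together with a norm
  \<open>N\<close> on \<open>X\<close>. The ambient space only supplies the linear operations; it carries no norm or
  topology that \<open>N\<close> would have to respect, and \<open>N\<close> is unconstrained outside \<open>X\<close>. Function types
  into real vector spaces serve as ambient spaces, with the pointwise operations.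
\<close>

instantiation "fun" :: (type, real_vector) real_vector
begin

definition scaleR_fun_def: "c *\<^sub>R f = (\<lambda>x. c *\<^sub>R f x)"

instance
  by standard (simp_all add: scaleR_fun_def fun_eq_iff scaleR_add_right scaleR_add_left)

end

definition normed_space_on :: "'v::real_vector set \<Rightarrow> ('v \<Rightarrow> real) \<Rightarrow> bool" where
  "normed_space_on X N \<longleftrightarrow> subspace X \<and>
     (\<forall>x\<in>X. 0 \<le> N x) \<and>
     (\<forall>x\<in>X. N x = 0 \<longleftrightarrow> x = 0) \<and>
     (\<forall>c. \<forall>x\<in>X. N (c *\<^sub>R x) = \<bar>c\<bar> * N x) \<and>
     (\<forall>x\<in>X. \<forall>y\<in>X. N (x + y) \<le> N x + N y)"

text \<open>
  The norm metric; the value \<open>0\<close> outside \<open>X\<close> is there because \<open>Metric_space\<close> demands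
  nonnegativity and symmetry on the whole type.
\<close>

definition norm_dist :: "'v::real_vector set \<Rightarrow> ('v \<Rightarrow> real) \<Rightarrow> 'v \<Rightarrow> 'v \<Rightarrow> real" where
  "norm_dist X N x y = (if x \<in> X \<and> y \<in> X then N (x - y) else 0)"

lemma Metric_space_norm_dist:
  assumes "normed_space_on X N"
  shows "Metric_space X (norm_dist X N)"
proof
  have X: "subspace X"
    and N0: "\<And>x. x \<in> X \<Longrightarrow> 0 \<le> N x"
    and N_eq: "\<And>x. x \<in> X \<Longrightarrow> N x = 0 \<longleftrightarrow> x = 0"
    and N_scale: "\<And>c x. x \<in> X \<Longrightarrow> N (c *\<^sub>R x) = \<bar>c\<bar> * N x"
    and N_add: "\<And>x y. x \<in> X \<Longrightarrow> y \<in> X \<Longrightarrow> N (x + y) \<le> N x + N y"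
    using assms unfolding normed_space_on_def by simp_all
  note diff = subspace_diff[OF X]
  have sym: "N (x - y) = N (y - x)" if "x \<in> X" "y \<in> X" for x y
    using N_scale[OF diff[OF that(2,1)], of "-1"] by simp
  show "0 \<le> norm_dist X N x y" for x y
    by (simp add: norm_dist_def N0 diff)
  show "norm_dist X N x y = norm_dist X N y x" for x y
    by (simp add: norm_dist_def sym[of x y])
  show "norm_dist X N x y = 0 \<longleftrightarrow> x = y" if "x \<in> X" "y \<in> X" for x y
    using N_eq[OF diff[OF that]] that by (simp add: norm_dist_def)
  show "norm_dist X N x z \<le> norm_dist X N x y + norm_dist X N y z"
    if "x \<in> X" "y \<in> X" "z \<in> X" for x y z
    using N_add[OF diff[OF that(1,2)] diff[OF that(2,3)]] that by (simp add: norm_dist_def)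
qed

definition banach_space_on :: "'v::real_vector set \<Rightarrow> ('v \<Rightarrow> real) \<Rightarrow> bool" where
  "banach_space_on X N \<longleftrightarrow>
     normed_space_on X N \<and> Metric_space.mcomplete X (norm_dist X N)"

definition linear_map_on :: "'v::real_vector set \<Rightarrow> ('v \<Rightarrow> 'w::real_vector) \<Rightarrow> bool" where
  "linear_map_on X f \<longleftrightarrow>
     (\<forall>x\<in>X. \<forall>y\<in>X. f (x + y) = f x + f y) \<and> (\<forall>c. \<forall>x\<in>X. f (c *\<^sub>R x) = c *\<^sub>R f x)"

text \<open>Functionals vanish outside \<open>X\<close>, so that each functional on \<open>X\<close> is a unique function.\<close>

definition dual_space :: "'v::real_vector set \<Rightarrow> ('v \<Rightarrow> real) \<Rightarrow> ('v \<Rightarrow> real) set" where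
  "dual_space X N =
     {f. linear_map_on X f \<and> (\<exists>C. \<forall>x\<in>X. \<bar>f x\<bar> \<le> C * N x) \<and> (\<forall>x. x \<notin> X \<longrightarrow> f x = 0)}"

definition dual_norm :: "'v::real_vector set \<Rightarrow> ('v \<Rightarrow> real) \<Rightarrow> ('v \<Rightarrow> real) \<Rightarrow> real" where
  "dual_norm X N f = (SUP x\<in>{x\<in>X. N x \<le> 1}. \<bar>f x\<bar>)"

definition canonical_embedding ::
    "'v::real_vector set \<Rightarrow> ('v \<Rightarrow> real) \<Rightarrow> 'v \<Rightarrow> ('v \<Rightarrow> real) \<Rightarrow> real" where
  "canonical_embedding X N x = (\<lambda>f. if f \<in> dual_space X N then f x else 0)"

definition reflexive_on :: "'v::real_vector set \<Rightarrow> ('v \<Rightarrow> real) \<Rightarrow> bool" where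
  "reflexive_on X N \<longleftrightarrow>
     canonical_embedding X N ` X = dual_space (dual_space X N) (dual_norm X N)"

definition isometric_linear_representation_on ::
    "'v::real_vector set \<Rightarrow> ('v \<Rightarrow> real) \<Rightarrow> ('g::topological_group_add \<Rightarrow> 'v \<Rightarrow> 'v) \<Rightarrow> bool" where
  "isometric_linear_representation_on X N \<pi> \<longleftrightarrow>
     (\<forall>g. bij_betw (\<pi> g) X X \<and> linear_map_on X (\<pi> g) \<and> (\<forall>\<xi>\<in>X. N (\<pi> g \<xi>) = N \<xi>)) \<and>
     (\<forall>\<xi>\<in>X. \<pi> 0 \<xi> = \<xi>) \<and>
     (\<forall>g f. \<forall>\<xi>\<in>X. \<pi> (g + f) \<xi> = \<pi> g (\<pi> f \<xi>))"

definition affine_isometric_action_on ::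
    "'v::real_vector set \<Rightarrow> ('v \<Rightarrow> real) \<Rightarrow> ('g::topological_group_add \<Rightarrow> 'v \<Rightarrow> 'v) \<Rightarrow> bool" where
  "affine_isometric_action_on X N \<alpha> \<longleftrightarrow>
     (\<forall>\<xi>\<in>X. \<alpha> 0 \<xi> = \<xi>) \<and>
     (\<forall>g f. \<forall>\<xi>\<in>X. \<alpha> (g + f) \<xi> = \<alpha> g (\<alpha> f \<xi>)) \<and>
     (\<exists>\<pi> b. isometric_linear_representation_on X N \<pi> \<and>
        (\<forall>g. b g \<in> X) \<and>
        (\<forall>g f. b (g + f) = \<pi> g (b f) + b g) \<and>
        (\<forall>g. \<forall>\<xi>\<in>X. \<alpha> g \<xi> = \<pi> g \<xi> + b g))"

definition continuous_action_on ::
    "'v::real_vector set \<Rightarrow> ('v \<Rightarrow> real) \<Rightarrow> ('g::topological_group_add \<Rightarrow> 'v \<Rightarrow> 'v) \<Rightarrow> bool" where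
  "continuous_action_on X N \<alpha> \<longleftrightarrow>
     continuous_map (prod_topology euclidean (Metric_space.mtopology X (norm_dist X N)))
       (Metric_space.mtopology X (norm_dist X N)) (\<lambda>(g, \<xi>). \<alpha> g \<xi>)"

definition metrically_proper_action_on ::
    "'v::real_vector set \<Rightarrow> ('v \<Rightarrow> real) \<Rightarrow> ('g::topological_group_add \<Rightarrow> 'v \<Rightarrow> 'v) \<Rightarrow> bool" where
  "metrically_proper_action_on X N \<alpha> \<longleftrightarrow>
     (\<forall>\<xi>\<in>X. \<forall>g. tends_to_infinity g \<longrightarrow>
        filterlim (\<lambda>n. N (\<alpha> (g n) \<xi> - \<xi>)) at_top sequentially)"

text \<open>
  HOL cannot quantify existentially over types, so a claim that a group \<open>'g\<close> acts on some Banach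
  space has to name an ambient type. The type \<open>nat \<Rightarrow> 'g \<Rightarrow> real\<close> loses no generality: given an
  affine isometric action on a reflexive Banach space, the closed linear span of the orbit of
  \<open>0\<close> is an invariant, again reflexive, subspace. It has a dense subset of cardinality at most
  that of \<open>nat \<times> 'g\<close>, hence cardinality at most that of \<open>nat \<Rightarrow> 'g \<Rightarrow> real\<close>, which equals the
  linear dimension of the latter. So it is linearly isomorphic to a linear subspace of
  \<open>nat \<Rightarrow> 'g \<Rightarrow> real\<close>, to which its norm can be transported.
\<close>

end

theory Submission
  imports Defs
begin

text \<open>
  Stability of \<open>d\<close> gives the kernels \<open>k j x y = max 0 (1 - d x y / 2 ^ j)\<close> the interchange of double
  limits. By an elementary version of the theorems of Grothendieck and Krein, the functions
  \<open>y \<mapsto> \<mu> (k j y)\<close>, with \<open>\<mu>\<close> a contractive functional on the bounded functions, form a translation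
  invariant disc \<open>K j\<close> on which pointwise and weak convergence agree. Interpolating between \<open>K j\<close> and
  the bounded functions, and taking an \<open>\<ell>\<^sup>2\<close>-sum over \<open>j\<close>, yields a reflexive space on which the group
  acts isometrically by translations. Put \<open>\<Phi> j = k j _ 0\<close>. This family lies outside the space, but
  \<open>b g = \<pi> g \<Phi> - \<Phi>\<close> lies in it and is a cocycle: the \<open>j\<close>-th coordinate has squared norm
  \<open>O(d g 0 / 2 ^ j)\<close>, which is summable and gives continuity, and norm at least 1 as soon as
  \<open>d g 0 \<ge> 2 ^ j\<close>, which gives metric properness.
\<close>

section \<open>Ultrafilters and the Hahn-Banach theorem\<close>

text \<open>Stability speaks only of bounded sequences. The truncation in \<open>k\<close> lifts
  this restriction: as \<open>k j x y\<close> vanishes at distance at least \<open>2 ^ j\<close>,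
  both iterated limits are 0 once one sequence escapes to infinity. The dual of the bounded
  functions enters only through its unit ball, \<open>contraction\<close>, and weak convergence is
  tested along ultrafilters, so neither a weak topology nor a representation of functionals by
  measures has to be built. Interpolation is needed because the space normed by the gauge of a
  weakly compact disc need not be reflexive. In the interpolation norm each element of a ball lies,
  for every \<open>n\<close>, within a constant times \<open>1 / 2 ^ n\<close> of a multiple of the
  disc that is bounded for fixed \<open>n\<close>; hence weak compactness passes from the disc to
  the ball. \<open>\<Phi>\<close> is outside the space since \<open>\<Phi> j 0 = 1\<close> for every
  \<open>j\<close>, which keeps all coordinate norms away from 0. Translation orbits need not be
  continuous on the whole space, so the action is finally restricted to a closed subspace.\<close>

lemma ultrafilter_not_eventually:
  assumes "ultrafilter U"
  shows "\<not> eventually P U \<longleftrightarrow> eventually (\<lambda>x. \<not> P x) U"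
proof -
  have "\<not> (eventually P U \<and> eventually (\<lambda>x. \<not> P x) U)"
    using eventually_conj[of P U "\<lambda>x. \<not> P x"] assms by (auto simp: ultrafilter_def)
  then show ?thesis using assms by (auto simp: ultrafilter_def)
qed

lemma ultrafilter_not_bot: "ultrafilter U \<Longrightarrow> U \<noteq> bot"
  by (simp add: ultrafilter_def)

lemma ultrafilter_filtermap: "ultrafilter U \<Longrightarrow> ultrafilter (filtermap f U)"
  by (simp add: ultrafilter_def eventually_filtermap filtermap_bot_iff)

text \<open>Zorn's lemma for the reversed order. Only nonempty chains need a lower bound, because
  any element of \<open>A\<close> bounds the empty one.\<close>

lemma zorn_minimal:
  fixes A :: "'a::order set"
  assumes "A \<noteq> {}"
    and chain: "\<And>C. C \<noteq> {} \<Longrightarrow> C \<subseteq> A \<Longrightarrow> (\<And>a b. a \<in> C \<Longrightarrow> b \<in> C \<Longrightarrow> a \<le> b \<or> b \<le> a) \<Longrightarrow>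
      \<exists>u\<in>A. \<forall>a\<in>C. u \<le> a"
  obtains m where "m \<in> A" "\<And>a. a \<in> A \<Longrightarrow> a \<le> m \<Longrightarrow> a = m"
proof -
  have "\<exists>m\<in>A. \<forall>a\<in>A. m \<ge> a \<longrightarrow> a = m"
  proof (rule predicate_Zorn)
    show "partial_order_on A (relation_of (\<ge>) A)"
      by (auto simp: partial_order_on_def preorder_on_def refl_on_def trans_def antisym_def
          relation_of_def)
    fix C assume C: "C \<in> Chains (relation_of (\<ge>) A)"
    show "\<exists>u\<in>A. \<forall>a\<in>C. u \<le> a"
    proof (cases "C = {}")
      case True
      then show ?thesis using \<open>A \<noteq> {}\<close> by auto
    next
      case False
      then show ?thesis using C by (intro chain) (auto simp: Chains_def relation_of_def)
    qed
  qed
  with that show ?thesis by blast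
qed

text \<open>Ultrafilters are the minimal proper filters, since finer filters are smaller in the
  order of the filter type. The infimum of a chain is proper: whatever holds eventually in it
  already does so in some member of the chain.\<close>

lemma ultrafilter_below:
  assumes "F \<noteq> bot"
  obtains U where "ultrafilter U" "U \<le> F"
proof -
  define A where "A = {G. G \<noteq> bot \<and> G \<le> F}"
  obtain U where "U \<in> A" "\<And>G. G \<in> A \<Longrightarrow> G \<le> U \<Longrightarrow> G = U"
  proof (rule zorn_minimal[of A])
    show "A \<noteq> {}" using assms by (auto simp: A_def)
    fix C assume C: "C \<noteq> {}" "C \<subseteq> A" and lin: "\<And>a b. a \<in> C \<Longrightarrow> b \<in> C \<Longrightarrow> a \<le> b \<or> b \<le> a"
    have "eventually P (Inf C) \<longleftrightarrow> (\<exists>b\<in>C. eventually P b)" for P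
    proof (rule eventually_Inf_base[OF C(1)])
      fix F G assume "F \<in> C" "G \<in> C"
      then show "\<exists>x\<in>C. x \<le> inf F G" using lin[of F G] by auto
    qed
    from this[of "\<lambda>_. False"] have "Inf C \<noteq> bot"
      using C by (auto simp: A_def eventually_False)
    moreover obtain G where "G \<in> C" using C by blast
    then have "Inf C \<le> F" using C by (intro Inf_lower2[of G]) (auto simp: A_def)
    ultimately show "\<exists>u\<in>A. \<forall>a\<in>C. u \<le> a" by (auto simp: A_def intro: Inf_lower)
  qed blast
  note min = this
  have U: "U \<noteq> bot" "U \<le> F" using min(1) by (simp_all add: A_def)
  have U_min: "G = U" if "G \<noteq> bot" "G \<le> U" for G
    using that U by (intro min(2)) (simp_all add: A_def)
  have "eventually P U \<or> eventually (\<lambda>x. \<not> P x) U" for P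
  proof (rule disjCI)
    \<comment> \<open>Restricting \<open>U\<close> to \<open>P\<close> leaves it proper, so
      minimality identifies the restriction with \<open>U\<close> itself.\<close>
    assume "\<not> eventually (\<lambda>x. \<not> P x) U"
    then have "inf U (principal {x. P x}) \<noteq> bot"
      by (auto simp: eventually_inf_principal eventually_False[symmetric])
    then have "inf U (principal {x. P x}) = U" by (intro U_min) auto
    moreover have "eventually P (inf U (principal {x. P x}))"
      by (simp add: eventually_inf_principal)
    ultimately show "eventually P U" by simp
  qed
  then show ?thesis using U that by (auto simp: ultrafilter_def)
qed

text \<open>Compactness yields a cluster point. For an ultrafilter every cluster point is a limit: a
  neighbourhood that is not eventually entered is eventually avoided.\<close>

lemma ultrafilter_compact_limit:
  fixes f :: "'a \<Rightarrow> 'b::topological_space"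
  assumes U: "ultrafilter U" and "compact K" and "eventually (\<lambda>x. f x \<in> K) U"
  obtains l where "l \<in> K" "(f \<longlongrightarrow> l) U"
proof -
  have "filtermap f U \<noteq> bot" "eventually (\<lambda>x. x \<in> K) (filtermap f U)"
    using assms ultrafilter_not_bot[OF U] by (auto simp: filtermap_bot_iff eventually_filtermap)
  then obtain l where l: "l \<in> K" "inf (nhds l) (filtermap f U) \<noteq> bot"
    using \<open>compact K\<close> unfolding compact_filter by blast
  have "(f \<longlongrightarrow> l) U"
  proof (rule topological_tendstoI, rule ccontr)
    fix S assume S: "open S" "l \<in> S" "\<not> (\<forall>\<^sub>F x in U. f x \<in> S)"
    then have "eventually (\<lambda>x. x \<notin> S) (filtermap f U)"
      by (simp add: ultrafilter_not_eventually[OF U] eventually_filtermap)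
    moreover have "eventually (\<lambda>x. x \<in> S) (nhds l)"
      using S by (simp add: eventually_nhds) blast
    ultimately have "eventually (\<lambda>x. False) (inf (nhds l) (filtermap f U))"
      unfolding eventually_inf by blast
    with l show False by (simp add: eventually_False)
  qed
  with l that show ?thesis by blast
qed

lemma ultrafilter_bounded_limit:
  fixes f :: "'a \<Rightarrow> real"
  assumes "ultrafilter U" and "eventually (\<lambda>x. \<bar>f x\<bar> \<le> c) U"
  shows "\<exists>l. \<bar>l\<bar> \<le> c \<and> (f \<longlongrightarrow> l) U"
proof -
  have "eventually (\<lambda>x. f x \<in> {-c..c}) U"
    using assms(2) by eventually_elim (auto simp: abs_le_iff)
  from ultrafilter_compact_limit[OF assms(1) compact_Icc this]
  obtain l where "l \<in> {-c..c}" "(f \<longlongrightarrow> l) U" .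
  then show ?thesis by (intro exI[of _ l] conjI) (simp_all add: abs_le_iff)
qed

lemma ultrafilter_sequentially:
  obtains U :: "nat filter" where "ultrafilter U" "U \<le> sequentially"
  using ultrafilter_below[OF sequentially_bot] by blast

section \<open>Sublinear functionals, the Hahn-Banach theorem and separation of convex sets\<close>

definition sublinear_on :: "'v::real_vector set \<Rightarrow> ('v \<Rightarrow> real) \<Rightarrow> bool" where
  "sublinear_on E q \<longleftrightarrow>
     (\<forall>x\<in>E. \<forall>y\<in>E. q (x + y) \<le> q x + q y) \<and> (\<forall>c>0. \<forall>x\<in>E. q (c *\<^sub>R x) \<le> c * q x)"

lemma sublinear_on_add: "sublinear_on E q \<Longrightarrow> x \<in> E \<Longrightarrow> y \<in> E \<Longrightarrow> q (x + y) \<le> q x + q y"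
  and sublinear_on_scale_le: "sublinear_on E q \<Longrightarrow> c > 0 \<Longrightarrow> x \<in> E \<Longrightarrow> q (c *\<^sub>R x) \<le> c * q x"
  by (auto simp: sublinear_on_def)

lemma sublinear_on_zero:
  assumes "subspace E" "sublinear_on E q"
  shows "q 0 = 0"
  using sublinear_on_scale_le[OF assms(2), of 2 0] sublinear_on_scale_le[OF assms(2), of "1/2" 0]
    subspace_0[OF assms(1)] by simp

text \<open>The definition asks only for an inequality with positive factors, which is the form
  easily checked for infima. The reverse inequality is the same one for the factor
  \<open>inverse c\<close>.\<close>

lemma sublinear_on_scale:
  assumes E: "subspace E" and q: "sublinear_on E q" and "c \<ge> 0" "x \<in> E"
  shows "q (c *\<^sub>R x) = c * q x"
proof (cases "c = 0")
  case True
  then show ?thesis using sublinear_on_zero[OF E q] by simp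
next
  case False
  then have c: "c > 0" using \<open>c \<ge> 0\<close> by simp
  have "q (inverse c *\<^sub>R c *\<^sub>R x) \<le> inverse c * q (c *\<^sub>R x)"
    using c \<open>x \<in> E\<close> by (intro sublinear_on_scale_le[OF q]) (auto intro: subspace_scale[OF E])
  then have "c * q x \<le> q (c *\<^sub>R x)"
    using c by (simp add: field_simps)
  with sublinear_on_scale_le[OF q c \<open>x \<in> E\<close>] show ?thesis by simp
qed

lemma sublinear_on_minus:
  assumes "subspace E" "sublinear_on E q" "x \<in> E"
  shows "- q (- x) \<le> q x"
  using sublinear_on_add[OF assms(2), of x "-x"] sublinear_on_zero[OF assms(1,2)]
    subspace_neg[OF assms(1)] assms(3) by simp

text \<open>For fixed \<open>y\<close> the infimum over \<open>t \<ge> 0\<close> of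
  \<open>m (z + t *\<^sub>R y) - t * m y\<close> is again sublinear in \<open>z\<close> and lies
  below \<open>m\<close>, hence equals \<open>m\<close> by minimality. The choice
  \<open>t = 1\<close> then gives superadditivity.\<close>

lemma minimal_sublinear_linear:
  assumes E: "subspace E" and m: "sublinear_on E m"
    and min: "\<And>q. sublinear_on E q \<Longrightarrow> (\<And>x. q x \<le> m x) \<Longrightarrow> (\<And>x. x \<notin> E \<Longrightarrow> q x = m x) \<Longrightarrow> q = m"
  shows "linear_map_on E m"
proof -
  have super: "m x + m y \<le> m (x + y)" if xy: "x \<in> E" "y \<in> E" for x y
  proof -
    define q where "q z = (if z \<in> E then INF t\<in>{0..}. m (z + t *\<^sub>R y) - t * m y else m z)" for z
    have bdd: "bdd_below ((\<lambda>t. m (z + t *\<^sub>R y) - t * m y) ` {0..})" if "z \<in> E" for z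
    proof (rule bdd_belowI2[of _ "- m (-z)"])
      fix t :: real assume t: "t \<in> {0..}"
      have "m (t *\<^sub>R y) \<le> m (z + t *\<^sub>R y) + m (-z)"
        using sublinear_on_add[OF m, of "z + t *\<^sub>R y" "-z"] that xy
        by (simp add: subspace_add[OF E] subspace_neg[OF E] subspace_scale[OF E])
      then show "- m (- z) \<le> m (z + t *\<^sub>R y) - t * m y"
        using sublinear_on_scale[OF E m, of t y] t xy by simp
    qed
    have q_le: "q z \<le> m (z + t *\<^sub>R y) - t * m y" if "z \<in> E" "t \<ge> 0" for z t
      using cINF_lower[OF bdd[OF that(1)], of t] that by (simp add: q_def)
    have q_ge: "a \<le> q z" if "z \<in> E" "\<And>t. t \<ge> 0 \<Longrightarrow> a \<le> m (z + t *\<^sub>R y) - t * m y" for a z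
      using that by (auto simp: q_def intro!: cINF_greatest)
    have "sublinear_on E q"
      unfolding sublinear_on_def
    proof (intro conjI ballI allI impI)
      fix z w assume zw: "z \<in> E" "w \<in> E"
      have "q (z + w) - (m (z + t *\<^sub>R y) - t * m y) \<le> q w" if t: "t \<ge> 0" for t
      proof (rule q_ge[OF zw(2)])
        fix u :: real assume u: "u \<ge> 0"
        have "q (z + w) \<le> m ((z + w) + (t + u) *\<^sub>R y) - (t + u) * m y"
          using t u zw by (intro q_le) (auto intro: subspace_add[OF E])
        also have "(z + w) + (t + u) *\<^sub>R y = (z + t *\<^sub>R y) + (w + u *\<^sub>R y)"
          by (simp add: algebra_simps)
        also have "m \<dots> \<le> m (z + t *\<^sub>R y) + m (w + u *\<^sub>R y)"
          using zw xy by (intro sublinear_on_add[OF m]) (auto intro: subspace_add[OF E] subspace_scale[OF E])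
        finally show "q (z + w) - (m (z + t *\<^sub>R y) - t * m y) \<le> m (w + u *\<^sub>R y) - u * m y"
          by (simp add: algebra_simps)
      qed
      then have "q (z + w) - q w \<le> q z"
        by (intro q_ge[OF zw(1)]) (simp add: algebra_simps)
      then show "q (z + w) \<le> q z + q w" by simp
    next
      fix c :: real and z assume c: "c > 0" and z: "z \<in> E"
      have "inverse c * q (c *\<^sub>R z) \<le> q z"
      proof (rule q_ge[OF z])
        fix t :: real assume t: "t \<ge> 0"
        have "q (c *\<^sub>R z) \<le> m (c *\<^sub>R z + (c * t) *\<^sub>R y) - (c * t) * m y"
          using c t z by (intro q_le) (auto intro: subspace_scale[OF E])
        also have "c *\<^sub>R z + (c * t) *\<^sub>R y = c *\<^sub>R (z + t *\<^sub>R y)" by (simp add: algebra_simps)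
        also have "m \<dots> = c * m (z + t *\<^sub>R y)"
          using c z xy by (intro sublinear_on_scale[OF E m]) (auto intro: subspace_add[OF E] subspace_scale[OF E])
        finally show "inverse c * q (c *\<^sub>R z) \<le> m (z + t *\<^sub>R y) - t * m y"
          using c by (simp add: field_simps)
      qed
      then show "q (c *\<^sub>R z) \<le> c * q z" using c by (simp add: field_simps)
    qed
    moreover have "q z \<le> m z" for z
      using q_le[of z 0] by (cases "z \<in> E") (auto simp: q_def)
    ultimately have "q = m" by (intro min) (auto simp: q_def)
    then show ?thesis using q_le[OF xy(1), of 1] by simp
  qed
  have add: "m (x + y) = m x + m y" if "x \<in> E" "y \<in> E" for x y
    using super[OF that] sublinear_on_add[OF m that] by simp
  have "m (c *\<^sub>R x) = c * m x" if x: "x \<in> E" for c x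
  proof (cases "c \<ge> 0")
    case True
    then show ?thesis using sublinear_on_scale[OF E m] x by simp
  next
    case False
    have "m (c *\<^sub>R x) + m ((-c) *\<^sub>R x) = 0"
      using add[of "c *\<^sub>R x" "(-c) *\<^sub>R x"] x sublinear_on_zero[OF E m]
      by (simp add: subspace_scale[OF E] subspace_neg[OF E])
    then show ?thesis using sublinear_on_scale[OF E m, of "-c" x] x False by simp
  qed
  with add show ?thesis by (simp add: linear_map_on_def)
qed

text \<open>Nothing is extended from a smaller subspace: a linear minorant is found directly as a
  minimal sublinear function below \<open>p\<close>. Further constraints on the functional are
  imposed through the choice of \<open>p\<close>.\<close>

lemma hahn_banach:
  assumes E: "subspace E" and p: "sublinear_on E p"
  obtains f where "linear_map_on E f" "\<And>x. x \<in> E \<Longrightarrow> f x \<le> p x"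
proof -
  \<comment> \<open>Values outside \<open>E\<close> are frozen because the order on functions sees
    the whole type; off \<open>E\<close>, chains would otherwise have no lower bound.\<close>
  define A where "A = {q. sublinear_on E q \<and> (\<forall>x. q x \<le> p x) \<and> (\<forall>x. x \<notin> E \<longrightarrow> q x = p x)}"
  obtain m where m: "m \<in> A" "\<And>q. q \<in> A \<Longrightarrow> q \<le> m \<Longrightarrow> q = m"
  proof (rule zorn_minimal[of A])
    show "A \<noteq> {}" using p by (auto simp: A_def)
    fix C assume C: "C \<noteq> {}" and CA: "C \<subseteq> A"
      and lin: "\<And>a b. a \<in> C \<Longrightarrow> b \<in> C \<Longrightarrow> a \<le> b \<or> b \<le> a"
    show "\<exists>u\<in>A. \<forall>a\<in>C. u \<le> a"
    proof -
      define u where "u x = (INF q\<in>C. q x)" for x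
      have bdd: "bdd_below ((\<lambda>q. q x) ` C)" for x
      proof (cases "x \<in> E")
        case True
        show ?thesis
        proof (rule bdd_belowI2[of _ "- p (-x)"])
          fix q assume "q \<in> C"
          then have q: "sublinear_on E q" "q (-x) \<le> p (-x)" using CA by (auto simp: A_def)
          show "- p (-x) \<le> q x" using sublinear_on_minus[OF E q(1) True] q(2) by simp
        qed
      next
        case False
        then show ?thesis using CA by (intro bdd_belowI2[of _ "p x"]) (auto simp: A_def)
      qed
      have u_le: "u x \<le> q x" if "q \<in> C" for q x
        unfolding u_def using cINF_lower[OF bdd that] .
      have u_ge: "a \<le> u x" if "\<And>q. q \<in> C \<Longrightarrow> a \<le> q x" for a x
        using C that by (auto simp: u_def intro!: cINF_greatest)
      have "sublinear_on E u"
        unfolding sublinear_on_def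
      proof (intro conjI ballI allI impI)
        fix x y assume xy: "x \<in> E" "y \<in> E"
        \<comment> \<open>Two members of the chain are comparable, so a single sublinear
          \<open>r\<close> lies below both.\<close>
        have *: "u (x + y) \<le> q x + q' y" if q: "q \<in> C" "q' \<in> C" for q q'
        proof -
          obtain r where r: "r \<in> C" "r \<le> q" "r \<le> q'" using lin[OF q] q by auto
          have "u (x + y) \<le> r (x + y)" using u_le r by blast
          also have "\<dots> \<le> r x + r y" using r CA xy by (auto simp: A_def intro: sublinear_on_add)
          also have "\<dots> \<le> q x + q' y" using r by (intro add_mono) (auto simp: le_fun_def)
          finally show ?thesis .
        qed
        have "u (x + y) - q x \<le> u y" if "q \<in> C" for q
          using *[OF that] by (intro u_ge) (simp add: algebra_simps)
        then have "u (x + y) - u y \<le> u x"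
          by (intro u_ge) (simp add: algebra_simps)
        then show "u (x + y) \<le> u x + u y" by simp
      next
        fix c :: real and x assume c: "c > 0" and x: "x \<in> E"
        have "inverse c * u (c *\<^sub>R x) \<le> u x"
        proof (rule u_ge)
          fix q assume q: "q \<in> C"
          then have "u (c *\<^sub>R x) \<le> c * q x"
            using u_le[OF q, of "c *\<^sub>R x"] sublinear_on_scale_le[of E q c x] CA c x
            by (auto simp: A_def)
          then show "inverse c * u (c *\<^sub>R x) \<le> q x" using c by (simp add: field_simps)
        qed
        then show "u (c *\<^sub>R x) \<le> c * u x" using c by (simp add: field_simps)
      qed
      moreover obtain q where "q \<in> C" using C by blast
      then have "\<forall>x. u x \<le> p x" using order_trans[OF u_le[of q]] CA by (auto simp: A_def)
      moreover have "u x = p x" if "x \<notin> E" for x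
      proof (rule antisym)
        show "u x \<le> p x" using calculation by blast
        show "p x \<le> u x" using CA that by (intro u_ge) (auto simp: A_def)
      qed
      ultimately have "u \<in> A" by (simp add: A_def)
      then show ?thesis using u_le by (auto simp: le_fun_def)
    qed
  qed blast
  have "linear_map_on E m"
  proof (rule minimal_sublinear_linear[OF E])
    show "sublinear_on E m" using m by (simp add: A_def)
    fix q assume q: "sublinear_on E q" "\<And>x. q x \<le> m x" "\<And>x. x \<notin> E \<Longrightarrow> q x = m x"
    have "\<And>x. q x \<le> p x" using q(2) m(1) unfolding A_def by (blast intro: order_trans)
    then show "q = m" using q m(1) by (intro m(2)) (auto simp: A_def le_fun_def)
  qed
  with m that show ?thesis by (auto simp: A_def)
qed

text \<open>Both requirements on \<open>f\<close> are coded into one sublinear bound, the infimum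
  \<open>p\<close> of \<open>S (x + t *\<^sub>R k) - t * e\<close>. For \<open>t = 0\<close> it
  gives \<open>f x \<le> S x\<close>; for \<open>t = 1\<close> at \<open>x = - k\<close> it gives
  \<open>f (- k) \<le> - e\<close>.\<close>

lemma hahn_banach_separation:
  assumes E: "subspace E" and S: "sublinear_on E S"
    and K: "convex K" "K \<noteq> {}" "K \<subseteq> E" and S_ge: "\<And>k. k \<in> K \<Longrightarrow> e \<le> S k"
  obtains f where "linear_map_on E f" "\<And>x. x \<in> E \<Longrightarrow> f x \<le> S x" "\<And>k. k \<in> K \<Longrightarrow> e \<le> f k"
proof -
  define h where "h x = (\<lambda>(t, k). S (x + t *\<^sub>R k) - t * e)" for x
  define p where "p x = (INF i\<in>{0..} \<times> K. h x i)" for x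
  have bdd: "bdd_below (h x ` ({0..} \<times> K))" if x: "x \<in> E" for x
  proof (rule bdd_belowI2[of _ "- S (- x)"])
    fix i assume i: "i \<in> {0::real..} \<times> K"
    obtain t k where tk: "i = (t, k)" "t \<ge> 0" "k \<in> K" using i by auto
    then have kE: "k \<in> E" using K by blast
    have "t * e \<le> t * S k" using tk S_ge by (intro mult_left_mono) auto
    also have "\<dots> = S ((x + t *\<^sub>R k) + (-x))"
      using sublinear_on_scale[OF E S] tk kE by simp
    also have "\<dots> \<le> S (x + t *\<^sub>R k) + S (-x)"
      using x kE by (intro sublinear_on_add[OF S])
        (auto intro: subspace_add[OF E] subspace_neg[OF E] subspace_scale[OF E])
    finally show "- S (- x) \<le> h x i" by (simp add: h_def tk)
  qed
  have p_le: "p x \<le> S (x + t *\<^sub>R k) - t * e" if "x \<in> E" "t \<ge> 0" "k \<in> K" for x t k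
    using cINF_lower[OF bdd[OF that(1)], of "(t, k)"] that by (simp add: p_def h_def)
  have p_ge: "a \<le> p x" if "\<And>t k. t \<ge> 0 \<Longrightarrow> k \<in> K \<Longrightarrow> a \<le> S (x + t *\<^sub>R k) - t * e" for a x
    using that K(2) by (auto simp: p_def h_def intro!: cINF_greatest)
  have "sublinear_on E p"
    unfolding sublinear_on_def
  proof (intro conjI ballI allI impI)
    fix x y assume xy: "x \<in> E" "y \<in> E"
    have *: "p (x + y) \<le> (S (x + t *\<^sub>R k) - t * e) + (S (y + u *\<^sub>R l) - u * e)"
      if tk: "t \<ge> 0" "k \<in> K" "u \<ge> 0" "l \<in> K" for t k u l
    proof -
      \<comment> \<open>Convexity merges the two directions into one; this is what makes
        \<open>p\<close> subadditive.\<close>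
      obtain n where n: "n \<in> K" "(t + u) *\<^sub>R n = t *\<^sub>R k + u *\<^sub>R l"
      proof (cases "t + u = 0")
        case True
        then have "t = 0 \<and> u = 0" using tk by linarith
        then show ?thesis using that[of k] tk by simp
      next
        case False
        have "(t / (t + u)) *\<^sub>R k + (u / (t + u)) *\<^sub>R l \<in> K"
          using tk False by (intro convexD[OF K(1)]) (auto simp: add_divide_distrib[symmetric])
        then show ?thesis using False by (intro that) (auto simp: scaleR_add_right)
      qed
      have "p (x + y) \<le> S ((x + y) + (t + u) *\<^sub>R n) - (t + u) * e"
        using tk n xy by (intro p_le) (auto intro: subspace_add[OF E])
      also have "(x + y) + (t + u) *\<^sub>R n = (x + t *\<^sub>R k) + (y + u *\<^sub>R l)"
        using n by (simp add: algebra_simps)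
      also have "S \<dots> \<le> S (x + t *\<^sub>R k) + S (y + u *\<^sub>R l)"
        using xy tk K by (intro sublinear_on_add[OF S])
          (auto intro: subspace_add[OF E] subspace_scale[OF E])
      finally show ?thesis by (simp add: algebra_simps)
    qed
    have "p (x + y) - (S (x + t *\<^sub>R k) - t * e) \<le> p y" if "t \<ge> 0" "k \<in> K" for t k
      by (rule p_ge) (use *[OF that] in \<open>simp add: algebra_simps\<close>)
    then have "p (x + y) - p y \<le> p x"
      by (intro p_ge) (simp add: algebra_simps)
    then show "p (x + y) \<le> p x + p y" by simp
  next
    fix c :: real and x assume c: "c > 0" and x: "x \<in> E"
    have "inverse c * p (c *\<^sub>R x) \<le> p x"
    proof (rule p_ge)
      fix t :: real and k assume tk: "t \<ge> 0" "k \<in> K"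
      have "p (c *\<^sub>R x) \<le> S (c *\<^sub>R x + (c * t) *\<^sub>R k) - (c * t) * e"
        using c tk x by (intro p_le) (auto intro: subspace_scale[OF E])
      also have "c *\<^sub>R x + (c * t) *\<^sub>R k = c *\<^sub>R (x + t *\<^sub>R k)" by (simp add: algebra_simps)
      also have "S \<dots> = c * S (x + t *\<^sub>R k)"
        using c tk x K by (intro sublinear_on_scale[OF E S])
          (auto intro: subspace_add[OF E] subspace_scale[OF E])
      finally show "inverse c * p (c *\<^sub>R x) \<le> S (x + t *\<^sub>R k) - t * e"
        using c by (simp add: field_simps)
    qed
    then show "p (c *\<^sub>R x) \<le> c * p x" using c by (simp add: field_simps)
  qed
  then obtain f where f: "linear_map_on E f" "\<And>x. x \<in> E \<Longrightarrow> f x \<le> p x"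
    using hahn_banach[OF E] by blast
  obtain k0 where k0: "k0 \<in> K" using K by blast
  show ?thesis
  proof
    show "linear_map_on E f" by fact
    show "f x \<le> S x" if "x \<in> E" for x
      using f(2)[OF that] p_le[OF that, of 0 k0] k0 by simp
    show "e \<le> f k" if "k \<in> K" for k
    proof -
      have kE: "k \<in> E" "-k \<in> E" using that K subspace_neg[OF E] by auto
      have "f ((-1) *\<^sub>R k) = (-1) *\<^sub>R f k" using f(1) kE unfolding linear_map_on_def by blast
      moreover have "f (-k) \<le> S (-k + 1 *\<^sub>R k) - 1 * e"
        using f(2)[OF kE(2)] p_le[OF kE(2), of 1 k] that by simp
      ultimately show ?thesis using sublinear_on_zero[OF E S] by simp
    qed
  qed
qed

section \<open>Functionals on bounded functions and their total variation\<close>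

text \<open>
  A charge that is merely monotone, subadditive and superadditive on disjoint sets suffices: if all
  intersections with later sets became negligible, the measures of the union would add up beyond the
  bound.
\<close>

lemma charge_intersections:
  fixes m :: "'a set \<Rightarrow> real" and D :: "nat \<Rightarrow> 'a set"
  assumes mono: "\<And>A B. A \<subseteq> B \<Longrightarrow> m A \<le> m B" and m0: "m {} = 0" and m1: "m UNIV \<le> 1"
    and sub: "\<And>A B. m (A \<union> B) \<le> m A + m B"
    and super: "\<And>A B. A \<inter> B = {} \<Longrightarrow> m A + m B \<le> m (A \<union> B)"
    and \<delta>: "\<delta> > 0" and D: "\<And>n. \<delta> \<le> m (D n)"
  obtains r :: "nat \<Rightarrow> nat" where "strict_mono r" "\<And>n. (\<Inter>i\<le>n. D (r i)) \<noteq> {}"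
proof -
  obtain U where U: "ultrafilter U" "U \<le> sequentially" by (rule ultrafilter_sequentially)
  have ev_gt: "eventually (\<lambda>n. N < n) U" for N
    using eventually_gt_at_top U(2) by (rule filter_leD[rotated])
  have Unb: "U \<noteq> bot" by (rule ultrafilter_not_bot[OF U(1)])
  \<comment> \<open>\<open>Q E\<close> says that \<open>E\<close> meets almost all
    \<open>D n\<close> in charge bounded away from 0. The intersections to be constructed are kept
    inside this class.\<close>
  define Q where "Q E \<longleftrightarrow> (\<exists>\<eta>>0. eventually (\<lambda>n. \<eta> \<le> m (E \<inter> D n)) U)" for E
  have notQ: "eventually (\<lambda>n. m (E \<inter> D n) < \<eta>) U" if "\<not> Q E" "\<eta> > 0" for E \<eta>
  proof -
    have "\<not> eventually (\<lambda>n. \<eta> \<le> m (E \<inter> D n)) U" using that by (auto simp: Q_def)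
    then show ?thesis
      unfolding ultrafilter_not_eventually[OF U(1)] by (simp add: not_le)
  qed
  have step: "\<exists>n>N. Q (E \<inter> D n)" if QE: "Q E" for E N
  proof (rule ccontr)
    assume no: "\<not> (\<exists>n>N. Q (E \<inter> D n))"
    obtain \<eta> where \<eta>: "\<eta> > 0" "eventually (\<lambda>n. \<eta> \<le> m (E \<inter> D n)) U" using QE by (auto simp: Q_def)
    have "\<exists>B. B \<subseteq> E \<and> \<not> Q B \<and> real L * (\<eta> / 2) \<le> m B" for L :: nat
    proof (induction L)
      case 0
      have "\<not> Q {}"
        using Unb by (auto simp: Q_def m0 eventually_False)
      then show ?case using m0 by (intro exI[of _ "{}"]) auto
    next
      case (Suc L)
      then obtain B where B: "B \<subseteq> E" "\<not> Q B" "real L * (\<eta> / 2) \<le> m B" by blast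
      have "eventually (\<lambda>n. N < n \<and> \<eta> \<le> m (E \<inter> D n) \<and> m (B \<inter> D n) < \<eta> / 2) U"
        using ev_gt[of N] \<eta>(2) notQ[OF B(2), of "\<eta>/2"] \<eta>(1) by (simp add: eventually_conj)
      then obtain n where n: "N < n" "\<eta> \<le> m (E \<inter> D n)" "m (B \<inter> D n) < \<eta> / 2"
        using eventually_happens'[OF Unb] by blast
      \<comment> \<open>The part of \<open>E \<inter> D n\<close> outside \<open>B\<close> still
        carries \<eta> / 2, because \<open>B\<close> takes less than \<eta> / 2 of the charge of at
        least \<eta>.\<close>
      define C where "C = E \<inter> D n - B"
      have "m (E \<inter> D n) \<le> m (C \<union> (B \<inter> D n))" by (rule mono) (auto simp: C_def)
      also have "\<dots> \<le> m C + m (B \<inter> D n)" by (rule sub)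
      finally have "\<eta> / 2 \<le> m C" using n by linarith
      moreover have "m B + m C \<le> m (B \<union> C)" by (rule super) (auto simp: C_def)
      ultimately have "real (Suc L) * (\<eta> / 2) \<le> m (B \<union> C)" using B(3) by (simp add: algebra_simps)
      \<comment> \<open>\<open>C\<close> lies in \<open>E \<inter> D n\<close>, for which
        \<open>Q\<close> fails by assumption; the failure of \<open>Q\<close> passes to unions by
        subadditivity.\<close>
      moreover have "\<not> Q (B \<union> C)"
      proof
        assume "Q (B \<union> C)"
        then obtain \<theta> where \<theta>: "\<theta> > 0" "eventually (\<lambda>k. \<theta> \<le> m ((B \<union> C) \<inter> D k)) U"
          by (auto simp: Q_def)
        have nQ: "\<not> Q (E \<inter> D n)" using no n(1) by blast
        have "eventually (\<lambda>k. \<theta> \<le> m ((B \<union> C) \<inter> D k) \<and> m (B \<inter> D k) < \<theta> / 2 \<and>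
            m (E \<inter> D n \<inter> D k) < \<theta> / 2) U"
          using \<theta> notQ[OF B(2), of "\<theta>/2"] notQ[OF nQ, of "\<theta>/2"] by (simp add: eventually_conj)
        then obtain k where k: "\<theta> \<le> m ((B \<union> C) \<inter> D k)" "m (B \<inter> D k) < \<theta> / 2"
            "m (E \<inter> D n \<inter> D k) < \<theta> / 2"
          using eventually_happens'[OF Unb] by blast
        have "m ((B \<union> C) \<inter> D k) \<le> m ((B \<inter> D k) \<union> (E \<inter> D n \<inter> D k))"
          by (rule mono) (auto simp: C_def)
        also have "\<dots> \<le> m (B \<inter> D k) + m (E \<inter> D n \<inter> D k)" by (rule sub)
        finally show False using k by linarith
      qed
      moreover have "B \<union> C \<subseteq> E" using B(1) by (auto simp: C_def)
      ultimately show ?case by blast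
    qed
    moreover obtain L :: nat where "2 / \<eta> < real L" using reals_Archimedean2 by blast
    then have "1 < real L * (\<eta> / 2)" using \<eta>(1) by (simp add: field_simps)
    ultimately obtain B where "1 < m B" by (meson less_le_trans)
    with mono[of B UNIV] m1 show False by simp
  qed
  have "Q UNIV" using \<delta> D by (auto simp: Q_def)
  \<comment> \<open>The state of the recursion is the last index used together with the intersection
    reached so far.\<close>
  have "\<exists>s. \<forall>n. Q (snd (s n)) \<and> (fst (s n) < fst (s (Suc n)) \<and>
      snd (s (Suc n)) = snd (s n) \<inter> D (fst (s (Suc n))))"
  proof (rule dependent_nat_choice)
    show "\<exists>x::nat \<times> 'a set. Q (snd x)" using \<open>Q UNIV\<close> by auto
    fix x :: "nat \<times> 'a set" and n assume "Q (snd x)"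
    then obtain k where "fst x < k" "Q (snd x \<inter> D k)" using step by blast
    then show "\<exists>y. Q (snd y) \<and> fst x < fst y \<and> snd y = snd x \<inter> D (fst y)"
      by (intro exI[of _ "(k, snd x \<inter> D k)"]) auto
  qed
  then obtain s where s: "\<And>n. Q (snd (s n))" "\<And>n. fst (s n) < fst (s (Suc n))"
    "\<And>n. snd (s (Suc n)) = snd (s n) \<inter> D (fst (s (Suc n)))" by blast
  define r where "r n = fst (s (Suc n))" for n
  have "strict_mono r" unfolding r_def strict_mono_Suc_iff using s(2) by blast
  moreover have "(\<Inter>i\<le>n. D (r i)) \<noteq> {}" for n
  proof -
    have "snd (s (Suc n)) \<subseteq> (\<Inter>i\<le>n. D (r i))"
    proof (induction n)
      case 0 then show ?case using s(3)[of 0] by (auto simp: r_def)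
    next
      case (Suc n) then show ?case using s(3)[of "Suc n"] by (auto simp: r_def atMost_Suc)
    qed
    moreover have "snd (s (Suc n)) \<noteq> {}"
    proof
      assume "snd (s (Suc n)) = {}"
      then have "Q {}" using s(1)[of "Suc n"] by simp
      then show False using Unb by (auto simp: Q_def m0 eventually_False)
    qed
    ultimately show ?thesis by blast
  qed
  ultimately show ?thesis using that by blast
qed

section \<open>Bounded functions and the unit ball of their dual\<close>

definition bfun :: "('a \<Rightarrow> real) set" where
  "bfun = {u. \<exists>c. \<forall>x. \<bar>u x\<bar> \<le> c}"

lemma bfunI: "(\<And>x. \<bar>u x\<bar> \<le> c) \<Longrightarrow> u \<in> bfun"
  by (auto simp: bfun_def)

lemma subspace_bfun: "subspace bfun"
  unfolding subspace_def
proof (intro conjI allI ballI)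
  show "0 \<in> bfun" by (rule bfunI[of _ 0]) simp
  fix u v :: "'a \<Rightarrow> real" and c :: real assume "u \<in> bfun" "v \<in> bfun"
  then obtain a b where ab: "\<And>x. \<bar>u x\<bar> \<le> a" "\<And>x. \<bar>v x\<bar> \<le> b" by (auto simp: bfun_def)
  show "u + v \<in> bfun"
  proof (rule bfunI)
    fix x show "\<bar>(u + v) x\<bar> \<le> a + b" using ab[of x] by simp
  qed
next
  fix u :: "'a \<Rightarrow> real" and c :: real assume "u \<in> bfun"
  then obtain a where a: "\<And>x. \<bar>u x\<bar> \<le> a" by (auto simp: bfun_def)
  show "c *\<^sub>R u \<in> bfun"
    by (rule bfunI[of _ "\<bar>c\<bar> * a"]) (simp add: scaleR_fun_def abs_mult a mult_left_mono)
qed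

text \<open>The unit ball of the dual of the bounded functions. Quantifying over bounds
  \<open>c\<close> replaces the supremum norm.\<close>

definition contraction :: "(('a \<Rightarrow> real) \<Rightarrow> real) \<Rightarrow> bool" where
  "contraction \<psi> \<longleftrightarrow> linear_map_on bfun \<psi> \<and> (\<forall>u c. (\<forall>x. \<bar>u x\<bar> \<le> c) \<longrightarrow> \<bar>\<psi> u\<bar> \<le> c)"

lemma linear_map_on_diff:
  "subspace X \<Longrightarrow> linear_map_on X f \<Longrightarrow> x \<in> X \<Longrightarrow> y \<in> X \<Longrightarrow> f (x - y) = f x - (f y :: 'b::real_vector)"
  using subspace_scale[of X y "-1"] unfolding linear_map_on_def
  by (metis (no_types, lifting) add_uminus_conv_diff scaleR_minus1_left)

lemma contraction_bound: "contraction \<psi> \<Longrightarrow> (\<And>x. \<bar>u x\<bar> \<le> c) \<Longrightarrow> \<bar>\<psi> u\<bar> \<le> c"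
  by (simp add: contraction_def)

lemma contraction_add: "contraction \<psi> \<Longrightarrow> u \<in> bfun \<Longrightarrow> v \<in> bfun \<Longrightarrow> \<psi> (u + v) = \<psi> u + \<psi> v"
  and contraction_scale: "contraction \<psi> \<Longrightarrow> u \<in> bfun \<Longrightarrow> \<psi> (c *\<^sub>R u) = c * \<psi> u"
  and contraction_diff: "contraction \<psi> \<Longrightarrow> u \<in> bfun \<Longrightarrow> v \<in> bfun \<Longrightarrow> \<psi> (u - v) = \<psi> u - \<psi> v"
  by (auto simp: contraction_def linear_map_on_def linear_map_on_diff[OF subspace_bfun])

lemma contraction_zero: "contraction \<psi> \<Longrightarrow> \<psi> 0 = 0"
  using contraction_scale[of \<psi> 0 0] subspace_0[OF subspace_bfun] by simp

text \<open>The absolute value of \<open>\<psi>\<close> in the dual Banach lattice, evaluated at the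
  indicator of \<open>A\<close>. Seen as a finitely additive measure it supplies the charge to which
  \<open>charge_intersections\<close> is applied.\<close>

definition total_variation :: "(('a \<Rightarrow> real) \<Rightarrow> real) \<Rightarrow> 'a set \<Rightarrow> real" where
  "total_variation \<psi> A = (SUP u\<in>{u. \<forall>x. \<bar>u x\<bar> \<le> indicator A x}. \<psi> u)"

context
  fixes \<psi> :: "('a \<Rightarrow> real) \<Rightarrow> real"
  assumes \<psi>: "contraction \<psi>"
begin

private abbreviation (input) "below A \<equiv> {u :: 'a \<Rightarrow> real. \<forall>x. \<bar>u x\<bar> \<le> indicator A x}"

lemma below_bfun: "u \<in> below A \<Longrightarrow> u \<in> bfun"
  by (rule bfunI[of _ 1]) (auto simp: indicator_def of_bool_def intro: order_trans)

lemma below_le_1: "u \<in> below A \<Longrightarrow> \<psi> u \<le> 1"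
  using contraction_bound[OF \<psi>, of u 1] by (force simp: indicator_def of_bool_def split: if_splits)

lemma total_variation_upper: "u \<in> below A \<Longrightarrow> \<psi> u \<le> total_variation \<psi> A"
  unfolding total_variation_def
  by (rule cSUP_upper) (auto intro!: bdd_aboveI2[of _ _ 1] below_le_1)

lemma total_variation_least:
  assumes "\<And>u. u \<in> below A \<Longrightarrow> \<psi> u \<le> c"
  shows "total_variation \<psi> A \<le> c"
  unfolding total_variation_def
proof (rule cSUP_least)
  have "(\<lambda>x. 0) \<in> below A" by simp
  then show "below A \<noteq> {}" by (metis empty_iff)
qed (use assms in simp)

lemma total_variation_UNIV: "total_variation \<psi> UNIV \<le> 1"
  by (rule total_variation_least) (rule below_le_1)

lemma total_variation_empty: "total_variation \<psi> {} = 0"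
proof (rule antisym)
  have "(\<lambda>x. 0) = (0 :: 'a \<Rightarrow> real)" by (simp add: fun_eq_iff)
  then show "0 \<le> total_variation \<psi> {}"
    using total_variation_upper[of "\<lambda>x. 0" "{}"] contraction_zero[OF \<psi>] by simp
  show "total_variation \<psi> {} \<le> 0"
    using contraction_bound[OF \<psi>, of _ 0] by (intro total_variation_least) (auto simp: abs_le_iff)
qed

lemma total_variation_mono: "A \<subseteq> B \<Longrightarrow> total_variation \<psi> A \<le> total_variation \<psi> B"
proof (rule total_variation_least, rule total_variation_upper)
  fix u :: "'a \<Rightarrow> real" assume "A \<subseteq> B" "u \<in> below A"
  then show "u \<in> below B" by (auto simp: indicator_def of_bool_def split: if_splits)
qed

lemma total_variation_subadditive:
  "total_variation \<psi> (A \<union> B) \<le> total_variation \<psi> A + total_variation \<psi> B"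
proof (rule total_variation_least)
  fix u assume u: "u \<in> below (A \<union> B)"
  define v w where "v x = u x * indicator A x" and "w x = u x * indicator (- A) x" for x
  have vw: "v \<in> below A" "w \<in> below B"
    using u by (auto simp: v_def w_def indicator_def of_bool_def split: if_splits)
  have "u = v + w" by (auto simp: v_def w_def fun_eq_iff indicator_def)
  then have "\<psi> u = \<psi> v + \<psi> w" using contraction_add[OF \<psi>] vw[THEN below_bfun] by simp
  also have "\<dots> \<le> total_variation \<psi> A + total_variation \<psi> B"
    by (intro add_mono total_variation_upper vw)
  finally show "\<psi> u \<le> total_variation \<psi> A + total_variation \<psi> B" .
qed

lemma total_variation_superadditive:
  assumes "A \<inter> B = {}"
  shows "total_variation \<psi> A + total_variation \<psi> B \<le> total_variation \<psi> (A \<union> B)"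
proof -
  have "\<psi> u + \<psi> v \<le> total_variation \<psi> (A \<union> B)" if uv: "u \<in> below A" "v \<in> below B" for u v
  proof -
    have "u + v \<in> below (A \<union> B)"
    proof safe
      fix x
      have "\<bar>u x\<bar> \<le> indicator A x" "\<bar>v x\<bar> \<le> indicator B x" using uv by auto
      then show "\<bar>(u + v) x\<bar> \<le> indicator (A \<union> B) x"
        using assms by (auto simp: indicator_def of_bool_def split: if_splits)
    qed
    then show ?thesis
      using total_variation_upper contraction_add[OF \<psi> below_bfun[OF uv(1)] below_bfun[OF uv(2)]]
      by metis
  qed
  then have "\<psi> u \<le> total_variation \<psi> (A \<union> B) - \<psi> v" if "u \<in> below A" "v \<in> below B" for u v
    using that by (simp add: algebra_simps)
  then have "total_variation \<psi> A \<le> total_variation \<psi> (A \<union> B) - \<psi> v" if "v \<in> below B" for v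
    using that by (intro total_variation_least) blast
  then have "total_variation \<psi> B \<le> total_variation \<psi> (A \<union> B) - total_variation \<psi> A"
    by (intro total_variation_least) (simp add: algebra_simps)
  then show ?thesis by simp
qed

text \<open>A Chebyshev estimate. The part of \<open>u\<close> below e / 2 contributes at most e / 2
  to \<open>\<psi> u\<close>; the rest, divided by \<open>c\<close> to fit under the indicator and
  multiplied by the sign of \<open>\<psi> u\<close>, is a test function of value at least e / (2 *
  c).\<close>

lemma total_variation_large:
  assumes c: "c > 0" "\<And>x. \<bar>u x\<bar> \<le> c" and e: "e > 0" "e \<le> \<bar>\<psi> u\<bar>"
  shows "e / (2 * c) \<le> total_variation \<psi> {x. e / 2 \<le> \<bar>u x\<bar>}"
proof -
  define A where "A = {x. e / 2 \<le> \<bar>u x\<bar>}"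
  define s where "s = sgn (\<psi> u)"
  define v w where "v x = (s / c) * u x * indicator A x" and "w x = u x * indicator (- A) x" for x
  have s: "\<bar>s\<bar> = 1" "s * \<psi> u = \<bar>\<psi> u\<bar>" using e by (auto simp: s_def sgn_if)
  have "\<bar>v x\<bar> \<le> indicator A x" for x
    using s c(1) c(2)[of x] by (auto simp: v_def indicator_def abs_mult)
  then have v: "v \<in> below A" by blast
  have w: "\<bar>w x\<bar> \<le> e / 2" for x
    using e by (auto simp: w_def indicator_def A_def)
  have wb: "w \<in> bfun" using w by (rule bfunI)
  have vb: "v \<in> bfun" using below_bfun[OF v] .
  have "s * s = 1" using s(1) by (metis abs_mult_self_eq mult_1)
  then have "s *\<^sub>R u = c *\<^sub>R v + s *\<^sub>R w"
    using c(1) by (auto simp: fun_eq_iff scaleR_fun_def v_def w_def indicator_def)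
  moreover have "u \<in> bfun" using c(2) by (rule bfunI)
  ultimately have "s * \<psi> u = c * \<psi> v + s * \<psi> w"
    using contraction_add[OF \<psi>, of "c *\<^sub>R v" "s *\<^sub>R w"] contraction_scale[OF \<psi>] wb vb
      subspace_scale[OF subspace_bfun] by metis
  moreover have "s * \<psi> w \<le> e / 2"
    using contraction_bound[OF \<psi>, of w "e/2"] w s(1)
    by (metis abs_ge_self abs_mult mult_1 order_trans)
  ultimately have "e / 2 \<le> c * \<psi> v" using s(2) e(2) by linarith
  also have "\<dots> \<le> c * total_variation \<psi> A"
    using total_variation_upper[OF v] c(1) by (intro mult_left_mono) auto
  finally show ?thesis using c(1) by (simp add: A_def field_simps)
qed

end

section \<open>Weak compactness from the double limit condition\<close>

text \<open>Grothendieck's interchange of double limits. Convergence of all the limits is a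
  hypothesis, so no conventional value of \<open>Lim\<close> enters. Only the first variable is
  restricted to a set, since it will later run through functionals that must be
  contractions.\<close>

definition double_limits :: "'a set \<Rightarrow> ('a \<Rightarrow> 'b \<Rightarrow> real) \<Rightarrow> bool" where
  "double_limits A k \<longleftrightarrow>
     (\<forall>(a :: nat \<Rightarrow> 'a) (b :: nat \<Rightarrow> 'b) U V \<alpha> \<beta> l l'.
        range a \<subseteq> A \<and> ultrafilter U \<and> ultrafilter V \<and>
        (\<forall>n. ((\<lambda>m. k (a n) (b m)) \<longlongrightarrow> \<alpha> n) V) \<and> (\<alpha> \<longlongrightarrow> l) U \<and>
        (\<forall>m. ((\<lambda>n. k (a n) (b m)) \<longlongrightarrow> \<beta> m) U) \<and> (\<beta> \<longlongrightarrow> l') V \<longrightarrow> l = l')"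

lemma double_limitsD:
  fixes a :: "nat \<Rightarrow> 'a" and b :: "nat \<Rightarrow> 'b"
  assumes "double_limits A k" "range a \<subseteq> A" "ultrafilter U" "ultrafilter V"
    and "\<And>n. ((\<lambda>m. k (a n) (b m)) \<longlongrightarrow> \<alpha> n) V" "(\<alpha> \<longlongrightarrow> l) U"
    and "\<And>m. ((\<lambda>n. k (a n) (b m)) \<longlongrightarrow> \<beta> m) U" "(\<beta> \<longlongrightarrow> l') V"
  shows "l = l'"
  by (rule assms(1)[unfolded double_limits_def, rule_format, of a U V b \<alpha> l \<beta> l'])
    (intro conjI allI assms)

lemma tendsto_abs_le:
  fixes f :: "'a \<Rightarrow> real"
  assumes "(f \<longlongrightarrow> l) F" "F \<noteq> bot" "eventually (\<lambda>x. \<bar>f x\<bar> \<le> c) F"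
  shows "\<bar>l\<bar> \<le> c"
  by (rule tendsto_upperbound[OF tendsto_rabs[OF assms(1)] assms(3,2)])

lemma tendsto_le_abs:
  fixes f :: "'a \<Rightarrow> real"
  assumes "(f \<longlongrightarrow> l) F" "F \<noteq> bot" "eventually (\<lambda>x. c \<le> \<bar>f x\<bar>) F"
  shows "c \<le> \<bar>l\<bar>"
  by (rule tendsto_lowerbound[OF tendsto_rabs[OF assms(1)] assms(3,2)])

text \<open>
  If convergence failed, a sequence \<open>a n\<close> with \<open>k (a n) - h\<close> large on sets of large variation could
  be chosen along the filter, each new term being small at witnesses for all nonempty intersections
  of earlier such sets. Witnesses for the intersections along a subsequence then violate the double
  limit condition.
\<close>

lemma contraction_continuous:
  fixes k :: "'a \<Rightarrow> 'b \<Rightarrow> real"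
  assumes \<psi>: "contraction \<psi>" and dl: "double_limits A k"
    and c: "\<And>a b. a \<in> A \<Longrightarrow> \<bar>k a b\<bar> \<le> c"
    and F: "ultrafilter F" and FA: "eventually (\<lambda>a. a \<in> A) F"
    and h: "\<And>b. ((\<lambda>a. k a b) \<longlongrightarrow> h b) F"
  shows "((\<lambda>a. \<psi> (k a)) \<longlongrightarrow> \<psi> h) F"
proof (rule ccontr)
  assume "\<not> ?thesis"
  then obtain e where e: "e > 0" "\<not> eventually (\<lambda>a. dist (\<psi> (k a)) (\<psi> h) < e) F"
    unfolding tendsto_iff by blast
  have Fnb: "F \<noteq> bot" by (rule ultrafilter_not_bot[OF F])
  have h_le: "\<bar>h b\<bar> \<le> c" for b
    by (rule tendsto_abs_le[OF h Fnb]) (use FA in eventually_elim, use c in blast)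
  define g where "g a = k a - h" for a
  define C where "C = 2 * (\<bar>c\<bar> + 1)"
  have C: "C > 0" by (simp add: C_def)
  have g_le: "\<bar>g a b\<bar> \<le> C" if "a \<in> A" for a b
    using c[OF that, of b] h_le[of b] by (simp add: g_def C_def)
  have \<psi>g: "\<psi> (g a) = \<psi> (k a) - \<psi> h" if "a \<in> A" for a
    unfolding g_def using c[OF that] h_le
    by (intro contraction_diff[OF \<psi>] bfunI[of _ c])
  have large: "eventually (\<lambda>a. a \<in> A \<and> e \<le> \<bar>\<psi> (g a)\<bar>) F"
    using e(2)[unfolded ultrafilter_not_eventually[OF F]] FA
    by eventually_elim (simp add: \<psi>g dist_real_def)
  have g0: "eventually (\<lambda>a. \<bar>g a b\<bar> < \<eta>) F" if "\<eta> > 0" for b \<eta>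
    using tendstoD[OF h that, of b] by (simp add: g_def dist_real_def)
  \<comment> \<open>A common witness of largeness for all members of \<open>T\<close>, arbitrary if
    there is none. It is fixed for every \<open>T\<close> in advance because the subsequence is
    selected only afterwards, so \<open>P\<close> must control the witnesses of all subsets of the
    earlier terms.\<close>
  define y where "y T = (SOME b. \<forall>a\<in>T. e / 2 \<le> \<bar>g a b\<bar>)" for T
  define P where "P f n r \<longleftrightarrow> r \<in> A \<and> e \<le> \<bar>\<psi> (g r)\<bar> \<and>
      (\<forall>T\<in>Pow (f ` {..<n}). \<bar>g r (y T)\<bar> < 1 / (real n + 1))" for f n r
  have "\<exists>a. \<forall>n::nat. P a n (a n)"
  proof (rule dependent_wellorder_choice)
    show "P f n r = P f' n r" if "\<And>m. m < n \<Longrightarrow> f m = f' m" for f f' n r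
    proof -
      have "f ` {..<n} = f' ` {..<n}" using that by (intro image_cong) auto
      then show ?thesis by (simp only: P_def)
    qed
    show "\<exists>r. P f n r" for n f
    proof -
      have "eventually (\<lambda>a. \<forall>T\<in>Pow (f ` {..<n}). \<bar>g a (y T)\<bar> < 1 / (real n + 1)) F"
        by (rule eventually_ball_finite) (auto intro!: g0)
      with large have "eventually (P f n) F"
        by eventually_elim (auto simp: P_def)
      then show ?thesis using eventually_happens'[OF Fnb] by blast
    qed
  qed
  then obtain a where a: "\<And>n. a n \<in> A" "\<And>n. e \<le> \<bar>\<psi> (g (a n))\<bar>"
    "\<And>n T. T \<subseteq> a ` {..<n} \<Longrightarrow> \<bar>g (a n) (y T)\<bar> < 1 / (real n + 1)"
    unfolding P_def by blast
  define D where "D n = {b. e / 2 \<le> \<bar>g (a n) b\<bar>}" for n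
  have D: "e / (2 * C) \<le> total_variation \<psi> (D n)" for n
    unfolding D_def by (rule total_variation_large[OF \<psi> C g_le[OF a(1)] e(1) a(2)])
  have "\<exists>r :: nat \<Rightarrow> nat. strict_mono r \<and> (\<forall>n. (\<Inter>i\<le>n. D (r i)) \<noteq> {})"
  proof (rule charge_intersections[of "total_variation \<psi>" "e / (2 * C)" D])
    show "e / (2 * C) > 0" using e C by simp
    fix r :: "nat \<Rightarrow> nat" assume "strict_mono r" "\<And>n. (\<Inter>i\<le>n. D (r i)) \<noteq> {}"
    then show "\<exists>r :: nat \<Rightarrow> nat. strict_mono r \<and> (\<forall>n. (\<Inter>i\<le>n. D (r i)) \<noteq> {})"
      by (intro exI[of _ r] conjI allI)
  qed (rule D total_variation_empty[OF \<psi>] total_variation_UNIV[OF \<psi>]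
      total_variation_subadditive[OF \<psi>]
      | erule total_variation_mono[OF \<psi>] total_variation_superadditive[OF \<psi>])+
  then obtain r :: "nat \<Rightarrow> nat"
    where r: "strict_mono r" "\<forall>n. (\<Inter>i\<le>n. D (r i)) \<noteq> {}" by (elim exE conjE)
  define b where "b J = y (a ` r ` {..J})" for J :: nat
  have b: "e / 2 \<le> \<bar>g (a (r j)) (b J)\<bar>" if "j \<le> J" for j J
  proof -
    have "\<exists>b. \<forall>a\<in>a ` r ` {..J}. e / 2 \<le> \<bar>g a b\<bar>" using spec[OF r(2), of J] by (auto simp: D_def)
    from someI_ex[OF this] show ?thesis using that by (auto simp: b_def y_def)
  qed
  obtain U where U: "ultrafilter U" "U \<le> sequentially" by (rule ultrafilter_sequentially)
  have Unb: "U \<noteq> bot" by (rule ultrafilter_not_bot[OF U(1)])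
  \<comment> \<open>For j > J the term \<open>a (r j)\<close> was chosen small at
    \<open>b J\<close>, which is a witness for a set of earlier terms.\<close>
  have lim_j: "((\<lambda>j. k (a (r j)) (b J)) \<longlongrightarrow> h (b J)) U" for J
  proof (rule tendsto_mono[OF U(2)])
    have "((\<lambda>j. g (a (r j)) (b J)) \<longlongrightarrow> 0) sequentially"
    proof (rule tendsto_rabs_zero_cancel,
        rule tendsto_sandwich[where f = "\<lambda>_. 0" and h = "\<lambda>j. 1 / (real j + 1)"])
      show "((\<lambda>j. 1 / (real j + 1)) \<longlongrightarrow> 0) sequentially"
        using LIMSEQ_inverse_real_of_nat by (simp add: inverse_eq_divide add.commute)
      show "eventually (\<lambda>j. \<bar>g (a (r j)) (b J)\<bar> \<le> 1 / (real j + 1)) sequentially"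
        using eventually_gt_at_top[of J]
      proof eventually_elim
        case (elim j)
        have "a ` r ` {..J} \<subseteq> a ` {..<r j}"
          using elim strict_monoD[OF r(1)] by (auto intro!: imageI intro: le_less_trans)
        then have "\<bar>g (a (r j)) (b J)\<bar> < 1 / (real (r j) + 1)" unfolding b_def by (rule a(3))
        also have "\<dots> \<le> 1 / (real j + 1)"
          using seq_suble[OF r(1), of j] by (intro divide_left_mono) auto
        finally show ?case by simp
      qed
    qed auto
    from tendsto_add[OF this tendsto_const[of "h (b J)"]]
    show "((\<lambda>j. k (a (r j)) (b J)) \<longlongrightarrow> h (b J)) sequentially" by (simp add: g_def)
  qed
  obtain \<beta> where \<beta>: "((\<lambda>J. h (b J)) \<longlongrightarrow> \<beta>) U"
    using ultrafilter_bounded_limit[OF U(1), of "\<lambda>J. h (b J)" c] h_le by auto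
  have "\<exists>\<gamma>. \<forall>j. \<bar>\<gamma> j\<bar> \<le> c \<and> ((\<lambda>J. k (a (r j)) (b J)) \<longlongrightarrow> \<gamma> j) U"
  proof (intro choice allI)
    fix j
    show "\<exists>y. \<bar>y\<bar> \<le> c \<and> ((\<lambda>J. k (a (r j)) (b J)) \<longlongrightarrow> y) U"
      using ultrafilter_bounded_limit[OF U(1), of "\<lambda>J. k (a (r j)) (b J)" c] c[OF a(1)] by auto
  qed
  then obtain \<gamma> where \<gamma>: "\<And>j. \<bar>\<gamma> j\<bar> \<le> c" "\<And>j. ((\<lambda>J. k (a (r j)) (b J)) \<longlongrightarrow> \<gamma> j) U"
    by blast
  \<comment> \<open>In the other order \<open>j\<close> is fixed while \<open>J\<close> eventually
    exceeds it, so the gap e / 2 at the witnesses survives.\<close>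
  have \<gamma>\<beta>: "e / 2 \<le> \<bar>\<gamma> j - \<beta>\<bar>" for j
  proof (rule tendsto_le_abs[OF tendsto_diff[OF \<gamma>(2) \<beta>] Unb])
    show "eventually (\<lambda>J. e / 2 \<le> \<bar>k (a (r j)) (b J) - h (b J)\<bar>) U"
      using filter_leD[OF U(2) eventually_ge_at_top[of j]]
      by eventually_elim (use b in \<open>simp add: g_def\<close>)
  qed
  obtain l where l: "(\<gamma> \<longlongrightarrow> l) U"
    using ultrafilter_bounded_limit[OF U(1), of \<gamma> c] \<gamma>(1) by auto
  have "e / 2 \<le> \<bar>l - \<beta>\<bar>"
    by (rule tendsto_le_abs[OF tendsto_diff[OF l tendsto_const] Unb])
      (intro always_eventually allI \<gamma>\<beta>)
  moreover have "l = \<beta>"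
    by (rule double_limitsD[OF dl _ U(1) U(1) \<gamma>(2) l lim_j \<beta>]) (use a(1) in auto)
  ultimately show False using e(1) by simp
qed

text \<open>The Banach-Alaoglu theorem along an ultrafilter: pointwise limits exist on bounded
  functions and inherit linearity and all bounds. On unbounded functions the value of
  \<open>\<mu>\<close> is immaterial.\<close>

lemma contraction_limit:
  assumes U: "ultrafilter U" and M: "eventually (\<lambda>i. contraction (M i)) U"
  obtains \<mu> where "contraction \<mu>" "\<And>u. u \<in> bfun \<Longrightarrow> ((\<lambda>i. M i u) \<longlongrightarrow> \<mu> u) U"
proof -
  have Unb: "U \<noteq> bot" by (rule ultrafilter_not_bot[OF U])
  define \<mu> where "\<mu> u = Lim U (\<lambda>i. M i u)" for u
  have lim: "((\<lambda>i. M i u) \<longlongrightarrow> \<mu> u) U" if u: "u \<in> bfun" for u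
  proof -
    obtain c where c: "\<And>x. \<bar>u x\<bar> \<le> c" using u by (auto simp: bfun_def)
    have "eventually (\<lambda>i. \<bar>M i u\<bar> \<le> c) U"
      using M by eventually_elim (rule contraction_bound[OF _ c])
    from ultrafilter_bounded_limit[OF U this]
    obtain l where l: "((\<lambda>i. M i u) \<longlongrightarrow> l) U" by blast
    then show ?thesis using tendsto_Lim[OF Unb l] by (simp add: \<mu>_def)
  qed
  have "\<mu> (u + v) = \<mu> u + \<mu> v" if uv: "u \<in> bfun" "v \<in> bfun" for u v
  proof (rule tendsto_unique[OF Unb lim])
    show "u + v \<in> bfun" using uv by (rule subspace_add[OF subspace_bfun])
    have "((\<lambda>i. M i u + M i v) \<longlongrightarrow> \<mu> u + \<mu> v) U" using uv by (intro tendsto_add lim)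
    then show "((\<lambda>i. M i (u + v)) \<longlongrightarrow> \<mu> u + \<mu> v) U"
      by (rule Lim_transform_eventually)
        (use M in eventually_elim, simp add: contraction_add uv)
  qed
  moreover have "\<mu> (c *\<^sub>R u) = c *\<^sub>R \<mu> u" if u: "u \<in> bfun" for c u
  proof (rule tendsto_unique[OF Unb lim])
    show "c *\<^sub>R u \<in> bfun" using u by (rule subspace_scale[OF subspace_bfun])
    have "((\<lambda>i. c *\<^sub>R M i u) \<longlongrightarrow> c *\<^sub>R \<mu> u) U" using u by (intro tendsto_scaleR tendsto_const lim)
    then show "((\<lambda>i. M i (c *\<^sub>R u)) \<longlongrightarrow> c *\<^sub>R \<mu> u) U"
      by (rule Lim_transform_eventually)
        (use M in eventually_elim, simp add: contraction_scale u)
  qed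
  moreover have "\<bar>\<mu> u\<bar> \<le> c" if c: "\<And>x. \<bar>u x\<bar> \<le> c" for u c
    by (rule tendsto_abs_le[OF lim[OF bfunI[OF c]] Unb])
      (use M in eventually_elim, rule contraction_bound[OF _ c])
  ultimately have "contraction \<mu>" by (simp add: contraction_def linear_map_on_def)
  with lim that show ?thesis by blast
qed

text \<open>Elements of \<open>K\<close> are bounded by 1, so each ultrafilter on \<open>K\<close>
  has a pointwise limit. Requiring this limit to lie in \<open>K\<close> and to be respected by
  every contractive functional expresses weak compactness in the bounded functions.\<close>

definition weakly_compact_disc :: "('a \<Rightarrow> real) set \<Rightarrow> bool" where
  "weakly_compact_disc K \<longleftrightarrow> K \<noteq> {} \<and> convex K \<and> (\<forall>w\<in>K. - w \<in> K) \<and> (\<forall>w\<in>K. \<forall>x. \<bar>w x\<bar> \<le> 1) \<and>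
     (\<forall>F w0. ultrafilter F \<and> eventually (\<lambda>w. w \<in> K) F \<and> (\<forall>x. ((\<lambda>w. w x) \<longlongrightarrow> w0 x) F) \<longrightarrow>
        w0 \<in> K \<and> (\<forall>\<psi>. contraction \<psi> \<longrightarrow> (\<psi> \<longlongrightarrow> \<psi> w0) F))"

text \<open>The image of the dual unit ball under the transpose of \<open>k\<close>. It contains
  every section \<open>\<lambda>y. k y x\<close>, by evaluation at \<open>x\<close>, and it is
  convex, symmetric and pointwise closed without any hull or closure being taken.\<close>

definition contraction_image :: "('a \<Rightarrow> 'b \<Rightarrow> real) \<Rightarrow> ('a \<Rightarrow> real) set" where
  "contraction_image k = {\<lambda>y. \<mu> (k y) |\<mu>. contraction \<mu>}"

lemma contraction_imageI: "contraction \<mu> \<Longrightarrow> w = (\<lambda>y. \<mu> (k y)) \<Longrightarrow> w \<in> contraction_image k"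
  by (auto simp: contraction_image_def)

lemma contraction_eval: "contraction (\<lambda>u. u x)"
  by (simp add: contraction_def linear_map_on_def scaleR_fun_def)

text \<open>The functions \<open>k (y m)\<close> have a pointwise limit \<open>h\<close>, which
  every contraction respects by \<open>contraction_continuous\<close>, and the functionals
  \<open>\<mu> n\<close> have a limit \<open>\<nu>\<close> on bounded functions. Both iterated
  limits equal \<open>\<nu> h\<close>. This prepares a second use of
  \<open>contraction_continuous\<close>, with functionals as the first variable.\<close>

lemma double_limits_contractions:
  fixes k :: "'a \<Rightarrow> 'b \<Rightarrow> real"
  assumes dl: "double_limits UNIV k" and k: "\<And>x y. \<bar>k x y\<bar> \<le> c"
  shows "double_limits {\<mu>. contraction \<mu>} (\<lambda>\<mu> y. \<mu> (k y))"
  unfolding double_limits_def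
proof (intro allI impI, elim conjE)
  fix \<mu> :: "nat \<Rightarrow> ('b \<Rightarrow> real) \<Rightarrow> real" and y :: "nat \<Rightarrow> 'a" and U V \<alpha> \<beta> l l'
  assume \<mu>: "range \<mu> \<subseteq> {\<mu>. contraction \<mu>}" and U: "ultrafilter U" and V: "ultrafilter V"
    and \<alpha>: "\<forall>n. ((\<lambda>m. \<mu> n (k (y m))) \<longlongrightarrow> \<alpha> n) V" "(\<alpha> \<longlongrightarrow> l) U"
    and \<beta>: "\<forall>m. ((\<lambda>n. \<mu> n (k (y m))) \<longlongrightarrow> \<beta> m) U" "(\<beta> \<longlongrightarrow> l') V"
  have Unb: "U \<noteq> bot" and Vnb: "V \<noteq> bot" using U V by (simp_all add: ultrafilter_not_bot)
  have \<mu>c: "contraction (\<mu> n)" for n using \<mu> by auto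
  have "\<exists>h. \<forall>x. \<bar>h x\<bar> \<le> c \<and> ((\<lambda>m. k (y m) x) \<longlongrightarrow> h x) V"
  proof (intro choice allI)
    fix x
    show "\<exists>l. \<bar>l\<bar> \<le> c \<and> ((\<lambda>m. k (y m) x) \<longlongrightarrow> l) V"
      using ultrafilter_bounded_limit[OF V, of "\<lambda>m. k (y m) x" c] k by auto
  qed
  then obtain h where h: "\<And>x. \<bar>h x\<bar> \<le> c" "\<And>x. ((\<lambda>m. k (y m) x) \<longlongrightarrow> h x) V" by blast
  have cont: "((\<lambda>m. \<nu> (k (y m))) \<longlongrightarrow> \<nu> h) V" if "contraction \<nu>" for \<nu>
  proof -
    have "((\<lambda>b. \<nu> (k b)) \<longlongrightarrow> \<nu> h) (filtermap y V)"
      by (rule contraction_continuous[OF that dl k ultrafilter_filtermap[OF V]])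
        (use h(2) in \<open>simp_all add: filterlim_filtermap\<close>)
    then show ?thesis by (simp add: filterlim_filtermap)
  qed
  obtain \<nu> where \<nu>: "contraction \<nu>" "\<And>u. u \<in> bfun \<Longrightarrow> ((\<lambda>n. \<mu> n u) \<longlongrightarrow> \<nu> u) U"
    using contraction_limit[OF U, of \<mu>] \<mu>c by auto
  have "\<alpha> n = \<mu> n h" for n
    using tendsto_unique[OF Vnb _ cont[OF \<mu>c]] \<alpha>(1) by blast
  then have "\<alpha> = (\<lambda>n. \<mu> n h)" by blast
  then have "l = \<nu> h"
    using tendsto_unique[OF Unb \<alpha>(2)] \<nu>(2)[OF bfunI[OF h(1)]] by simp
  moreover have "\<beta> m = \<nu> (k (y m))" for m
    using tendsto_unique[OF Unb spec[OF \<beta>(1), of m] \<nu>(2)[OF bfunI[OF k]]] .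
  then have "\<beta> = (\<lambda>m. \<nu> (k (y m)))" by blast
  then have "l' = \<nu> h"
    using tendsto_unique[OF Vnb \<beta>(2)] cont[OF \<nu>(1)] by simp
  ultimately show "l = l'" by simp
qed

lemma weakly_compact_disc_contraction_image:
  fixes k :: "'a \<Rightarrow> 'b \<Rightarrow> real"
  assumes dl: "double_limits UNIV k" and k: "\<And>x y. \<bar>k x y\<bar> \<le> 1"
  shows "weakly_compact_disc (contraction_image k)"
proof -
  let ?K = "contraction_image k"
  have kb: "k y \<in> bfun" for y using k by (rule bfunI)
  have "?K \<noteq> {}" using contraction_imageI[OF contraction_eval[of undefined] refl, of k] by blast
  moreover have "convex ?K"
  proof (rule convexI)
    fix v w and s t :: real assume vw: "v \<in> ?K" "w \<in> ?K" and st: "0 \<le> s" "0 \<le> t" "s + t = 1"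
    obtain \<mu> \<nu> where \<mu>: "contraction \<mu>" "v = (\<lambda>y. \<mu> (k y))" and \<nu>: "contraction \<nu>" "w = (\<lambda>y. \<nu> (k y))"
      using vw by (auto simp: contraction_image_def)
    have "\<bar>s * \<mu> u + t * \<nu> u\<bar> \<le> c" if "\<forall>x. \<bar>u x\<bar> \<le> c" for u c
    proof -
      have "\<bar>s * \<mu> u + t * \<nu> u\<bar> \<le> s * \<bar>\<mu> u\<bar> + t * \<bar>\<nu> u\<bar>"
        using st by (metis abs_mult abs_of_nonneg abs_triangle_ineq)
      also have "\<dots> \<le> s * c + t * c"
        using st that contraction_bound[OF \<mu>(1)] contraction_bound[OF \<nu>(1)]
        by (intro add_mono mult_left_mono) auto
      finally show ?thesis using st by (simp add: distrib_right[symmetric])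
    qed
    then have "contraction (\<lambda>u. s * \<mu> u + t * \<nu> u)"
      using \<mu>(1) \<nu>(1) by (auto simp: contraction_def linear_map_on_def algebra_simps)
    moreover have "s *\<^sub>R v + t *\<^sub>R w = (\<lambda>y. s * \<mu> (k y) + t * \<nu> (k y))"
      by (simp add: fun_eq_iff scaleR_fun_def \<mu> \<nu>)
    ultimately show "s *\<^sub>R v + t *\<^sub>R w \<in> ?K"
      by (rule contraction_imageI[of "\<lambda>u. s * \<mu> u + t * \<nu> u"])
  qed
  moreover have "- w \<in> ?K" if w: "w \<in> ?K" for w
  proof -
    obtain \<mu> where \<mu>: "contraction \<mu>" "w = (\<lambda>y. \<mu> (k y))" using w by (auto simp: contraction_image_def)
    then have "contraction (\<lambda>u. - \<mu> u)" by (simp add: contraction_def linear_map_on_def)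
    moreover have "- w = (\<lambda>y. - \<mu> (k y))" by (simp add: fun_eq_iff \<mu>)
    ultimately show ?thesis by (rule contraction_imageI[of "\<lambda>u. - \<mu> u"])
  qed
  moreover have "\<bar>w x\<bar> \<le> 1" if "w \<in> ?K" for w x
    using that contraction_bound k by (fastforce simp: contraction_image_def)
  moreover have "w0 \<in> ?K \<and> (\<forall>\<psi>. contraction \<psi> \<longrightarrow> (\<psi> \<longlongrightarrow> \<psi> w0) F)"
    if F: "ultrafilter F" "eventually (\<lambda>w. w \<in> ?K) F" "\<forall>x. ((\<lambda>w. w x) \<longlongrightarrow> w0 x) F" for F w0
  proof -
    have Fnb: "F \<noteq> bot" by (rule ultrafilter_not_bot[OF F(1)])
    \<comment> \<open>Convergence of elements of the disc is lifted to the functionals representing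
      them, where compactness is available.\<close>
    have "\<exists>M. \<forall>w\<in>?K. contraction (M w) \<and> w = (\<lambda>y. M w (k y))"
      by (rule bchoice) (auto simp: contraction_image_def)
    then obtain M where M: "\<And>w. w \<in> ?K \<Longrightarrow> contraction (M w)" "\<And>w. w \<in> ?K \<Longrightarrow> w = (\<lambda>y. M w (k y))"
      by blast
    have evM: "eventually (\<lambda>w. contraction (M w)) F" using F(2) by eventually_elim (rule M)
    then obtain \<nu> where \<nu>: "contraction \<nu>" "\<And>u. u \<in> bfun \<Longrightarrow> ((\<lambda>w. M w u) \<longlongrightarrow> \<nu> u) F"
      using contraction_limit[OF F(1)] by blast
    have Mlim: "((\<lambda>w. M w (k y)) \<longlongrightarrow> w0 y) F" for y
      by (rule Lim_transform_eventually[OF F(3)[rule_format, of y]])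
        (use F(2) in eventually_elim, use M(2) in metis)
    have "w0 = (\<lambda>y. \<nu> (k y))"
      using tendsto_unique[OF Fnb Mlim \<nu>(2)[OF kb]] by (simp add: fun_eq_iff)
    then have "w0 \<in> ?K" using \<nu>(1) by (auto simp: contraction_image_def)
    moreover have "(\<psi> \<longlongrightarrow> \<psi> w0) F" if \<psi>: "contraction \<psi>" for \<psi>
    proof -
      have "((\<lambda>\<mu>. \<psi> (\<lambda>y. \<mu> (k y))) \<longlongrightarrow> \<psi> w0) (filtermap M F)"
      proof (rule contraction_continuous[OF \<psi> double_limits_contractions[OF dl k]])
        show "ultrafilter (filtermap M F)" by (rule ultrafilter_filtermap[OF F(1)])
        show "eventually (\<lambda>a. a \<in> {\<mu>. contraction \<mu>}) (filtermap M F)"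
          using evM by (simp add: eventually_filtermap)
        show "\<bar>a (k b)\<bar> \<le> 1" if "a \<in> {\<mu>. contraction \<mu>}" for a :: "('b \<Rightarrow> real) \<Rightarrow> real" and b
          using that contraction_bound k by blast
        show "((\<lambda>a. a (k b)) \<longlongrightarrow> w0 b) (filtermap M F)" for b
          using Mlim by (simp add: filterlim_filtermap)
      qed
      then have "((\<lambda>w. \<psi> (\<lambda>y. M w (k y))) \<longlongrightarrow> \<psi> w0) F" by (simp add: filterlim_filtermap)
      then show ?thesis
        by (rule Lim_transform_eventually) (use F(2) in eventually_elim, use M(2) in metis)
    qed
    ultimately show ?thesis by blast
  qed
  ultimately show ?thesis unfolding weakly_compact_disc_def by blast
qed

section \<open>Gauges of interpolation sums\<close>

text \<open>Up to scaling, \<open>gauge\<close> is the K-functional of real interpolation: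
  \<open>f\<close> is split into a multiple of a member of the disc and a bounded remainder, with
  weights \<alpha> and \<beta> on the two sizes.\<close>

definition gauge_le :: "('a \<Rightarrow> real) set \<Rightarrow> real \<Rightarrow> real \<Rightarrow> ('a \<Rightarrow> real) \<Rightarrow> real \<Rightarrow> bool" where
  "gauge_le K \<alpha> \<beta> f r \<longleftrightarrow>
     (\<exists>s t w. 0 \<le> s \<and> 0 \<le> t \<and> w \<in> K \<and> \<alpha> * s + \<beta> * t \<le> r \<and> (\<forall>x. \<bar>f x - s * w x\<bar> \<le> t))"

definition gauge :: "('a \<Rightarrow> real) set \<Rightarrow> real \<Rightarrow> real \<Rightarrow> ('a \<Rightarrow> real) \<Rightarrow> real" where
  "gauge K \<alpha> \<beta> f = Inf {r. gauge_le K \<alpha> \<beta> f r}"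

locale compact_disc =
  fixes K :: "('a \<Rightarrow> real) set" and \<alpha> \<beta> :: real
  assumes disc: "weakly_compact_disc K" and \<alpha>: "\<alpha> > 0" and \<beta>: "\<beta> > 0"
begin

lemma convex: "convex K"
  and nonempty: "K \<noteq> {}"
  and symmetric: "w \<in> K \<Longrightarrow> - w \<in> K"
  and bounded: "w \<in> K \<Longrightarrow> \<bar>w x\<bar> \<le> 1"
  and limit: "ultrafilter F \<Longrightarrow> eventually (\<lambda>w. w \<in> K) F \<Longrightarrow> (\<And>x. ((\<lambda>w. w x) \<longlongrightarrow> w0 x) F) \<Longrightarrow> w0 \<in> K"
  and functional_limit: "ultrafilter F \<Longrightarrow> eventually (\<lambda>w. w \<in> K) F \<Longrightarrow>
        (\<And>x. ((\<lambda>w. w x) \<longlongrightarrow> w0 x) F) \<Longrightarrow> contraction \<psi> \<Longrightarrow> (\<psi> \<longlongrightarrow> \<psi> w0) F"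
proof -
  note d = disc[unfolded weakly_compact_disc_def]
  show "convex K" "K \<noteq> {}" "w \<in> K \<Longrightarrow> - w \<in> K" "w \<in> K \<Longrightarrow> \<bar>w x\<bar> \<le> 1" using d by simp_all
  assume F: "ultrafilter F" "eventually (\<lambda>w. w \<in> K) F" "\<And>x. ((\<lambda>w. w x) \<longlongrightarrow> w0 x) F"
  then have "w0 \<in> K \<and> (\<forall>\<psi>. contraction \<psi> \<longrightarrow> (\<psi> \<longlongrightarrow> \<psi> w0) F)"
    by (intro d[THEN conjunct2, THEN conjunct2, THEN conjunct2, THEN conjunct2, rule_format] conjI allI)
  then show "w0 \<in> K" "contraction \<psi> \<Longrightarrow> (\<psi> \<longlongrightarrow> \<psi> w0) F" by simp_all
qed

lemma gauge_leI:
  "0 \<le> s \<Longrightarrow> 0 \<le> t \<Longrightarrow> w \<in> K \<Longrightarrow> \<alpha> * s + \<beta> * t \<le> r \<Longrightarrow> (\<And>x. \<bar>f x - s * w x\<bar> \<le> t) \<Longrightarrow> gauge_le K \<alpha> \<beta> f r"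
  unfolding gauge_le_def by blast

lemma gauge_leE:
  assumes "gauge_le K \<alpha> \<beta> f r"
  obtains s t w where "0 \<le> s" "0 \<le> t" "w \<in> K" "\<alpha> * s + \<beta> * t \<le> r" "\<And>x. \<bar>f x - s * w x\<bar> \<le> t"
  using assms unfolding gauge_le_def by blast

lemma gauge_le_nonneg: "gauge_le K \<alpha> \<beta> f r \<Longrightarrow> 0 \<le> r"
  using \<alpha> \<beta> by (elim gauge_leE) (meson add_nonneg_nonneg less_imp_le mult_nonneg_nonneg order_trans)

lemma gauge_le_mono: "gauge_le K \<alpha> \<beta> f r \<Longrightarrow> r \<le> r' \<Longrightarrow> gauge_le K \<alpha> \<beta> f r'"
  unfolding gauge_le_def by (meson order_trans)

lemma gauge_le_bound:
  assumes "\<And>x. \<bar>f x\<bar> \<le> c"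
  shows "gauge_le K \<alpha> \<beta> f (\<beta> * c)"
proof -
  obtain w where w: "w \<in> K" using nonempty by blast
  have "0 \<le> c" using assms[of undefined] by linarith
  then show ?thesis using w assms by (intro gauge_leI[of 0 c w]) auto
qed

text \<open>Decompositions form a compact family: the scalars stay bounded because \<open>r\<close>
  converges and both weights are positive, and the disc parts converge by weak compactness. The
  final inequalities give lower semicontinuity of the gauge; the convergence of
  \<open>\<psi> (w i)\<close> is kept for weak convergence in the interpolation space.\<close>

lemma gauge_le_decomposition:
  assumes F: "ultrafilter F" and ev: "eventually (\<lambda>i. gauge_le K \<alpha> \<beta> (u i) (r i)) F"
    and r: "(r \<longlongrightarrow> r0) F" and u: "\<And>x. ((\<lambda>i. u i x) \<longlongrightarrow> u0 x) F"
  obtains s t w s0 t0 w0 where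
    "eventually (\<lambda>i. 0 \<le> s i \<and> 0 \<le> t i \<and> w i \<in> K \<and> \<alpha> * s i + \<beta> * t i \<le> r i \<and>
       (\<forall>x. \<bar>u i x - s i * w i x\<bar> \<le> t i)) F"
    "(s \<longlongrightarrow> s0) F" "(t \<longlongrightarrow> t0) F" "\<And>x. ((\<lambda>i. w i x) \<longlongrightarrow> w0 x) F"
    "\<And>\<psi>. contraction \<psi> \<Longrightarrow> ((\<lambda>i. \<psi> (w i)) \<longlongrightarrow> \<psi> w0) F"
    "0 \<le> s0" "0 \<le> t0" "w0 \<in> K" "\<alpha> * s0 + \<beta> * t0 \<le> r0" "\<And>x. \<bar>u0 x - s0 * w0 x\<bar> \<le> t0"
proof -
  have Fnb: "F \<noteq> bot" by (rule ultrafilter_not_bot[OF F])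
  define P where "P i z \<longleftrightarrow> (case z of (s, t, w) \<Rightarrow> 0 \<le> s \<and> 0 \<le> t \<and> w \<in> K \<and>
      \<alpha> * s + \<beta> * t \<le> r i \<and> (\<forall>x. \<bar>u i x - s * w x\<bar> \<le> t))" for i and z :: "real \<times> real \<times> ('a \<Rightarrow> real)"
  \<comment> \<open>Where no decomposition exists the choice is arbitrary, so all properties of it
    hold only eventually.\<close>
  define z where "z i = (SOME z. P i z)" for i
  define s t w where "s i = fst (z i)" and "t i = fst (snd (z i))" and "w i = snd (snd (z i))" for i
  have "P i (z i)" if "gauge_le K \<alpha> \<beta> (u i) (r i)" for i
  proof -
    have "\<exists>z. P i z" using that by (auto simp: gauge_le_def P_def)
    then show ?thesis unfolding z_def by (rule someI_ex)
  qed
  then have ev: "eventually (\<lambda>i. 0 \<le> s i \<and> 0 \<le> t i \<and> w i \<in> K \<and> \<alpha> * s i + \<beta> * t i \<le> r i \<and>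
       (\<forall>x. \<bar>u i x - s i * w i x\<bar> \<le> t i)) F"
    by (intro eventually_mono[OF ev]) (simp add: P_def s_def t_def w_def case_prod_unfold)
  have "eventually (\<lambda>i. r i < r0 + 1) F" using order_tendstoD(2)[OF r, of "r0 + 1"] by simp
  with ev have "eventually (\<lambda>i. \<bar>s i\<bar> \<le> (r0 + 1) / \<alpha>) F"
  proof eventually_elim
    case (elim i)
    have "0 \<le> \<beta> * t i" using elim \<beta> by simp
    then have "\<alpha> * s i \<le> r0 + 1" using elim by linarith
    then show ?case using elim \<alpha> by (simp add: field_simps)
  qed
  from ultrafilter_bounded_limit[OF F this] obtain s0 where s0: "(s \<longlongrightarrow> s0) F" by blast
  have "eventually (\<lambda>i. r i < r0 + 1) F" using order_tendstoD(2)[OF r, of "r0 + 1"] by simp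
  with ev have "eventually (\<lambda>i. \<bar>t i\<bar> \<le> (r0 + 1) / \<beta>) F"
  proof eventually_elim
    case (elim i)
    have "0 \<le> \<alpha> * s i" using elim \<alpha> by simp
    then have "\<beta> * t i \<le> r0 + 1" using elim by linarith
    then show ?case using elim \<beta> by (simp add: field_simps)
  qed
  from ultrafilter_bounded_limit[OF F this] obtain t0 where t0: "(t \<longlongrightarrow> t0) F" by blast
  have "\<exists>w0. \<forall>x. \<bar>w0 x\<bar> \<le> 1 \<and> ((\<lambda>i. w i x) \<longlongrightarrow> w0 x) F"
  proof (intro choice allI ultrafilter_bounded_limit[OF F])
    show "eventually (\<lambda>i. \<bar>w i x\<bar> \<le> 1) F" for x
      using ev by eventually_elim (simp add: bounded)
  qed
  then obtain w0 where w0: "\<And>x. ((\<lambda>i. w i x) \<longlongrightarrow> w0 x) F" by blast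
  have evK: "eventually (\<lambda>v. v \<in> K) (filtermap w F)"
    using ev by (auto simp: eventually_filtermap elim: eventually_mono)
  have lim: "((\<lambda>v. v x) \<longlongrightarrow> w0 x) (filtermap w F)" for x
    using w0 by (simp add: filterlim_filtermap)
  show ?thesis
  proof (rule that[OF ev s0 t0 w0])
    show "w0 \<in> K" by (rule limit[OF ultrafilter_filtermap[OF F] evK lim])
    show "((\<lambda>i. \<psi> (w i)) \<longlongrightarrow> \<psi> w0) F" if "contraction \<psi>" for \<psi>
      using functional_limit[OF ultrafilter_filtermap[OF F] evK lim that]
      by (simp add: filterlim_filtermap)
    show "0 \<le> s0" by (rule tendsto_lowerbound[OF s0 _ Fnb]) (use ev in eventually_elim, simp)
    show "0 \<le> t0" by (rule tendsto_lowerbound[OF t0 _ Fnb]) (use ev in eventually_elim, simp)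
    show "\<alpha> * s0 + \<beta> * t0 \<le> r0"
      by (rule tendsto_le[OF Fnb r tendsto_add[OF tendsto_mult_left[OF s0] tendsto_mult_left[OF t0]]])
        (use ev in eventually_elim, simp)
    show "\<bar>u0 x - s0 * w0 x\<bar> \<le> t0" for x
      by (rule tendsto_le[OF Fnb t0 tendsto_rabs[OF tendsto_diff[OF u tendsto_mult[OF s0 w0]]]])
        (use ev in eventually_elim, simp)
  qed
qed

lemma gauge_le_limit:
  assumes "ultrafilter F" "eventually (\<lambda>i. gauge_le K \<alpha> \<beta> (u i) (r i)) F"
    and "(r \<longlongrightarrow> r0) F" "\<And>x. ((\<lambda>i. u i x) \<longlongrightarrow> u0 x) F"
  shows "gauge_le K \<alpha> \<beta> u0 r0"
  using assms by (rule gauge_le_decomposition) (rule gauge_leI)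

text \<open>The infimum is attained, by \<open>gauge_le_limit\<close> for the constant family
  \<open>f\<close> and levels decreasing to the gauge.\<close>

lemma gauge_le_iff:
  assumes "f \<in> bfun"
  shows "gauge K \<alpha> \<beta> f \<le> r \<longleftrightarrow> gauge_le K \<alpha> \<beta> f r"
proof
  have bdd: "bdd_below {r. gauge_le K \<alpha> \<beta> f r}"
    by (rule bdd_belowI[of _ 0]) (simp add: gauge_le_nonneg)
  show "gauge K \<alpha> \<beta> f \<le> r" if "gauge_le K \<alpha> \<beta> f r"
    unfolding gauge_def using that by (intro cInf_lower bdd) simp
  obtain c where c: "\<And>x. \<bar>f x\<bar> \<le> c" using assms by (auto simp: bfun_def)
  obtain U where U: "ultrafilter U" "U \<le> sequentially" by (rule ultrafilter_sequentially)
  have "gauge_le K \<alpha> \<beta> f (gauge K \<alpha> \<beta> f)"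
  proof (rule gauge_le_limit[OF U(1)])
    show "((\<lambda>n. gauge K \<alpha> \<beta> f + inverse (real (Suc n))) \<longlongrightarrow> gauge K \<alpha> \<beta> f) U"
      by (rule tendsto_mono[OF U(2)]) (rule LIMSEQ_inverse_real_of_nat_add)
    show "eventually (\<lambda>n. gauge_le K \<alpha> \<beta> f (gauge K \<alpha> \<beta> f + inverse (real (Suc n)))) U"
    proof (intro always_eventually allI)
      fix n
      have "Inf {r. gauge_le K \<alpha> \<beta> f r} < gauge K \<alpha> \<beta> f + inverse (real (Suc n))"
        by (simp add: gauge_def)
      moreover have "{r. gauge_le K \<alpha> \<beta> f r} \<noteq> {}"
        using gauge_le_bound[of f c] c by blast
      ultimately have "\<exists>r\<in>{r. gauge_le K \<alpha> \<beta> f r}. r < gauge K \<alpha> \<beta> f + inverse (real (Suc n))"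
        by (intro cInf_lessD)
      then show "gauge_le K \<alpha> \<beta> f (gauge K \<alpha> \<beta> f + inverse (real (Suc n)))"
        using gauge_le_mono[OF _ less_imp_le] by (elim bexE) simp
    qed
  qed simp
  then show "gauge_le K \<alpha> \<beta> f r" if "gauge K \<alpha> \<beta> f \<le> r" using that by (rule gauge_le_mono)
qed

lemma gauge_attained:
  assumes "f \<in> bfun"
  obtains s t w where "0 \<le> s" "0 \<le> t" "w \<in> K" "\<alpha> * s + \<beta> * t \<le> gauge K \<alpha> \<beta> f"
    "\<And>x. \<bar>f x - s * w x\<bar> \<le> t"
  by (rule gauge_leE[OF gauge_le_iff[OF assms, THEN iffD1, OF order_refl]], rule that)

lemma gauge_nonneg: "f \<in> bfun \<Longrightarrow> 0 \<le> gauge K \<alpha> \<beta> f"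
  using gauge_le_iff[of f "gauge K \<alpha> \<beta> f"] gauge_le_nonneg by blast

lemma gauge_le_sup: "(\<And>x. \<bar>f x\<bar> \<le> c) \<Longrightarrow> gauge K \<alpha> \<beta> f \<le> \<beta> * c"
  using gauge_le_iff[OF bfunI[of f c]] gauge_le_bound by blast

lemma gauge_add:
  assumes fg: "f \<in> bfun" "g \<in> bfun"
  shows "gauge K \<alpha> \<beta> (f + g) \<le> gauge K \<alpha> \<beta> f + gauge K \<alpha> \<beta> g"
proof -
  obtain s t w where 1: "0 \<le> s" "0 \<le> t" "w \<in> K" "\<alpha> * s + \<beta> * t \<le> gauge K \<alpha> \<beta> f"
      "\<And>x. \<bar>f x - s * w x\<bar> \<le> t"
    by (rule gauge_attained[OF fg(1)], rule that)
  obtain s' t' w' where 2: "0 \<le> s'" "0 \<le> t'" "w' \<in> K" "\<alpha> * s' + \<beta> * t' \<le> gauge K \<alpha> \<beta> g"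
      "\<And>x. \<bar>g x - s' * w' x\<bar> \<le> t'"
    by (rule gauge_attained[OF fg(2)], rule that)
  obtain v where v: "v \<in> K" "\<And>x. (s + s') * v x = s * w x + s' * w' x"
  proof (cases "s + s' = 0")
    case True
    then have "s = 0" "s' = 0" using 1 2 by linarith+
    then show ?thesis using that[of w] 1 by simp
  next
    case False
    have "(s / (s + s')) *\<^sub>R w + (s' / (s + s')) *\<^sub>R w' \<in> K"
      using 1 2 False by (intro convexD[OF convex]) (auto simp: add_divide_distrib[symmetric])
    moreover have "(s + s') * ((s / (s + s')) *\<^sub>R w + (s' / (s + s')) *\<^sub>R w') x = s * w x + s' * w' x" for x
    proof -
      have "((s / (s + s')) *\<^sub>R w + (s' / (s + s')) *\<^sub>R w') x = (s * w x + s' * w' x) / (s + s')"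
        by (simp add: scaleR_fun_def add_divide_distrib)
      then show ?thesis using False by simp
    qed
    ultimately show ?thesis by (rule that)
  qed
  have "gauge_le K \<alpha> \<beta> (f + g) (gauge K \<alpha> \<beta> f + gauge K \<alpha> \<beta> g)"
  proof (rule gauge_leI[of "s + s'" "t + t'" v])
    show "\<bar>(f + g) x - (s + s') * v x\<bar> \<le> t + t'" for x
      unfolding v(2) using 1(5)[of x] 2(5)[of x] by simp
  qed (use 1 2 v in \<open>auto simp: algebra_simps\<close>)
  then show ?thesis using gauge_le_iff subspace_add[OF subspace_bfun fg] by blast
qed

lemma gauge_scale_le:
  assumes f: "f \<in> bfun"
  shows "gauge K \<alpha> \<beta> (c *\<^sub>R f) \<le> \<bar>c\<bar> * gauge K \<alpha> \<beta> f"
proof -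
  obtain s t w where 1: "0 \<le> s" "0 \<le> t" "w \<in> K" "\<alpha> * s + \<beta> * t \<le> gauge K \<alpha> \<beta> f"
      "\<And>x. \<bar>f x - s * w x\<bar> \<le> t"
    by (rule gauge_attained[OF f], rule that)
  obtain v where v: "v \<in> K" "\<And>x. \<bar>c\<bar> * v x = c * w x"
    using that[of w] that[of "- w"] 1(3) symmetric[of w] by (cases "c \<ge> 0") auto
  have "gauge_le K \<alpha> \<beta> (c *\<^sub>R f) (\<bar>c\<bar> * gauge K \<alpha> \<beta> f)"
  proof (rule gauge_leI[of "\<bar>c\<bar> * s" "\<bar>c\<bar> * t" v])
    show "\<bar>(c *\<^sub>R f) x - \<bar>c\<bar> * s * v x\<bar> \<le> \<bar>c\<bar> * t" for x
    proof -
      have "(c *\<^sub>R f) x - \<bar>c\<bar> * s * v x = c * (f x - s * w x)"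
        using v(2)[of x] by (simp add: scaleR_fun_def algebra_simps)
      then show ?thesis using 1(5)[of x] by (simp add: abs_mult mult_left_mono)
    qed
    show "\<alpha> * (\<bar>c\<bar> * s) + \<beta> * (\<bar>c\<bar> * t) \<le> \<bar>c\<bar> * gauge K \<alpha> \<beta> f"
      using mult_left_mono[OF 1(4), of "\<bar>c\<bar>"] by (simp add: algebra_simps)
  qed (use 1 v in auto)
  then show ?thesis using gauge_le_iff subspace_scale[OF subspace_bfun f] by blast
qed

lemma gauge_scale:
  assumes f: "f \<in> bfun"
  shows "gauge K \<alpha> \<beta> (c *\<^sub>R f) = \<bar>c\<bar> * gauge K \<alpha> \<beta> f"
proof (rule antisym[OF gauge_scale_le[OF f]])
  show "\<bar>c\<bar> * gauge K \<alpha> \<beta> f \<le> gauge K \<alpha> \<beta> (c *\<^sub>R f)"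
  proof (cases "c = 0")
    case True
    then show ?thesis using gauge_nonneg[OF subspace_scale[OF subspace_bfun f, of c]] by simp
  next
    case False
    then have "gauge K \<alpha> \<beta> f \<le> \<bar>inverse c\<bar> * gauge K \<alpha> \<beta> (c *\<^sub>R f)"
      using gauge_scale_le[OF subspace_scale[OF subspace_bfun f, of c], of "inverse c"] by simp
    then show ?thesis using False by (simp add: field_simps)
  qed
qed

lemma gauge_disc: "w \<in> K \<Longrightarrow> gauge K \<alpha> \<beta> w \<le> \<alpha>"
  using gauge_le_iff[of w \<alpha>] bfunI[of w 1] bounded by (auto intro!: gauge_leI[of 1 0 w])

end

section \<open>A criterion for reflexivity\<close>

lemma sum_fun_eval: "(\<Sum>i\<in>A. f i) x = (\<Sum>i\<in>A. f i x)"
  by (induction A rule: infinite_finite_induct) simp_all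

lemma linear_map_on_sum:
  fixes \<phi> :: "'v::real_vector \<Rightarrow> real"
  assumes X: "subspace X" and \<phi>: "linear_map_on X \<phi>" and A: "\<And>i. i \<in> A \<Longrightarrow> x i \<in> X"
  shows "\<phi> (\<Sum>i\<in>A. c i *\<^sub>R x i) = (\<Sum>i\<in>A. c i * \<phi> (x i))"
  using A
proof (induction A rule: infinite_finite_induct)
  case (insert i A)
  have "(\<Sum>i\<in>A. c i *\<^sub>R x i) \<in> X"
    using insert.prems by (intro subspace_sum[OF X] subspace_scale[OF X]) auto
  moreover have "c i *\<^sub>R x i \<in> X" "x i \<in> X"
    using insert.prems by (auto intro: subspace_scale[OF X])
  ultimately show ?case
    using \<phi> insert by (simp add: linear_map_on_def)
qed (use \<phi> subspace_0[OF X] in \<open>auto simp: linear_map_on_def dest!: spec[of _ 0] bspec[of X _ 0]\<close>)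

context
  fixes X :: "'v::real_vector set" and N :: "'v \<Rightarrow> real"
  assumes normed: "normed_space_on X N"
begin

lemma normed_subspace: "subspace X"
  and normed_nonneg: "x \<in> X \<Longrightarrow> 0 \<le> N x"
  and normed_eq_0: "x \<in> X \<Longrightarrow> N x = 0 \<longleftrightarrow> x = 0"
  and normed_scale: "x \<in> X \<Longrightarrow> N (c *\<^sub>R x) = \<bar>c\<bar> * N x"
  and normed_add: "x \<in> X \<Longrightarrow> y \<in> X \<Longrightarrow> N (x + y) \<le> N x + N y"
  using normed unfolding normed_space_on_def by simp_all

lemma dual_linear: "f \<in> dual_space X N \<Longrightarrow> linear_map_on X f"
  and dual_outside: "f \<in> dual_space X N \<Longrightarrow> x \<notin> X \<Longrightarrow> f x = 0"
  by (simp_all add: dual_space_def)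

lemma dual_spaceI:
  "linear_map_on X f \<Longrightarrow> (\<And>x. x \<in> X \<Longrightarrow> \<bar>f x\<bar> \<le> C * N x) \<Longrightarrow> (\<And>x. x \<notin> X \<Longrightarrow> f x = 0) \<Longrightarrow>
    f \<in> dual_space X N"
  unfolding dual_space_def by blast

lemma dual_zero: "f \<in> dual_space X N \<Longrightarrow> f 0 = 0"
  using linear_map_on_diff[OF normed_subspace dual_linear, of f 0 0] subspace_0[OF normed_subspace] by simp

lemma dual_boundE:
  assumes "f \<in> dual_space X N"
  obtains C where "C \<ge> 0" "\<And>x. x \<in> X \<Longrightarrow> \<bar>f x\<bar> \<le> C * N x"
proof -
  obtain C where C: "\<And>x. x \<in> X \<Longrightarrow> \<bar>f x\<bar> \<le> C * N x" using assms by (auto simp: dual_space_def)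
  have "\<bar>f x\<bar> \<le> \<bar>C\<bar> * N x" if "x \<in> X" for x
    using C[OF that] mult_right_mono[OF abs_ge_self[of C] normed_nonneg[OF that]] by linarith
  then show ?thesis using that[of "\<bar>C\<bar>"] by simp
qed

lemma dual_norm_upper:
  assumes f: "f \<in> dual_space X N" and x: "x \<in> X" "N x \<le> 1"
  shows "\<bar>f x\<bar> \<le> dual_norm X N f"
proof -
  obtain C where C: "C \<ge> 0" "\<And>x. x \<in> X \<Longrightarrow> \<bar>f x\<bar> \<le> C * N x" using dual_boundE[OF f] by blast
  show ?thesis
    unfolding dual_norm_def
  proof (rule cSUP_upper)
    show "bdd_above ((\<lambda>x. \<bar>f x\<bar>) ` {x \<in> X. N x \<le> 1})"
    proof (rule bdd_aboveI2[of _ _ C])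
      fix z assume "z \<in> {x \<in> X. N x \<le> 1}"
      then show "\<bar>f z\<bar> \<le> C" using C(2)[of z] mult_left_mono[of "N z" 1 C] C(1) by auto
    qed
  qed (use x in simp)
qed

lemma dual_norm_least:
  assumes "\<And>x. x \<in> X \<Longrightarrow> N x \<le> 1 \<Longrightarrow> \<bar>f x\<bar> \<le> c"
  shows "dual_norm X N f \<le> c"
  unfolding dual_norm_def
proof (rule cSUP_least)
  have "0 \<in> {x \<in> X. N x \<le> 1}" using subspace_0[OF normed_subspace] normed_eq_0[of 0] by simp
  then show "{x \<in> X. N x \<le> 1} \<noteq> {}" by (metis empty_iff)
qed (use assms in simp)

lemma dual_norm_bound:
  assumes f: "f \<in> dual_space X N" and x: "x \<in> X"
  shows "\<bar>f x\<bar> \<le> dual_norm X N f * N x"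
proof (cases "N x = 0")
  case True
  then show ?thesis using normed_eq_0[OF x] dual_zero[OF f] by simp
next
  case False
  then have pos: "N x > 0" using normed_nonneg[OF x] by simp
  let ?y = "inverse (N x) *\<^sub>R x"
  have y: "?y \<in> X" "N ?y \<le> 1"
    using pos x by (simp_all add: subspace_scale[OF normed_subspace] normed_scale)
  have "f ?y = inverse (N x) * f x"
    using dual_linear[OF f] x by (simp add: linear_map_on_def)
  then have "\<bar>f x\<bar> = \<bar>f ?y\<bar> * N x" using pos by (simp add: abs_mult)
  also have "\<dots> \<le> dual_norm X N f * N x"
    by (intro mult_right_mono dual_norm_upper[OF f y]) (use pos in simp)
  finally show ?thesis .
qed

lemma subspace_dual: "subspace (dual_space X N)"
  unfolding subspace_def
proof (intro conjI ballI allI)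
  show "0 \<in> dual_space X N"
    by (auto simp: dual_space_def linear_map_on_def intro!: exI[of _ 0])
  fix f g assume fg: "f \<in> dual_space X N" "g \<in> dual_space X N"
  obtain C where C: "\<And>x. x \<in> X \<Longrightarrow> \<bar>f x\<bar> \<le> C * N x" using dual_boundE[OF fg(1)] by blast
  obtain C' where C': "\<And>x. x \<in> X \<Longrightarrow> \<bar>g x\<bar> \<le> C' * N x" using dual_boundE[OF fg(2)] by blast
  have "\<bar>(f + g) x\<bar> \<le> (C + C') * N x" if "x \<in> X" for x
    using C[OF that] C'[OF that] by (simp add: distrib_right)
  then show "f + g \<in> dual_space X N"
    using dual_linear[OF fg(1)] dual_linear[OF fg(2)] dual_outside[OF fg(1)] dual_outside[OF fg(2)]
    by (intro dual_spaceI[of _ "C + C'"]) (simp_all add: linear_map_on_def algebra_simps)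
next
  fix f and c :: real assume f: "f \<in> dual_space X N"
  obtain C where C: "\<And>x. x \<in> X \<Longrightarrow> \<bar>f x\<bar> \<le> C * N x" using dual_boundE[OF f] by blast
  have "\<bar>(c *\<^sub>R f) x\<bar> \<le> (\<bar>c\<bar> * C) * N x" if "x \<in> X" for x
    using mult_left_mono[OF C[OF that], of "\<bar>c\<bar>"] by (simp add: scaleR_fun_def abs_mult mult.assoc)
  then show "c *\<^sub>R f \<in> dual_space X N"
    using dual_linear[OF f] dual_outside[OF f]
    by (intro dual_spaceI[of _ "\<bar>c\<bar> * C"]) (simp_all add: linear_map_on_def scaleR_fun_def algebra_simps)
qed

lemma canonical_embedding_bidual:
  assumes x: "x \<in> X"
  shows "canonical_embedding X N x \<in> dual_space (dual_space X N) (dual_norm X N)"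
proof -
  have "\<bar>canonical_embedding X N x f\<bar> \<le> N x * dual_norm X N f" if "f \<in> dual_space X N" for f
    using dual_norm_bound[OF that x] that by (simp add: canonical_embedding_def mult.commute)
  moreover have "linear_map_on (dual_space X N) (canonical_embedding X N x)"
    using subspace_add[OF subspace_dual] subspace_scale[OF subspace_dual]
    by (simp add: linear_map_on_def canonical_embedding_def scaleR_fun_def)
  ultimately show ?thesis by (auto simp: dual_space_def[of "dual_space X N"] canonical_embedding_def)
qed

section \<open>Reflexivity from weak compactness of balls\<close>

context
  assumes weakly_compact: "\<And>F r. ultrafilter F \<Longrightarrow> eventually (\<lambda>x. x \<in> X \<and> N x \<le> r) F \<Longrightarrow>
      \<exists>x0\<in>X. N x0 \<le> r \<and> (\<forall>f\<in>dual_space X N. (f \<longlongrightarrow> f x0) F)"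
begin

text \<open>
  An exact form of Helly's theorem: minimise the squared distance between \<open>(f z)\<close> and \<open>(\<phi> f)\<close>. The
  residuals at a minimiser \<open>z0\<close> are the coefficients of a functional that attains its norm at \<open>z0\<close>,
  which forces them to vanish.
\<close>

lemma bidual_finite:
  assumes \<phi>: "linear_map_on (dual_space X N) \<phi>" and r: "r > 0"
    and bound: "\<And>f. f \<in> dual_space X N \<Longrightarrow> \<bar>\<phi> f\<bar> \<le> r * dual_norm X N f"
    and A: "finite A" "A \<subseteq> dual_space X N"
  obtains z where "z \<in> X" "N z \<le> r" "\<And>f. f \<in> A \<Longrightarrow> f z = \<phi> f"
proof -
  let ?B = "{z \<in> X. N z \<le> r}"
  define Q where "Q z = (\<Sum>f\<in>A. (f z - \<phi> f)\<^sup>2)" for z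
  have "0 \<in> ?B" using subspace_0[OF normed_subspace] normed_eq_0[of 0] r by simp
  from imageI[OF this, of Q] have Bne: "Q ` ?B \<noteq> {}" by (metis empty_iff)
  have bdd: "bdd_below (Q ` ?B)"
    by (rule bdd_belowI2[of _ 0]) (simp add: Q_def sum_nonneg)
  have "\<exists>z. z \<in> ?B \<and> Q z < Inf (Q ` ?B) + inverse (real (Suc n))" for n
    using cInf_lessD[OF Bne, of "Inf (Q ` ?B) + inverse (real (Suc n))"] by auto
  then obtain z where z: "\<And>n. z n \<in> ?B" "\<And>n. Q (z n) < Inf (Q ` ?B) + inverse (real (Suc n))"
    by metis
  obtain U where U: "ultrafilter U" "U \<le> sequentially" by (rule ultrafilter_sequentially)
  have Unb: "U \<noteq> bot" by (rule ultrafilter_not_bot[OF U(1)])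
  \<comment> \<open>A minimising sequence has a weak cluster point in the ball, and \<open>Q\<close>
    involves only finitely many functionals, so the infimum is attained there.\<close>
  have "eventually (\<lambda>x. x \<in> X \<and> N x \<le> r) (filtermap z U)"
    using z(1) by (simp add: eventually_filtermap)
  from weakly_compact[OF ultrafilter_filtermap[OF U(1)] this]
  obtain z0 where z0: "z0 \<in> X" "N z0 \<le> r"
    and "\<And>f. f \<in> dual_space X N \<Longrightarrow> (f \<longlongrightarrow> f z0) (filtermap z U)" by blast
  then have lim: "((\<lambda>n. f (z n)) \<longlongrightarrow> f z0) U" if "f \<in> dual_space X N" for f
    using that by (simp add: filterlim_filtermap)
  have "((\<lambda>n. Q (z n)) \<longlongrightarrow> Q z0) U"
    unfolding Q_def using A(2) by (intro tendsto_intros lim) auto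
  moreover have "((\<lambda>n. Inf (Q ` ?B) + inverse (real (Suc n))) \<longlongrightarrow> Inf (Q ` ?B)) U"
    by (rule tendsto_mono[OF U(2)]) (rule LIMSEQ_inverse_real_of_nat_add)
  ultimately have "Q z0 \<le> Inf (Q ` ?B)"
    by (intro tendsto_le[OF Unb]) (auto intro!: always_eventually less_imp_le[OF z(2)] simp del: of_nat_Suc)
  then have min: "Q z0 \<le> Q x" if "x \<in> ?B" for x
    using cInf_lower[OF imageI[OF that] bdd] by (rule order_trans)
  define c where "c f = \<phi> f - f z0" for f
  define g where "g = (\<Sum>f\<in>A. c f *\<^sub>R f)"
  have gD: "g \<in> dual_space X N"
    unfolding g_def using A(2) by (intro subspace_sum[OF subspace_dual] subspace_scale[OF subspace_dual]) auto
  have g: "g x = (\<Sum>f\<in>A. c f * f x)" for x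
    by (simp add: g_def sum_fun_eval scaleR_fun_def)
  have g_le: "g x \<le> g z0" if x: "x \<in> ?B" for x
  proof -
    define M where "M = (\<Sum>f\<in>A. (f (x - z0))\<^sup>2)"
    have xz: "x - z0 \<in> X" using x z0 by (simp add: subspace_diff[OF normed_subspace])
    \<comment> \<open>The first-order condition at the minimiser: moving from \<open>z0\<close>
      towards \<open>x\<close> by a fraction \<open>t\<close> cannot decrease \<open>Q\<close>, and
      the quadratic term disappears as \<open>t\<close> tends to 0.\<close>
    have *: "2 * g (x - z0) \<le> t * M" if t: "0 < t" "t \<le> 1" for t
    proof -
      have eq: "z0 + t *\<^sub>R (x - z0) = (1 - t) *\<^sub>R z0 + t *\<^sub>R x" by (simp add: algebra_simps)
      have "N ((1 - t) *\<^sub>R z0 + t *\<^sub>R x) \<le> (1 - t) * N z0 + t * N x"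
        using normed_add[of "(1 - t) *\<^sub>R z0" "t *\<^sub>R x"] x z0 t
        by (simp add: normed_scale subspace_scale[OF normed_subspace])
      also have "\<dots> \<le> (1 - t) * r + t * r"
        using x z0 t by (intro add_mono mult_left_mono) auto
      finally have "z0 + t *\<^sub>R (x - z0) \<in> ?B"
        unfolding eq using x z0
        by (simp add: algebra_simps subspace_add[OF normed_subspace] subspace_scale[OF normed_subspace] subspace_diff[OF normed_subspace])
      from min[OF this] have "Q z0 \<le> Q (z0 + t *\<^sub>R (x - z0))" .
      also have "\<dots> = (\<Sum>f\<in>A. (f z0 - \<phi> f)\<^sup>2 - 2 * t * (c f * f (x - z0)) + t\<^sup>2 * (f (x - z0))\<^sup>2)"
        unfolding Q_def
      proof (rule sum.cong[OF refl])
        fix f assume "f \<in> A"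
        then have "f (z0 + t *\<^sub>R (x - z0)) = f z0 + t * f (x - z0)"
          using dual_linear[of f] A(2) z0(1) xz subspace_scale[OF normed_subspace xz]
          by (auto simp: linear_map_on_def)
        then show "(f (z0 + t *\<^sub>R (x - z0)) - \<phi> f)\<^sup>2 =
            (f z0 - \<phi> f)\<^sup>2 - 2 * t * (c f * f (x - z0)) + t\<^sup>2 * (f (x - z0))\<^sup>2"
          by (simp add: c_def power2_eq_square algebra_simps)
      qed
      also have "\<dots> = Q z0 - 2 * t * g (x - z0) + t\<^sup>2 * M"
        by (simp add: Q_def g M_def sum.distrib sum_subtractf sum_distrib_left)
      finally have "t * (2 * g (x - z0)) \<le> t * (t * M)" by (simp add: power2_eq_square)
      then show ?thesis using t by simp
    qed
    have "2 * g (x - z0) \<le> 0"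
    proof (rule tendsto_le[of "at_right (0::real)"])
      show "((\<lambda>t. t * M) \<longlongrightarrow> 0) (at_right 0)" by (auto intro!: tendsto_eq_intros)
      show "eventually (\<lambda>t. 2 * g (x - z0) \<le> t * M) (at_right 0)"
        by (rule eventually_mono[OF eventually_at_right_real[of 0 1]]) (auto intro: *)
    qed auto
    moreover have "g (x - z0) = g x - g z0"
      using linear_map_on_diff[OF normed_subspace dual_linear[OF gD]] x z0 by simp
    ultimately show ?thesis by simp
  qed
  \<comment> \<open>\<open>z0\<close> maximises \<open>g\<close> on the ball of radius
    \<open>r\<close>, which contains both \<open>r *\<^sub>R x\<close> and
    \<open>(- r) *\<^sub>R x\<close> for \<open>x\<close> in the unit ball.\<close>
  have "dual_norm X N g \<le> g z0 / r"
  proof (rule dual_norm_least)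
    fix x assume x: "x \<in> X" "N x \<le> 1"
    have gs: "g (a *\<^sub>R x) = a * g x" for a
      using dual_linear[OF gD] x by (simp add: linear_map_on_def)
    have "a *\<^sub>R x \<in> ?B" if "\<bar>a\<bar> = r" for a
      using x r that mult_left_mono[OF x(2), of r] by (simp add: subspace_scale[OF normed_subspace] normed_scale)
    from g_le[OF this[of r]] g_le[OF this[of "-r"]] r
    have "r * g x \<le> g z0" "- r * g x \<le> g z0" unfolding gs by simp_all
    then have "r * \<bar>g x\<bar> \<le> g z0" by (simp add: abs_if)
    then show "\<bar>g x\<bar> \<le> g z0 / r" using r by (simp add: field_simps)
  qed
  \<comment> \<open>The bound on \<open>\<phi>\<close> limits \<open>\<phi> g\<close> by
    \<open>g z0\<close>, whereas by the choice of coefficients \<open>\<phi> g - g z0\<close> is the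
    sum of the squared residuals.\<close>
  then have "\<phi> g \<le> g z0" using bound[OF gD] r by (simp add: field_simps abs_le_iff)
  moreover have "\<phi> g = (\<Sum>f\<in>A. c f * \<phi> f)"
    unfolding g_def using A(2) by (intro linear_map_on_sum[OF subspace_dual \<phi>]) auto
  then have "\<phi> g - g z0 = (\<Sum>f\<in>A. c f * (\<phi> f - f z0))"
    by (simp add: g right_diff_distrib sum_subtractf)
  then have "\<phi> g - g z0 = (\<Sum>f\<in>A. (c f)\<^sup>2)"
    by (simp add: c_def power2_eq_square)
  ultimately have "(\<Sum>f\<in>A. (c f)\<^sup>2) \<le> 0" by simp
  then have "(\<Sum>f\<in>A. (c f)\<^sup>2) = 0" by (intro antisym sum_nonneg) auto
  then have "\<forall>f\<in>A. c f = 0" using A(1) by (simp add: sum_nonneg_eq_0_iff)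
  then show ?thesis using z0 that[of z0] by (simp add: c_def)
qed

text \<open>For each finite set \<open>A\<close> of functionals, \<open>bidual_finite\<close> gives
  a point \<open>z A\<close> of a fixed ball on which they agree with \<open>\<phi>\<close>. A weak
  limit of these points, as \<open>A\<close> grows, represents \<open>\<phi>\<close> on the whole
  dual.\<close>

lemma reflexive_onI: "reflexive_on X N"
  unfolding reflexive_on_def
proof (intro equalityI subsetI)
  fix \<phi> assume "\<phi> \<in> canonical_embedding X N ` X"
  then show "\<phi> \<in> dual_space (dual_space X N) (dual_norm X N)"
    using canonical_embedding_bidual by blast
next
  let ?D = "dual_space X N"
  fix \<phi> assume "\<phi> \<in> dual_space ?D (dual_norm X N)"
  then obtain C where lin: "linear_map_on ?D \<phi>" and C: "\<And>f. f \<in> ?D \<Longrightarrow> \<bar>\<phi> f\<bar> \<le> C * dual_norm X N f"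
    and out: "\<And>f. f \<notin> ?D \<Longrightarrow> \<phi> f = 0"
    unfolding dual_space_def[of ?D] by blast
  \<comment> \<open>The summand 1 provides the positive radius that \<open>bidual_finite\<close>
    divides by.\<close>
  define r where "r = \<bar>C\<bar> + 1"
  have r: "r > 0" by (simp add: r_def)
  have bound: "\<bar>\<phi> f\<bar> \<le> r * dual_norm X N f" if f: "f \<in> ?D" for f
  proof -
    have "0 \<le> dual_norm X N f"
      using dual_norm_upper[OF f, of 0] subspace_0[OF normed_subspace] normed_eq_0[of 0] by simp
    then have "C * dual_norm X N f \<le> r * dual_norm X N f"
      by (intro mult_right_mono) (simp_all add: r_def)
    with C[OF f] show ?thesis by linarith
  qed
  have "\<exists>z. z \<in> X \<and> N z \<le> r \<and> (\<forall>f\<in>A. f z = \<phi> f)" if "finite A" "A \<subseteq> ?D" for A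
    by (rule bidual_finite[OF lin r bound that]) auto
  then have "\<exists>z. \<forall>A. finite A \<and> A \<subseteq> ?D \<longrightarrow> z A \<in> X \<and> N (z A) \<le> r \<and> (\<forall>f\<in>A. f (z A) = \<phi> f)"
    by (intro choice) blast
  then obtain z where
    "\<forall>A. finite A \<and> A \<subseteq> ?D \<longrightarrow> z A \<in> X \<and> N (z A) \<le> r \<and> (\<forall>f\<in>A. f (z A) = \<phi> f)"
    by (elim exE)
  then have z: "z A \<in> X \<and> N (z A) \<le> r \<and> (\<forall>f\<in>A. f (z A) = \<phi> f)" if "finite A" "A \<subseteq> ?D" for A
    using that by simp
  obtain U where U: "ultrafilter U" "U \<le> finite_subsets_at_top ?D"
    using ultrafilter_below[OF finite_subsets_at_top_neq_bot[of ?D]] by blast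
  have Unb: "U \<noteq> bot" by (rule ultrafilter_not_bot[OF U(1)])
  have evU: "eventually (\<lambda>A. finite A \<and> B \<subseteq> A \<and> A \<subseteq> ?D) U" if "finite B" "B \<subseteq> ?D" for B
    using that by (intro filter_leD[OF U(2)]) (auto simp: eventually_finite_subsets_at_top)
  have "eventually (\<lambda>x. x \<in> X \<and> N x \<le> r) (filtermap z U)"
    unfolding eventually_filtermap using evU[of "{}"] by (auto elim!: eventually_mono dest: z)
  from weakly_compact[OF ultrafilter_filtermap[OF U(1)] this]
  obtain x where x: "x \<in> X" "\<And>f. f \<in> ?D \<Longrightarrow> (f \<longlongrightarrow> f x) (filtermap z U)" by blast
  have "f x = \<phi> f" if f: "f \<in> ?D" for f
  proof (rule tendsto_unique[OF Unb])
    show "((\<lambda>A. f (z A)) \<longlongrightarrow> f x) U" using x(2)[OF f] by (simp add: filterlim_filtermap)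
    have "eventually (\<lambda>A. f (z A) = \<phi> f) U"
      using evU[of "{f}"] f by (auto elim!: eventually_mono dest: z)
    then show "((\<lambda>A. f (z A)) \<longlongrightarrow> \<phi> f) U" by (rule tendsto_eventually)
  qed
  then have "\<phi> = canonical_embedding X N x"
    by (auto simp: fun_eq_iff canonical_embedding_def out)
  then show "\<phi> \<in> canonical_embedding X N ` X" using x(1) by blast
qed

end

end

section \<open>The interpolation space\<close>

text \<open>
  An \<open>\<ell>\<^sup>2\<close>-sum of Davis-Figiel-Johnson-Pelczynski interpolation spaces between the discs \<open>K j\<close> and the
  bounded functions. The weights are chosen such that \<open>4\<^sup>-\<^sup>n\<close> is square summable, \<open>2\<^sup>n\<close> tends to infinity
  and their product is summable.
\<close>

locale disc_sequence =
  fixes K :: "'j \<Rightarrow> ('a \<Rightarrow> real) set"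
  assumes discs: "\<And>j. weakly_compact_disc (K j)"
begin

lemma disc: "compact_disc (K j) (1 / 4 ^ n) (2 ^ n)"
  by standard (simp_all add: discs)

definition p :: "'j \<times> nat \<Rightarrow> ('j \<Rightarrow> 'a \<Rightarrow> real) \<Rightarrow> real" where
  "p i f = gauge (K (fst i)) (1 / 4 ^ snd i) (2 ^ snd i) (f (fst i))"

definition V :: "('j \<Rightarrow> 'a \<Rightarrow> real) set" where
  "V = {f. \<forall>j. f j \<in> bfun}"

definition X :: "('j \<Rightarrow> 'a \<Rightarrow> real) set" where
  "X = {f \<in> V. \<exists>r. \<forall>I. finite I \<longrightarrow> L2_set (\<lambda>i. p i f) I \<le> r}"

text \<open>The index type \<open>'j\<close> is arbitrary, so the l2-norm is taken as the supremum
  over finite index sets. It is meaningful on \<open>X\<close>, where these partial norms are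
  bounded.\<close>

definition N :: "('j \<Rightarrow> 'a \<Rightarrow> real) \<Rightarrow> real" where
  "N f = (SUP I\<in>{I. finite I}. L2_set (\<lambda>i. p i f) I)"

lemma V_bfun: "f \<in> V \<Longrightarrow> f j \<in> bfun"
  by (simp add: V_def)

lemma subspace_V: "subspace V"
  by (simp add: subspace_def V_def scaleR_fun_def[of _ "_ :: 'j \<Rightarrow> _"] subspace_0[OF subspace_bfun]
      subspace_add[OF subspace_bfun] subspace_scale[OF subspace_bfun])

lemma X_V: "f \<in> X \<Longrightarrow> f \<in> V"
  by (simp add: X_def)

lemma p_nonneg: "f \<in> V \<Longrightarrow> 0 \<le> p i f"
  unfolding p_def by (rule compact_disc.gauge_nonneg[OF disc V_bfun])

lemma p_add: "f \<in> V \<Longrightarrow> g \<in> V \<Longrightarrow> p i (f + g) \<le> p i f + p i g"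
  using compact_disc.gauge_add[OF disc V_bfun V_bfun, of f g "fst i"] by (simp add: p_def)

lemma p_scale: "f \<in> V \<Longrightarrow> p i (c *\<^sub>R f) = \<bar>c\<bar> * p i f"
  unfolding p_def scaleR_fun_def[of c f] by (rule compact_disc.gauge_scale[OF disc V_bfun])

lemma L2_le_N:
  assumes "f \<in> X" "finite I"
  shows "L2_set (\<lambda>i. p i f) I \<le> N f"
proof -
  obtain r where "\<And>I. finite I \<Longrightarrow> L2_set (\<lambda>i. p i f) I \<le> r" using assms by (auto simp: X_def)
  then have "bdd_above ((\<lambda>I. L2_set (\<lambda>i. p i f) I) ` {I. finite I})"
    by (intro bdd_aboveI2[of _ _ r]) simp
  then show ?thesis unfolding N_def using assms by (intro cSUP_upper) simp_all
qed

lemma N_leI: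
  assumes "\<And>I. finite I \<Longrightarrow> L2_set (\<lambda>i. p i f) I \<le> r"
  shows "N f \<le> r"
  unfolding N_def by (rule cSUP_least) (use assms in auto)

lemma X_I: "f \<in> V \<Longrightarrow> (\<And>I. finite I \<Longrightarrow> L2_set (\<lambda>i. p i f) I \<le> r) \<Longrightarrow> f \<in> X"
  unfolding X_def by blast

lemma N_nonneg: "f \<in> X \<Longrightarrow> 0 \<le> N f"
  using L2_le_N[of f "{}"] by simp

lemma p_le_N: "f \<in> X \<Longrightarrow> p i f \<le> N f"
  using L2_le_N[of f "{i}"] p_nonneg[OF X_V] by simp

text \<open>At \<open>n = 0\<close> both weights are 1, and members of the disc are bounded by 1, so
  \<open>s + t\<close> bounds the function. Hence N-bounded families have pointwise
  ultralimits.\<close>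

lemma pointwise_le_p:
  assumes "f \<in> V"
  shows "\<bar>f j x\<bar> \<le> p (j, 0) f"
proof -
  interpret compact_disc "K j" "1 / 4 ^ 0" "2 ^ 0" by (rule disc)
  obtain s t w where st: "0 \<le> s" "0 \<le> t" "w \<in> K j" "1 / 4 ^ 0 * s + 2 ^ 0 * t \<le> gauge (K j) (1 / 4 ^ 0) (2 ^ 0) (f j)"
    "\<And>x. \<bar>f j x - s * w x\<bar> \<le> t"
    by (rule gauge_attained[OF V_bfun[OF assms]], rule that)
  have "\<bar>s * w x\<bar> \<le> s" using st(1) bounded[OF st(3), of x] by (simp add: abs_mult mult_left_le)
  then show ?thesis using st(4) st(5)[of x] by (simp add: p_def)
qed

lemma pointwise_le_N: "f \<in> X \<Longrightarrow> \<bar>f j x\<bar> \<le> N f"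
  using pointwise_le_p[OF X_V] p_le_N by (rule order_trans)

lemma L2_add:
  assumes "f \<in> V" "g \<in> V"
  shows "L2_set (\<lambda>i. p i (f + g)) I \<le> L2_set (\<lambda>i. p i f) I + L2_set (\<lambda>i. p i g) I"
proof -
  have "L2_set (\<lambda>i. p i (f + g)) I \<le> L2_set (\<lambda>i. p i f + p i g) I"
    using assms by (intro L2_set_mono p_add p_nonneg subspace_add[OF subspace_V])
  also have "\<dots> \<le> L2_set (\<lambda>i. p i f) I + L2_set (\<lambda>i. p i g) I" by (rule L2_set_triangle_ineq)
  finally show ?thesis .
qed

lemma L2_scale: "f \<in> V \<Longrightarrow> L2_set (\<lambda>i. p i (c *\<^sub>R f)) I = \<bar>c\<bar> * L2_set (\<lambda>i. p i f) I"
  by (simp add: p_scale L2_set_right_distrib)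

lemma X_add: "f + g \<in> X" and N_add: "N (f + g) \<le> N f + N g" if "f \<in> X" "g \<in> X"
proof -
  have *: "L2_set (\<lambda>i. p i (f + g)) I \<le> N f + N g" if "finite I" for I
    using L2_add[OF X_V X_V, of f g I] L2_le_N[of f I] L2_le_N[of g I] \<open>f \<in> X\<close> \<open>g \<in> X\<close> that by linarith
  show "f + g \<in> X"
    by (rule X_I[OF subspace_add[OF subspace_V]]) (use that X_V * in auto)
  show "N (f + g) \<le> N f + N g" by (rule N_leI[OF *])
qed

lemma X_scale: "c *\<^sub>R f \<in> X" and N_scale_le: "N (c *\<^sub>R f) \<le> \<bar>c\<bar> * N f" if "f \<in> X"
proof -
  have *: "L2_set (\<lambda>i. p i (c *\<^sub>R f)) I \<le> \<bar>c\<bar> * N f" if "finite I" for I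
    using L2_le_N[OF \<open>f \<in> X\<close> that] by (simp add: L2_scale[OF X_V[OF \<open>f \<in> X\<close>]] mult_left_mono)
  show "c *\<^sub>R f \<in> X"
    by (rule X_I[OF subspace_scale[OF subspace_V]]) (use that X_V * in auto)
  show "N (c *\<^sub>R f) \<le> \<bar>c\<bar> * N f" by (rule N_leI[OF *])
qed

lemma zero_X: "0 \<in> X" and N_zero: "N 0 = 0"
proof -
  have "p i 0 = 0" for i using p_scale[OF subspace_0[OF subspace_V], of i 0] by simp
  then have *: "L2_set (\<lambda>i. p i 0) I \<le> 0" for I by (simp add: L2_set_def)
  show "0 \<in> X" by (rule X_I[OF subspace_0[OF subspace_V] *])
  from N_nonneg[OF this] N_leI[OF *] show "N 0 = 0" by simp
qed

lemma subspace_X: "subspace X"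
  by (simp add: subspace_def zero_X X_add X_scale)

lemma N_scale:
  assumes f: "f \<in> X"
  shows "N (c *\<^sub>R f) = \<bar>c\<bar> * N f"
proof (rule antisym[OF N_scale_le[OF f]])
  show "\<bar>c\<bar> * N f \<le> N (c *\<^sub>R f)"
  proof (cases "c = 0")
    case True
    then show ?thesis by (simp add: N_zero)
  next
    case False
    then have "N f \<le> \<bar>inverse c\<bar> * N (c *\<^sub>R f)"
      using N_scale_le[OF X_scale[OF f], of "inverse c" c] by simp
    then show ?thesis using False by (simp add: field_simps)
  qed
qed

lemma N_eq_0: "f \<in> X \<Longrightarrow> N f = 0 \<longleftrightarrow> f = 0"
  using pointwise_le_N[of f] N_zero by (auto intro!: ext)

lemma normed_space_X: "Y \<subseteq> X \<Longrightarrow> subspace Y \<Longrightarrow> normed_space_on Y N"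
  unfolding normed_space_on_def using N_nonneg N_eq_0 N_scale N_add by blast

text \<open>A Fatou property: each coordinate gauge is lower semicontinuous by
  \<open>gauge_le_limit\<close>, and each partial l2-norm involves finitely many
  coordinates.\<close>

lemma N_limit:
  assumes F: "ultrafilter F" and ev: "eventually (\<lambda>i. u i \<in> X \<and> N (u i) \<le> r) F"
    and lim: "\<And>j x. ((\<lambda>i. u i j x) \<longlongrightarrow> u0 j x) F"
  shows "u0 \<in> X" "N u0 \<le> r"
proof -
  have Fnb: "F \<noteq> bot" by (rule ultrafilter_not_bot[OF F])
  have "\<bar>u0 j x\<bar> \<le> r" for j x
    by (rule tendsto_abs_le[OF lim Fnb])
      (use ev in eventually_elim, use pointwise_le_N in \<open>meson order_trans\<close>)
  then have V: "u0 \<in> V" unfolding V_def by (auto intro: bfunI)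
  have p_ev: "eventually (\<lambda>a. \<bar>p i (u a)\<bar> \<le> r) F" for i
    using ev
  proof eventually_elim
    case (elim a)
    then show ?case using p_le_N[of "u a" i] p_nonneg[OF X_V, of "u a" i] by simp
  qed
  have "\<exists>q. \<forall>i. \<bar>q i\<bar> \<le> r \<and> ((\<lambda>a. p i (u a)) \<longlongrightarrow> q i) F"
    by (intro choice allI ultrafilter_bounded_limit[OF F] p_ev)
  then obtain q where q: "\<And>i. ((\<lambda>a. p i (u a)) \<longlongrightarrow> q i) F" by blast
  have pq: "p i u0 \<le> q i" for i
  proof -
    interpret compact_disc "K (fst i)" "1 / 4 ^ snd i" "2 ^ snd i" by (rule disc)
    have "gauge_le (K (fst i)) (1 / 4 ^ snd i) (2 ^ snd i) (u0 (fst i)) (q i)"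
    proof (rule gauge_le_limit[OF F _ q lim])
      show "eventually (\<lambda>a. gauge_le (K (fst i)) (1 / 4 ^ snd i) (2 ^ snd i) (u a (fst i)) (p i (u a))) F"
        using ev
      proof eventually_elim
        case (elim a)
        then show ?case using gauge_le_iff[OF V_bfun[OF X_V], of "u a" "fst i" "p i (u a)"]
          by (simp add: p_def)
      qed
    qed
    then show ?thesis using gauge_le_iff[OF V_bfun[OF V]] by (simp add: p_def)
  qed
  have *: "L2_set (\<lambda>i. p i u0) I \<le> r" if I: "finite I" for I
  proof -
    have "L2_set (\<lambda>i. p i u0) I \<le> L2_set q I"
      by (intro L2_set_mono pq p_nonneg[OF V])
    also have "L2_set q I \<le> r"
    proof (rule tendsto_upperbound[OF _ _ Fnb])
      show "((\<lambda>a. L2_set (\<lambda>i. p i (u a)) I) \<longlongrightarrow> L2_set q I) F"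
        unfolding L2_set_def by (intro tendsto_intros q)
      show "eventually (\<lambda>a. L2_set (\<lambda>i. p i (u a)) I \<le> r) F"
        using ev by eventually_elim (use L2_le_N[OF _ I] in \<open>meson order_trans\<close>)
    qed
    finally show ?thesis .
  qed
  show "u0 \<in> X" by (rule X_I[OF V *])
  show "N u0 \<le> r" by (rule N_leI[OF *])
qed

text \<open>The reason for interpolating. For large \<open>n\<close> the bounded remainder of a
  decomposition is uniformly small on the ball, and the disc part converges weakly.\<close>

lemma contraction_tendsto:
  assumes F: "ultrafilter F" and ev: "eventually (\<lambda>f. f \<in> X \<and> N f \<le> r) F"
    and lim: "\<And>j x. ((\<lambda>f. f j x) \<longlongrightarrow> f0 j x) F" and \<psi>: "contraction \<psi>"
  shows "((\<lambda>f. \<psi> (f j)) \<longlongrightarrow> \<psi> (f0 j)) F"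
proof (rule tendstoI)
  fix \<eta> :: real assume \<eta>: "\<eta> > 0"
  \<comment> \<open>This makes every remainder of size at most \<open>\<bar>r\<bar> / 2 ^ n\<close>
    smaller than \<eta> / 4. The error is used once for \<open>f j\<close> and once for
    \<open>f0 j\<close>; the other \<eta> / 2 is left for the disc parts.\<close>
  obtain n where n: "4 * (\<bar>r\<bar> + 1) / \<eta> < 2 ^ n" using real_arch_pow[of 2] by auto
  have tn: "2 * t < \<eta> / 2" if "2 ^ n * t \<le> \<bar>r\<bar>" for t
  proof -
    have "4 * (\<bar>r\<bar> + 1) < 2 ^ n * \<eta>" using n \<eta> by (simp add: field_simps)
    then have "4 * \<bar>r\<bar> < 2 ^ n * \<eta>" by (simp add: distrib_left)
    moreover have "2 ^ n * (4 * t) \<le> 4 * \<bar>r\<bar>" using that by simp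
    ultimately have "2 ^ n * (4 * t) < 2 ^ n * \<eta>" by (rule le_less_trans[rotated])
    then have "4 * t < \<eta>" by (rule mult_left_less_imp_less) simp
    then show ?thesis by simp
  qed
  interpret compact_disc "K j" "1 / 4 ^ n" "2 ^ n" by (rule disc)
  have "eventually (\<lambda>f. gauge_le (K j) (1 / 4 ^ n) (2 ^ n) (f j) \<bar>r\<bar>) F"
    using ev
  proof eventually_elim
    case (elim f)
    then have "p (j, n) f \<le> \<bar>r\<bar>" using p_le_N[of f "(j, n)"] by linarith
    then show ?case using gauge_le_iff[OF V_bfun[OF X_V], of f] elim by (simp add: p_def)
  qed
  then obtain s t w s0 t0 w0 where
    st: "eventually (\<lambda>f. 0 \<le> s f \<and> 0 \<le> t f \<and> w f \<in> K j \<and> 1 / 4 ^ n * s f + 2 ^ n * t f \<le> \<bar>r\<bar> \<and>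
       (\<forall>x. \<bar>f j x - s f * w f x\<bar> \<le> t f)) F"
    and s: "(s \<longlongrightarrow> s0) F" and w: "\<And>\<psi>. contraction \<psi> \<Longrightarrow> ((\<lambda>i. \<psi> (w i)) \<longlongrightarrow> \<psi> w0) F"
    and s0: "0 \<le> s0" "0 \<le> t0" "w0 \<in> K j" "1 / 4 ^ n * s0 + 2 ^ n * t0 \<le> \<bar>r\<bar>"
      "\<And>x. \<bar>f0 j x - s0 * w0 x\<bar> \<le> t0"
    by (rule gauge_le_decomposition[OF F _ tendsto_const lim]) (rule that)
  have error: "\<bar>\<psi> u - a * \<psi> v\<bar> < \<eta> / 4" if "0 \<le> a" "v \<in> K j" "1 / 4 ^ n * a + 2 ^ n * b \<le> \<bar>r\<bar>"
    "\<And>x. \<bar>u x - a * v x\<bar> \<le> b" for a b u v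
  proof -
    have v: "v \<in> bfun" using bounded[OF that(2)] by (rule bfunI)
    have "\<bar>(u - a *\<^sub>R v) x\<bar> \<le> b" for x using that(4) by (simp add: scaleR_fun_def)
    then have d: "u - a *\<^sub>R v \<in> bfun" "\<bar>\<psi> (u - a *\<^sub>R v)\<bar> \<le> b"
      by (rule bfunI, rule contraction_bound[OF \<psi>])
    have "u = (u - a *\<^sub>R v) + a *\<^sub>R v" by simp
    then have "\<psi> u = \<psi> (u - a *\<^sub>R v) + a * \<psi> v"
      using contraction_add[OF \<psi> d(1) subspace_scale[OF subspace_bfun v]] contraction_scale[OF \<psi> v]
      by metis
    moreover have "0 \<le> 1 / 4 ^ n * a" using that(1) by simp
    then have "2 * b < \<eta> / 2" using that(3) by (intro tn) linarith
    ultimately show ?thesis using d(2) by linarith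
  qed
  have "((\<lambda>f. s f * \<psi> (w f)) \<longlongrightarrow> s0 * \<psi> w0) F" by (intro tendsto_mult s w \<psi>)
  then have "eventually (\<lambda>f. \<bar>s f * \<psi> (w f) - s0 * \<psi> w0\<bar> < \<eta> / 2) F"
    using \<eta> by (auto dest: tendstoD[where e = "\<eta> / 2"] simp: dist_real_def)
  with st show "eventually (\<lambda>f. dist (\<psi> (f j)) (\<psi> (f0 j)) < \<eta>) F"
  proof eventually_elim
    case (elim f)
    then have "\<bar>\<psi> (f j) - s f * \<psi> (w f)\<bar> < \<eta> / 4" by (intro error[of _ _ "t f"]) auto
    moreover have "\<bar>\<psi> (f0 j) - s0 * \<psi> w0\<bar> < \<eta> / 4" using s0 by (intro error[of _ _ t0])
    ultimately show ?case using elim(2) unfolding dist_real_def by linarith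
  qed
qed

definition sup_norm :: "('a \<Rightarrow> real) \<Rightarrow> real" where
  "sup_norm u = (SUP x. \<bar>u x\<bar>)"

lemma sup_norm_upper: "u \<in> bfun \<Longrightarrow> \<bar>u x\<bar> \<le> sup_norm u"
  unfolding sup_norm_def by (rule cSUP_upper) (auto simp: bfun_def intro: bdd_aboveI2)

lemma sup_norm_least: "(\<And>x. \<bar>u x\<bar> \<le> c) \<Longrightarrow> sup_norm u \<le> c"
  unfolding sup_norm_def by (rule cSUP_least) auto

definition single :: "'j \<Rightarrow> ('a \<Rightarrow> real) \<Rightarrow> 'j \<Rightarrow> 'a \<Rightarrow> real" where
  "single j u = (\<lambda>i. if i = j then u else 0)"

lemma single_V: "u \<in> bfun \<Longrightarrow> single j u \<in> V"
  by (simp add: V_def single_def subspace_0[OF subspace_bfun])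

text \<open>Mazur's lemma for finitely many coordinates in the supremum norm. Otherwise a functional
  bounded by the sum of those norms separates \<open>S\<close> from \<open>f0\<close>; it is a
  finite sum of contractions of single coordinates, along which \<open>contraction_tendsto\<close>
  forces convergence to its value at \<open>f0\<close>.\<close>

lemma convex_hull_uniform_limit:
  assumes F: "ultrafilter F" and ev: "eventually (\<lambda>f. f \<in> X \<and> N f \<le> r) F"
    and lim: "\<And>j x. ((\<lambda>f. f j x) \<longlongrightarrow> f0 j x) F"
    and S: "convex S" "S \<subseteq> X" "eventually (\<lambda>f. f \<in> S) F"
    and J: "finite J" and e: "e > 0"
  shows "\<exists>g\<in>S. \<forall>j\<in>J. \<forall>x. \<bar>g j x - f0 j x\<bar> \<le> e"
proof (rule ccontr)
  assume no: "\<not> ?thesis"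
  have Fnb: "F \<noteq> bot" by (rule ultrafilter_not_bot[OF F])
  have f0: "f0 \<in> X" by (rule N_limit(1)[OF F ev lim])
  define T where "T z = (\<Sum>j\<in>J. sup_norm (z j))" for z :: "'j \<Rightarrow> 'a \<Rightarrow> real"
  have T: "sublinear_on V T"
    unfolding sublinear_on_def
  proof (intro conjI ballI allI impI)
    fix y z assume yz: "y \<in> V" "z \<in> V"
    have "sup_norm ((y + z) j) \<le> sup_norm (y j) + sup_norm (z j)" for j
    proof (rule sup_norm_least)
      show "\<bar>(y + z) j x\<bar> \<le> sup_norm (y j) + sup_norm (z j)" for x
        using sup_norm_upper[OF V_bfun[OF yz(1)], of j x] sup_norm_upper[OF V_bfun[OF yz(2)], of j x]
        by simp
    qed
    then show "T (y + z) \<le> T y + T z" unfolding T_def sum.distrib[symmetric] by (intro sum_mono)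
  next
    fix c :: real and z assume c: "c > 0" and z: "z \<in> V"
    have "sup_norm ((c *\<^sub>R z) j) \<le> c * sup_norm (z j)" for j
    proof (rule sup_norm_least)
      show "\<bar>(c *\<^sub>R z) j x\<bar> \<le> c * sup_norm (z j)" for x
        using sup_norm_upper[OF V_bfun[OF z], of j x] c by (simp add: scaleR_fun_def abs_mult)
    qed
    then show "T (c *\<^sub>R z) \<le> c * T z" unfolding T_def sum_distrib_left by (intro sum_mono)
  qed
  obtain s0 where s0: "s0 \<in> S" using eventually_happens'[OF Fnb S(3)] by blast
  have "(\<lambda>g. g - f0) ` S = (\<lambda>g. - f0 + g) ` S" by (simp add: image_def)
  then have cvx: "convex ((\<lambda>g. g - f0) ` S)" using convex_translation[OF S(1), of "- f0"] by simp
  have SV: "(\<lambda>g. g - f0) ` S \<subseteq> V"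
    using S(2) X_V f0 by (auto intro!: subspace_diff[OF subspace_V])
  have "e \<le> T k" if k: "k \<in> (\<lambda>g. g - f0) ` S" for k
  proof -
    obtain g where g: "g \<in> S" "k = g - f0" using k by blast
    then obtain j x where j: "j \<in> J" "e < \<bar>k j x\<bar>" using no by (auto simp: not_le)
    have kV: "k \<in> V" using SV k by blast
    have "e \<le> sup_norm (k j)" using j sup_norm_upper[OF V_bfun[OF kV], of j x] by linarith
    also have "sup_norm (k j) \<le> T k"
      unfolding T_def using J j(1)
      by (intro member_le_sum) (use sup_norm_upper[OF V_bfun[OF kV]] abs_ge_zero order_trans in blast)+
    finally show ?thesis .
  qed
  from hahn_banach_separation[OF subspace_V T cvx _ SV this]
  obtain \<psi> where \<psi>: "linear_map_on V \<psi>" "\<And>z. z \<in> V \<Longrightarrow> \<psi> z \<le> T z"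
    "\<And>k. k \<in> (\<lambda>g. g - f0) ` S \<Longrightarrow> e \<le> \<psi> k"
    using s0 by (metis empty_iff imageI)
  have \<psi>_abs: "\<bar>\<psi> z\<bar> \<le> T z" if z: "z \<in> V" for z
  proof -
    have "\<psi> ((-1) *\<^sub>R z) = (-1) *\<^sub>R \<psi> z" using \<psi>(1) z unfolding linear_map_on_def by blast
    moreover have "sup_norm ((- z) j) = sup_norm (z j)" for j by (simp add: sup_norm_def)
    then have "T (- z) = T z" by (simp add: T_def)
    ultimately show ?thesis
      using \<psi>(2)[OF z] \<psi>(2)[OF subspace_neg[OF subspace_V z]] by (simp add: abs_le_iff)
  qed
  have contr: "contraction (\<lambda>u. \<psi> (single j u))" if j: "j \<in> J" for j
    unfolding contraction_def linear_map_on_def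
  proof (intro conjI ballI allI impI)
    fix u v :: "'a \<Rightarrow> real" assume "u \<in> bfun" "v \<in> bfun"
    moreover have "single j (u + v) = single j u + single j v" by (simp add: single_def fun_eq_iff)
    ultimately show "\<psi> (single j (u + v)) = \<psi> (single j u) + \<psi> (single j v)"
      using \<psi>(1) single_V by (simp add: linear_map_on_def)
  next
    fix c and u :: "'a \<Rightarrow> real" assume "u \<in> bfun"
    moreover have "single j (c *\<^sub>R u) = c *\<^sub>R single j u" by (simp add: single_def fun_eq_iff scaleR_fun_def)
    ultimately show "\<psi> (single j (c *\<^sub>R u)) = c *\<^sub>R \<psi> (single j u)"
      using \<psi>(1) single_V by (simp add: linear_map_on_def)
  next
    fix u :: "'a \<Rightarrow> real" and c assume c: "\<forall>x. \<bar>u x\<bar> \<le> c"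
    then have "\<bar>\<psi> (single j u)\<bar> \<le> T (single j u)" by (intro \<psi>_abs single_V) (auto intro: bfunI)
    also have "\<dots> = (\<Sum>i\<in>J. if i = j then sup_norm u else 0)"
      unfolding T_def by (intro sum.cong) (auto simp: single_def sup_norm_def)
    also have "\<dots> = sup_norm u" using J j by (simp add: sum.delta')
    also have "\<dots> \<le> c" using c by (intro sup_norm_least) simp
    finally show "\<bar>\<psi> (single j u)\<bar> \<le> c" .
  qed
  \<comment> \<open>\<open>z\<close> and the sum of its components in \<open>J\<close> agree on
    \<open>J\<close>, so \<open>T\<close> vanishes on their difference, and with it
    \<open>\<psi>\<close>.\<close>
  have \<psi>_sum: "\<psi> z = (\<Sum>j\<in>J. \<psi> (single j (z j)))" if z: "z \<in> V" for z
  proof -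
    define y where "y = (\<Sum>j\<in>J. 1 *\<^sub>R single j (z j))"
    have yV: "y \<in> V"
      unfolding y_def using V_bfun[OF z]
      by (intro subspace_sum[OF subspace_V] subspace_scale[OF subspace_V] single_V)
    have "\<psi> y = (\<Sum>j\<in>J. 1 * \<psi> (single j (z j)))"
      unfolding y_def by (intro linear_map_on_sum[OF subspace_V \<psi>(1)] single_V V_bfun[OF z])
    moreover have "y j = z j" if "j \<in> J" for j
      using J that by (simp add: y_def sum_fun_eval single_def if_distrib[of "\<lambda>u. u _"] cong: if_cong)
    then have "T (z - y) = 0" by (simp add: T_def sup_norm_def)
    then have "\<psi> (z - y) = 0" using \<psi>_abs[of "z - y"] subspace_diff[OF subspace_V z yV] by simp
    ultimately show ?thesis using linear_map_on_diff[OF subspace_V \<psi>(1) z yV] by simp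
  qed
  have "((\<lambda>f. \<psi> f - \<psi> f0) \<longlongrightarrow> (\<Sum>j\<in>J. \<psi> (single j (f0 j))) - \<psi> f0) F"
  proof (rule Lim_transform_eventually)
    show "((\<lambda>f. (\<Sum>j\<in>J. \<psi> (single j (f j))) - \<psi> f0) \<longlongrightarrow> (\<Sum>j\<in>J. \<psi> (single j (f0 j))) - \<psi> f0) F"
      by (intro tendsto_intros contraction_tendsto[OF F ev lim contr])
    show "eventually (\<lambda>f. (\<Sum>j\<in>J. \<psi> (single j (f j))) - \<psi> f0 = \<psi> f - \<psi> f0) F"
      using ev by eventually_elim (simp add: \<psi>_sum[OF X_V])
  qed
  moreover have "eventually (\<lambda>f. e \<le> \<psi> f - \<psi> f0) F"
    using S(3)
  proof eventually_elim
    case (elim f)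
    then have "e \<le> \<psi> (f - f0)" by (intro \<psi>(3)) auto
    then show ?case using linear_map_on_diff[OF subspace_V \<psi>(1)] X_V f0 S(2) elim by auto
  qed
  ultimately have "e \<le> (\<Sum>j\<in>J. \<psi> (single j (f0 j))) - \<psi> f0" by (rule tendsto_lowerbound[OF _ _ Fnb])
  then show False using \<psi>_sum[OF X_V[OF f0]] e by simp
qed

end

section \<open>Mazur's lemma and closed subspaces\<close>

lemma L2_set_le_iff: "0 \<le> r \<Longrightarrow> L2_set f I \<le> r \<longleftrightarrow> (\<Sum>i\<in>I. (f i)\<^sup>2) \<le> r\<^sup>2"
  unfolding L2_set_def using real_sqrt_le_iff[of "\<Sum>i\<in>I. (f i)\<^sup>2" "r\<^sup>2"] by simp

lemma L2_set_squared: "(L2_set f I)\<^sup>2 = (\<Sum>i\<in>I. (f i)\<^sup>2)"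
  by (simp add: L2_set_def sum_nonneg)

context disc_sequence
begin

text \<open>On \<open>I\<close> the vector \<open>h\<close> adds at most \<eta>; off
  \<open>I\<close> the vector \<open>s\<close> has squared mass at most
  \<open>\<eta>\<^sup>2\<close> left. The two index ranges contribute separately to the squared
  norm.\<close>

lemma N_almost_disjoint:
  assumes s: "s \<in> X" and h: "h \<in> X" and \<eta>: "\<eta> \<ge> 0" and I: "finite I"
    and tail: "(N s)\<^sup>2 \<le> (L2_set (\<lambda>i. p i s) I)\<^sup>2 + \<eta>\<^sup>2" and small: "L2_set (\<lambda>i. p i h) I \<le> \<eta>"
  shows "(N (s + h))\<^sup>2 \<le> (N s + \<eta>)\<^sup>2 + (N h + \<eta>)\<^sup>2"
proof -
  define R where "R = (N s + \<eta>)\<^sup>2 + (N h + \<eta>)\<^sup>2"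
  have R: "R \<ge> 0" by (simp add: R_def)
  have "N (s + h) \<le> sqrt R"
  proof (rule N_leI)
    fix I' :: "('j \<times> nat) set" assume I': "finite I'"
    let ?J = "I' - I"
    have J: "finite ?J" using I' by simp
    have "L2_set (\<lambda>i. p i (s + h)) I \<le> N s + \<eta>"
      using L2_add[OF X_V[OF s] X_V[OF h], of I] L2_le_N[OF s I] small by linarith
    then have 1: "(\<Sum>i\<in>I. (p i (s + h))\<^sup>2) \<le> (N s + \<eta>)\<^sup>2"
      using N_nonneg[OF s] \<eta> by (intro L2_set_le_iff[THEN iffD1]) simp_all
    have "(\<Sum>i\<in>I. (p i s)\<^sup>2) + (\<Sum>i\<in>?J. (p i s)\<^sup>2) = (\<Sum>i\<in>I \<union> ?J. (p i s)\<^sup>2)"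
      using I J by (intro sum.union_disjoint[symmetric]) auto
    also have "\<dots> \<le> (N s)\<^sup>2"
      using I J by (intro L2_set_le_iff[THEN iffD1] N_nonneg[OF s] L2_le_N[OF s]) simp
    finally have "(\<Sum>i\<in>?J. (p i s)\<^sup>2) \<le> \<eta>\<^sup>2"
      using tail by (simp add: L2_set_squared)
    then have "L2_set (\<lambda>i. p i s) ?J \<le> \<eta>" by (rule L2_set_le_iff[OF \<eta>, THEN iffD2])
    then have "L2_set (\<lambda>i. p i (s + h)) ?J \<le> N h + \<eta>"
      using L2_add[OF X_V[OF s] X_V[OF h], of ?J] L2_le_N[OF h J] by linarith
    then have 2: "(\<Sum>i\<in>?J. (p i (s + h))\<^sup>2) \<le> (N h + \<eta>)\<^sup>2"
      using N_nonneg[OF h] \<eta> by (intro L2_set_le_iff[THEN iffD1]) simp_all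
    have "(\<Sum>i\<in>I'. (p i (s + h))\<^sup>2) \<le> (\<Sum>i\<in>I \<union> ?J. (p i (s + h))\<^sup>2)"
      using I J by (intro sum_mono2) auto
    also have "\<dots> = (\<Sum>i\<in>I. (p i (s + h))\<^sup>2) + (\<Sum>i\<in>?J. (p i (s + h))\<^sup>2)"
      using I J by (intro sum.union_disjoint) auto
    also have "\<dots> \<le> R" unfolding R_def by (intro add_mono 1 2)
    finally show "L2_set (\<lambda>i. p i (s + h)) I' \<le> sqrt R"
      using L2_set_le_iff[of "sqrt R" "\<lambda>i. p i (s + h)" I'] R by simp
  qed
  then have "(N (s + h))\<^sup>2 \<le> (sqrt R)\<^sup>2"
    using N_nonneg[OF X_add[OF s h]] by (intro power_mono)
  then show ?thesis using R by (simp add: R_def)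
qed

lemma N_tail:
  assumes s: "s \<in> X" and \<eta>: "\<eta> > 0"
  obtains I where "finite I" "(N s)\<^sup>2 \<le> (L2_set (\<lambda>i. p i s) I)\<^sup>2 + \<eta>\<^sup>2"
proof (cases "N s = 0")
  case True
  then show ?thesis using that[of "{}"] by simp
next
  case False
  then have pos: "N s > 0" using N_nonneg[OF s] by simp
  \<comment> \<open>Lowering \<open>N s\<close> by \<delta> costs at most
    \<open>2 * N s * \<delta> \<le> \<eta>\<^sup>2\<close> in the square; \<delta> is kept below
    \<open>N s\<close> so that squaring remains monotone.\<close>
  define \<delta> where "\<delta> = min (N s) (\<eta>\<^sup>2 / (2 * N s))"
  have \<delta>: "0 < \<delta>" "\<delta> \<le> N s" "2 * N s * \<delta> \<le> \<eta>\<^sup>2"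
    using pos \<eta> by (auto simp: \<delta>_def min_def field_simps)
  have "\<exists>I. finite I \<and> N s - \<delta> < L2_set (\<lambda>i. p i s) I"
  proof (rule ccontr)
    assume "\<not> ?thesis"
    then have "N s \<le> N s - \<delta>" by (intro N_leI) (auto simp: not_less)
    then show False using \<delta> by simp
  qed
  then obtain I where I: "finite I" "N s - \<delta> < L2_set (\<lambda>i. p i s) I" by blast
  have "(N s)\<^sup>2 \<le> (N s - \<delta>)\<^sup>2 + 2 * N s * \<delta>" by (simp add: power2_eq_square algebra_simps)
  also have "(N s - \<delta>)\<^sup>2 \<le> (L2_set (\<lambda>i. p i s) I)\<^sup>2"
    using \<delta>(2) I(2) by (intro power_mono) auto
  finally show ?thesis using that[OF I(1)] \<delta>(3) by linarith
qed

lemma p_le_sup: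
  assumes "\<And>x. \<bar>h (fst i) x\<bar> \<le> c"
  shows "p i h \<le> 2 ^ snd i * c"
  unfolding p_def by (rule compact_disc.gauge_le_sup[OF disc assms])

text \<open>
  Gliding hump: each summand is chosen uniformly small on the coordinates that carry most of the norm
  of the partial sum, so the squared norms nearly add up and the averages tend to zero.
\<close>

lemma mazur:
  assumes F: "ultrafilter F" and ev: "eventually (\<lambda>f. f \<in> X \<and> N f \<le> r) F"
    and lim: "\<And>j x. ((\<lambda>f. f j x) \<longlongrightarrow> f0 j x) F"
    and S: "convex S" "S \<subseteq> X" "eventually (\<lambda>f. f \<in> S) F" and e: "e > 0"
  shows "\<exists>g\<in>S. N (g - f0) < e"
proof -
  have Fnb: "F \<noteq> bot" by (rule ultrafilter_not_bot[OF F])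
  have f0: "f0 \<in> X" "N f0 \<le> r" by (rule N_limit[OF F ev lim])+
  \<comment> \<open>The hump argument needs a uniform bound on the summands, hence the restriction
    of \<open>S\<close> to a ball.\<close>
  define B where "B = {f \<in> S. N f \<le> r}"
  have Bev: "eventually (\<lambda>f. f \<in> B) F" using ev S(3) by eventually_elim (simp add: B_def)
  have BX: "B \<subseteq> X" using S by (auto simp: B_def)
  have Bcvx: "convex B"
  proof (rule convexI)
    fix f g and s t :: real assume fg: "f \<in> B" "g \<in> B" and st: "0 \<le> s" "0 \<le> t" "s + t = 1"
    have fgX: "f \<in> X" "g \<in> X" using fg BX by auto
    have "N (s *\<^sub>R f + t *\<^sub>R g) \<le> s * N f + t * N g"
      using N_add[OF X_scale[OF fgX(1)] X_scale[OF fgX(2)], of s t] st by (simp add: N_scale fgX)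
    also have "\<dots> \<le> s * r + t * r" using fg st by (intro add_mono mult_left_mono) (auto simp: B_def)
    finally show "s *\<^sub>R f + t *\<^sub>R g \<in> B"
      using fg st convexD[OF S(1), of f g s t] by (simp add: B_def distrib_right[symmetric])
  qed
  have dX: "g - f0 \<in> X" if "g \<in> B" for g using that BX f0 subspace_diff[OF subspace_X] by blast
  have dN: "N (g - f0) \<le> 2 * r" if g: "g \<in> B" for g
  proof -
    have "N (g + (-1) *\<^sub>R f0) \<le> N g + N ((-1) *\<^sub>R f0)"
      using g BX f0 by (intro N_add X_scale) auto
    then show ?thesis using N_scale[OF f0(1), of "-1"] f0 g by (simp add: B_def)
  qed
  obtain g0 where g0: "g0 \<in> B" using eventually_happens'[OF Fnb Bev] by blast
  have r: "0 \<le> r" using f0 N_nonneg[OF f0(1)] by linarith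
  \<comment> \<open>Each summand \<open>g - f0\<close> has norm at most 2 * r; the additional 1
    absorbs the error of one hump.\<close>
  define M where "M = (2 * r)\<^sup>2 + 1"
  have M: "M > 0" "(2 * r)\<^sup>2 \<le> M" by (simp_all add: M_def add_nonneg_pos)
  \<comment> \<open>The scaled vector plays the role of a sum of m + 1 differences. Linear growth of
    its squared norm means that \<open>N (g - f0)\<close> decays like the inverse square root of m +
    1.\<close>
  have "\<exists>g\<in>B. (N (real (Suc m) *\<^sub>R (g - f0)))\<^sup>2 \<le> real (Suc m) * M" for m
  proof (induction m)
    case 0
    have "(N (g0 - f0))\<^sup>2 \<le> (2 * r)\<^sup>2" using dN[OF g0] N_nonneg[OF dX[OF g0]] by (intro power_mono)
    moreover have "real (Suc 0) *\<^sub>R (g0 - f0) = g0 - f0"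
      by (simp only: One_nat_def[symmetric] of_nat_1 scaleR_one)
    moreover have "real (Suc 0) * M = M" by simp
    ultimately show ?case using g0 M(2) by (metis order_trans)
  next
    case (Suc m)
    then obtain g where g: "g \<in> B" "(N (real (Suc m) *\<^sub>R (g - f0)))\<^sup>2 \<le> real (Suc m) * M" by blast
    define s where "s = real (Suc m) *\<^sub>R (g - f0)"
    have s: "s \<in> X" unfolding s_def by (rule X_scale[OF dX[OF g(1)]])
    \<comment> \<open>Expanding the two squares leaves an error
      \<open>\<eta> * (2 * N s + 4 * r + 2 * \<eta>)\<close>, which this choice keeps below
      1.\<close>
    define \<eta> where "\<eta> = min 1 (1 / (2 * N s + 4 * r + 2))"
    have \<eta>: "0 < \<eta>" "\<eta> \<le> 1" "\<eta> * (2 * N s + 4 * r + 2) \<le> 1"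
      using N_nonneg[OF s] r by (auto simp: \<eta>_def min_def field_simps)
    obtain I where I: "finite I" "(N s)\<^sup>2 \<le> (L2_set (\<lambda>i. p i s) I)\<^sup>2 + \<eta>\<^sup>2"
      by (rule N_tail[OF s \<eta>(1)])
    \<comment> \<open>Passing from the supremum norm to the gauges on \<open>I\<close> costs the
      total weight of \<open>I\<close>; the summand 1 keeps the divisor positive when
      \<open>I\<close> is empty.\<close>
    define C :: real where "C = (\<Sum>i\<in>I. 2 ^ snd i) + 1"
    have C: "C > 0" unfolding C_def by (intro add_nonneg_pos sum_nonneg) auto
    obtain g' where g': "g' \<in> B" "\<And>j x. j \<in> fst ` I \<Longrightarrow> \<bar>g' j x - f0 j x\<bar> \<le> \<eta> / C"
      using convex_hull_uniform_limit[OF F ev lim Bcvx BX Bev, of "fst ` I" "\<eta> / C"] I(1) \<eta>(1) C by auto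
    define h where "h = g' - f0"
    have h: "h \<in> X" "N h \<le> 2 * r" unfolding h_def by (rule dX[OF g'(1)], rule dN[OF g'(1)])
    have "L2_set (\<lambda>i. p i h) I \<le> (\<Sum>i\<in>I. p i h)" by (rule L2_set_le_sum) (rule p_nonneg[OF X_V[OF h(1)]])
    also have "\<dots> \<le> (\<Sum>i\<in>I. 2 ^ snd i * (\<eta> / C))"
      by (intro sum_mono p_le_sup) (simp add: h_def g'(2))
    also have "\<dots> = (C - 1) * (\<eta> / C)" by (simp add: C_def sum_distrib_right sum_divide_distrib)
    also have "\<dots> \<le> \<eta>" using C \<eta>(1) by (simp add: field_simps)
    finally have small: "L2_set (\<lambda>i. p i h) I \<le> \<eta>" .
    have "(N (s + h))\<^sup>2 \<le> (N s + \<eta>)\<^sup>2 + (N h + \<eta>)\<^sup>2"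
      by (rule N_almost_disjoint[OF s h(1) less_imp_le[OF \<eta>(1)] I small])
    also have "\<dots> \<le> (N s + \<eta>)\<^sup>2 + (2 * r + \<eta>)\<^sup>2"
      using h N_nonneg[OF h(1)] \<eta>(1) by (intro add_left_mono power_mono) auto
    also have "\<dots> = (N s)\<^sup>2 + (2 * r)\<^sup>2 + \<eta> * (2 * N s + 4 * r + 2 * \<eta>)"
      by (simp add: power2_eq_square algebra_simps)
    also have "\<eta> * (2 * N s + 4 * r + 2 * \<eta>) \<le> \<eta> * (2 * N s + 4 * r + 2)"
      using \<eta> by (intro mult_left_mono) auto
    also have "(N s)\<^sup>2 + (2 * r)\<^sup>2 + \<eta> * (2 * N s + 4 * r + 2) \<le> real (Suc m) * M + M"
      using g(2) \<eta>(3) by (simp add: s_def M_def)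
    finally have N_sh: "(N (s + h))\<^sup>2 \<le> real (Suc (Suc m)) * M" by (simp add: algebra_simps)
    define k where "k = real (Suc (Suc m))"
    have k: "k > 0" "real (Suc m) = k - 1" by (simp_all add: k_def)
    \<comment> \<open>The weights are those that turn the average of the previous terms into the
      average with one more term.\<close>
    define g'' where "g'' = ((k - 1) / k) *\<^sub>R g + (1 / k) *\<^sub>R g'"
    have "g'' \<in> B" unfolding g''_def using k g g'
      by (intro convexD[OF Bcvx]) (auto simp: k_def field_simps)
    moreover have "k *\<^sub>R (g'' - f0) = s + h"
    proof (intro ext)
      fix j x
      have "s j x = (k - 1) * (g j x - f0 j x)"
        unfolding s_def k(2) by (simp add: scaleR_fun_def)
      then show "(k *\<^sub>R (g'' - f0)) j x = (s + h) j x"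
        using k(1) by (simp add: g''_def h_def scaleR_fun_def right_diff_distrib distrib_left)
          (simp add: left_diff_distrib)
    qed
    ultimately show ?case using N_sh unfolding k_def by metis
  qed
  then obtain g where g: "\<And>m. g m \<in> B"
    "\<And>m. (N (real (Suc m) *\<^sub>R (g m - f0)))\<^sup>2 \<le> real (Suc m) * M" by metis
  obtain m :: nat where m: "M / e\<^sup>2 < real m" using reals_Archimedean2 by blast
  have "(real (Suc m))\<^sup>2 * (N (g m - f0))\<^sup>2 \<le> real (Suc m) * M"
    using g(2)[of m] by (simp add: N_scale[OF dX[OF g(1)]] power_mult_distrib)
  then have "real (Suc m) * (N (g m - f0))\<^sup>2 \<le> M"
    by (simp add: power2_eq_square mult.assoc del: of_nat_Suc)
  also have "M < real (Suc m) * e\<^sup>2" using m e by (simp add: field_simps) (smt (verit) zero_less_power)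
  finally have "(N (g m - f0))\<^sup>2 < e\<^sup>2" by (simp del: of_nat_Suc)
  then have "N (g m - f0) < e" using e by (intro power2_less_imp_less[of _ e]) auto
  then show ?thesis using g(1)[of m] by (auto simp: B_def)
qed

section \<open>Closed subspaces are reflexive and complete\<close>

context
  fixes Y :: "('j \<Rightarrow> 'a \<Rightarrow> real) set"
  assumes Y: "subspace Y" "Y \<subseteq> X"
    and closed: "\<And>f. f \<in> X \<Longrightarrow> (\<And>e. e > 0 \<Longrightarrow> \<exists>g\<in>Y. N (g - f) < e) \<Longrightarrow> f \<in> Y"
begin

text \<open>The pointwise ultralimit is the weak limit. \<open>mazur\<close> puts it into
  \<open>Y\<close>; if some functional failed to converge, a half-space away from the limit would
  eventually contain \<open>f\<close>, and \<open>mazur\<close> would find points of it arbitrarily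
  close to the limit. The functionals on \<open>Y\<close> need not be described.\<close>

lemma reflexive_closed_subspace: "reflexive_on Y N"
proof (rule reflexive_onI)
  show normed: "normed_space_on Y N" by (rule normed_space_X[OF Y(2,1)])
  fix F :: "('j \<Rightarrow> 'a \<Rightarrow> real) filter" and r
  assume F: "ultrafilter F" and "eventually (\<lambda>f. f \<in> Y \<and> N f \<le> r) F"
  then have evY: "eventually (\<lambda>f. f \<in> Y) F" and ev: "eventually (\<lambda>f. f \<in> X \<and> N f \<le> r) F"
    using Y(2) by (auto elim: eventually_mono)
  have Fnb: "F \<noteq> bot" by (rule ultrafilter_not_bot[OF F])
  have "\<exists>l. \<forall>z. \<bar>l z\<bar> \<le> r \<and> ((\<lambda>f. f (fst z) (snd z)) \<longlongrightarrow> l z) F"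
  proof (intro choice allI ultrafilter_bounded_limit[OF F])
    show "eventually (\<lambda>f. \<bar>f (fst z) (snd z)\<bar> \<le> r) F" for z
      using ev by eventually_elim (use pointwise_le_N in \<open>meson order_trans\<close>)
  qed
  then obtain l where l: "\<And>z. ((\<lambda>f. f (fst z) (snd z)) \<longlongrightarrow> l z) F" by blast
  define f0 where "f0 j x = l (j, x)" for j x
  have lim: "((\<lambda>f. f j x) \<longlongrightarrow> f0 j x) F" for j x using l[of "(j, x)"] by (simp add: f0_def)
  have f0: "f0 \<in> X" "N f0 \<le> r" by (rule N_limit[OF F ev lim])+
  have f0Y: "f0 \<in> Y"
    by (rule closed[OF f0(1)], rule mazur[OF F ev lim subspace_imp_convex[OF Y(1)] Y(2) evY])
  have "(\<phi> \<longlongrightarrow> \<phi> f0) F" if \<phi>: "\<phi> \<in> dual_space Y N" for \<phi>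
  proof (rule tendstoI)
    fix e :: real assume e: "e > 0"
    obtain C where C: "C \<ge> 0" "\<And>f. f \<in> Y \<Longrightarrow> \<bar>\<phi> f\<bar> \<le> C * N f" using dual_boundE[OF normed \<phi>] by blast
    have lin: "linear_map_on Y \<phi>" by (rule dual_linear[OF normed \<phi>])
    \<comment> \<open>The signs 1 and -1 yield the two one-sided estimates.\<close>
    have half: "eventually (\<lambda>f. a * (\<phi> f - \<phi> f0) < e) F" if a: "\<bar>a\<bar> = 1" for a :: real
    proof (rule ccontr)
      assume "\<not> ?thesis"
      then have "eventually (\<lambda>f. e \<le> a * (\<phi> f - \<phi> f0)) F"
        using ultrafilter_not_eventually[OF F] by (simp add: not_less)
      define S where "S = {f \<in> Y. e \<le> a * (\<phi> f - \<phi> f0)}"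
      have "eventually (\<lambda>f. f \<in> S) F"
        using evY \<open>eventually (\<lambda>f. e \<le> _ f) F\<close> by eventually_elim (simp add: S_def)
      moreover have "convex S"
      proof (rule convexI)
        fix f g and s t :: real assume fg: "f \<in> S" "g \<in> S" and st: "0 \<le> s" "0 \<le> t" "s + t = 1"
        have "\<phi> (s *\<^sub>R f + t *\<^sub>R g) = s * \<phi> f + t * \<phi> g"
          using lin fg subspace_scale[OF Y(1)] by (simp add: linear_map_on_def S_def)
        moreover have "a * (s * \<phi> f + t * \<phi> g - (s + t) * \<phi> f0) =
            s * (a * (\<phi> f - \<phi> f0)) + t * (a * (\<phi> g - \<phi> f0))" by (simp add: algebra_simps)
        moreover have "s * e + t * e \<le> s * (a * (\<phi> f - \<phi> f0)) + t * (a * (\<phi> g - \<phi> f0))"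
          using fg st by (intro add_mono mult_left_mono) (auto simp: S_def)
        ultimately have "e \<le> a * (\<phi> (s *\<^sub>R f + t *\<^sub>R g) - \<phi> f0)"
          using st by (simp add: distrib_right[symmetric])
        then show "s *\<^sub>R f + t *\<^sub>R g \<in> S"
          using fg by (simp add: S_def subspace_add[OF Y(1)] subspace_scale[OF Y(1)])
      qed
      moreover have "S \<subseteq> X" using Y(2) by (auto simp: S_def)
      moreover have "e / (C + 1) > 0" using e C by simp
      ultimately obtain g where g: "g \<in> S" "N (g - f0) < e / (C + 1)"
        using mazur[OF F ev lim, of S "e / (C + 1)"] by blast
      have gY: "g \<in> Y" "g - f0 \<in> Y" using g f0Y subspace_diff[OF Y(1)] by (auto simp: S_def)
      have "e \<le> a * (\<phi> g - \<phi> f0)" using g by (simp add: S_def)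
      also have "\<dots> \<le> \<bar>\<phi> (g - f0)\<bar>"
        using a linear_map_on_diff[OF Y(1) lin gY(1) f0Y] by (metis abs_ge_self abs_mult mult_1)
      also have "\<dots> \<le> C * N (g - f0)" by (rule C(2)[OF gY(2)])
      also have "\<dots> \<le> (C + 1) * N (g - f0)"
        using N_nonneg gY Y(2) by (intro mult_right_mono) auto
      also have "\<dots> < e" using g(2) C(1) by (simp add: field_simps)
      finally show False by simp
    qed
    have "eventually (\<lambda>f. \<phi> f - \<phi> f0 < e) F" "eventually (\<lambda>f. \<phi> f0 - \<phi> f < e) F"
      using half[of 1] half[of "-1"] by simp_all
    then show "eventually (\<lambda>f. dist (\<phi> f) (\<phi> f0) < e) F"
      by eventually_elim (simp add: dist_real_def abs_less_iff)
  qed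
  then show "\<exists>f0\<in>Y. N f0 \<le> r \<and> (\<forall>\<phi>\<in>dual_space Y N. (\<phi> \<longlongrightarrow> \<phi> f0) F)" using f0Y f0(2) by blast
qed

text \<open>The candidate is a pointwise limit along an ultrafilter. \<open>N_limit\<close>, applied
  to differences, turns the Cauchy estimate into convergence of the full sequence.\<close>

lemma banach_closed_subspace: "banach_space_on Y N"
proof -
  have normed: "normed_space_on Y N" by (rule normed_space_X[OF Y(2,1)])
  interpret M: Metric_space Y "norm_dist Y N" by (rule Metric_space_norm_dist[OF normed])
  have "\<exists>x. limitin M.mtopology \<sigma> x sequentially" if \<sigma>: "M.MCauchy \<sigma>" for \<sigma>
  proof -
    have \<sigma>Y: "\<sigma> n \<in> Y" for n using \<sigma> by (auto simp: M.MCauchy_def)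
    then have \<sigma>X: "\<sigma> n \<in> X" for n using Y by blast
    have diffX: "\<sigma> n - \<sigma> m \<in> X" for n m using \<sigma>X subspace_diff[OF subspace_X] by blast
    have cauchy: "\<exists>M. \<forall>n\<ge>M. \<forall>m\<ge>M. N (\<sigma> n - \<sigma> m) < e" if "e > 0" for e
      using \<sigma> that \<sigma>Y unfolding M.MCauchy_def norm_dist_def by simp
    obtain U where U: "ultrafilter U" "U \<le> sequentially" by (rule ultrafilter_sequentially)
    obtain M0 where M0: "\<And>n m. n \<ge> M0 \<Longrightarrow> m \<ge> M0 \<Longrightarrow> N (\<sigma> n - \<sigma> m) < 1" using cauchy[of 1] by auto
    define R where "R = N (\<sigma> M0) + 1"
    have evR: "eventually (\<lambda>n. \<sigma> n \<in> X \<and> N (\<sigma> n) \<le> R) U"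
      using filter_leD[OF U(2) eventually_ge_at_top[of M0]]
    proof eventually_elim
      case (elim n)
      have "N (\<sigma> n) \<le> N (\<sigma> n - \<sigma> M0) + N (\<sigma> M0)" using N_add[OF diffX \<sigma>X, of n M0 M0] by simp
      then show ?case using M0[of n M0] elim \<sigma>X by (simp add: R_def)
    qed
    have "\<exists>l. \<forall>z. \<bar>l z\<bar> \<le> R \<and> ((\<lambda>n. \<sigma> n (fst z) (snd z)) \<longlongrightarrow> l z) U"
    proof (intro choice allI ultrafilter_bounded_limit[OF U(1)])
      show "eventually (\<lambda>n. \<bar>\<sigma> n (fst z) (snd z)\<bar> \<le> R) U" for z
        using evR by eventually_elim (use pointwise_le_N in \<open>meson order_trans\<close>)
    qed
    then obtain l where l: "\<And>z. ((\<lambda>n. \<sigma> n (fst z) (snd z)) \<longlongrightarrow> l z) U" by blast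
    define f0 where "f0 j x = l (j, x)" for j x
    have lim: "((\<lambda>n. \<sigma> n j x) \<longlongrightarrow> f0 j x) U" for j x using l[of "(j, x)"] by (simp add: f0_def)
    have f0X: "f0 \<in> X" by (rule N_limit(1)[OF U(1) evR lim])
    have close: "\<exists>M. \<forall>n\<ge>M. N (\<sigma> n - f0) < e" if e: "e > 0" for e
    proof -
      obtain M where M: "\<And>n m. n \<ge> M \<Longrightarrow> m \<ge> M \<Longrightarrow> N (\<sigma> n - \<sigma> m) < e / 2" using cauchy[of "e/2"] e by auto
      have "N (\<sigma> n - f0) \<le> e / 2" if n: "n \<ge> M" for n
      proof (rule N_limit(2)[OF U(1)])
        show "eventually (\<lambda>m. \<sigma> n - \<sigma> m \<in> X \<and> N (\<sigma> n - \<sigma> m) \<le> e / 2) U"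
          using filter_leD[OF U(2) eventually_ge_at_top[of M]]
          by eventually_elim (use M[OF n] diffX in \<open>auto intro: less_imp_le\<close>)
        show "((\<lambda>m. (\<sigma> n - \<sigma> m) j x) \<longlongrightarrow> (\<sigma> n - f0) j x) U" for j x
          by (auto intro!: tendsto_intros lim)
      qed
      then show ?thesis using e by (intro exI[of _ M]) force
    qed
    have f0Y: "f0 \<in> Y"
    proof (rule closed[OF f0X])
      show "\<exists>g\<in>Y. N (g - f0) < e" if "e > 0" for e using close[OF that] \<sigma>Y by blast
    qed
    have "limitin M.mtopology \<sigma> f0 sequentially"
      unfolding M.limit_metric_sequentially using close f0Y \<sigma>Y by (simp add: norm_dist_def)
    then show ?thesis by blast
  qed
  then show ?thesis by (simp add: banach_space_on_def normed M.mcomplete_def)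
qed

end

end

section \<open>The truncated metric and its cocycle\<close>

locale stable_metric_group =
  fixes d :: "'g::topological_group_add \<Rightarrow> 'g \<Rightarrow> real"
  assumes compatible: "compatible_metric d" and left: "left_invariant d"
    and stable: "stable_metric UNIV d"
begin

sublocale d: Metric_space UNIV d
  using compatible by (simp add: compatible_metric_def)

text \<open>A tent at scale \<open>2 ^ j\<close>: equal to 1 on the diagonal, 0 from distance
  \<open>2 ^ j\<close> on, and Lipschitz with constant \<open>1 / 2 ^ j\<close> in either
  variable.\<close>

definition k :: "nat \<Rightarrow> 'g \<Rightarrow> 'g \<Rightarrow> real" where
  "k j x y = max 0 (1 - d x y / 2 ^ j)"

lemma k_commute: "k j x y = k j y x"
  by (simp add: k_def d.commute)

lemma k_bounds: "0 \<le> k j x y" "k j x y \<le> 1" "\<bar>k j x y\<bar> \<le> 1"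
  by (simp_all add: k_def)

lemma d_shift: "d (- g + x) y = d x (g + y)"
  using left[unfolded left_invariant_def, rule_format, of g "- g + x" y]
  by (simp add: add.assoc[symmetric])

lemma k_shift: "k j (- g + x) y = k j x (g + y)"
  by (simp add: k_def d_shift)

lemma k_far: "2 ^ j \<le> d x y \<Longrightarrow> k j x y = 0"
  by (simp add: k_def field_simps)

lemma eventually_k_zero:
  assumes "\<And>R. eventually (\<lambda>n. R < d (a n) 0) U"
  shows "eventually (\<lambda>n. k j (a n) y = 0) U"
  using assms[of "2 ^ j + d y 0"]
proof eventually_elim
  case (elim n)
  have "d (a n) 0 \<le> d (a n) y + d y 0" by (rule d.triangle) simp_all
  then show ?case using elim by (intro k_far) linarith
qed

text \<open>With \<open>b m\<close> fixed, \<open>a n\<close> leaves the support of the kernel, so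
  \<open>l' = 0\<close>. In the other order, if \<open>b\<close> is bounded along \<open>V\<close>,
  a distant \<open>a n\<close> is far from almost all \<open>b m\<close>; if not, \<open>b\<close>
  itself escapes from every fixed \<open>a n\<close>.\<close>

lemma double_limit_unbounded:
  fixes a b :: "nat \<Rightarrow> 'g"
  assumes U: "ultrafilter U" and V: "ultrafilter V"
    and \<alpha>: "\<And>n. ((\<lambda>m. k j (a n) (b m)) \<longlongrightarrow> \<alpha> n) V" "(\<alpha> \<longlongrightarrow> l) U"
    and \<beta>: "\<And>m. ((\<lambda>n. k j (a n) (b m)) \<longlongrightarrow> \<beta> m) U" "(\<beta> \<longlongrightarrow> l') V"
    and unb: "\<And>R. eventually (\<lambda>n. R < d (a n) 0) U"
  shows "l = 0" "l' = 0"
proof -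
  have Unb: "U \<noteq> bot" and Vnb: "V \<noteq> bot" using U V by (simp_all add: ultrafilter_not_bot)
  have "\<beta> m = 0" for m
    by (rule tendsto_unique[OF Unb \<beta>(1)], rule tendsto_eventually, rule eventually_k_zero[OF unb])
  then show "l' = 0"
    by (intro tendsto_unique[OF Vnb \<beta>(2)] tendsto_eventually always_eventually allI)
  have "eventually (\<lambda>n. \<alpha> n = 0) U"
  proof (cases "\<exists>R. eventually (\<lambda>m. d (b m) 0 \<le> R) V")
    case True
    then obtain R where R: "eventually (\<lambda>m. d (b m) 0 \<le> R) V" by blast
    show ?thesis
      using unb[of "R + 2 ^ j"]
    proof eventually_elim
      case (elim n)
      have "eventually (\<lambda>m. k j (a n) (b m) = 0) V"
        using R
      proof eventually_elim
        case (elim m)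
        have "d (a n) 0 \<le> d (a n) (b m) + d (b m) 0" by (rule d.triangle) simp_all
        then show ?case using elim \<open>R + 2 ^ j < d (a n) 0\<close> by (intro k_far) linarith
      qed
      then show ?case by (intro tendsto_unique[OF Vnb \<alpha>(1)] tendsto_eventually)
    qed
  next
    case False
    then have "eventually (\<lambda>m. R < d (b m) 0) V" for R
      using ultrafilter_not_eventually[OF V, of "\<lambda>m. d (b m) 0 \<le> R"] by (simp add: not_le)
    then have "eventually (\<lambda>m. k j (a n) (b m) = 0) V" for n
      unfolding k_commute[of j "a n"] by (rule eventually_k_zero)
    then have "\<alpha> n = 0" for n
      by (intro tendsto_unique[OF Vnb \<alpha>(1)] tendsto_eventually)
    then show ?thesis by simp
  qed
  then show "l = 0" by (intro tendsto_unique[OF Unb \<alpha>(2)] tendsto_eventually)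
qed

text \<open>The kernel is a continuous function of \<open>d\<close>, so it inherits the interchange
  of limits that stability gives for \<open>d\<close>.\<close>

lemma double_limit_bounded:
  fixes a b :: "nat \<Rightarrow> 'g"
  assumes U: "ultrafilter U" and V: "ultrafilter V"
    and \<alpha>: "\<And>n. ((\<lambda>m. k j (a n) (b m)) \<longlongrightarrow> \<alpha> n) V" "(\<alpha> \<longlongrightarrow> l) U"
    and \<beta>: "\<And>m. ((\<lambda>n. k j (a n) (b m)) \<longlongrightarrow> \<beta> m) U" "(\<beta> \<longlongrightarrow> l') V"
    and aR: "eventually (\<lambda>n. d (a n) 0 \<le> R) U" and bR: "eventually (\<lambda>m. d (b m) 0 \<le> R) V"
  shows "l = l'"
proof -
  have Unb: "U \<noteq> bot" and Vnb: "V \<noteq> bot" using U V by (simp_all add: ultrafilter_not_bot)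
  \<comment> \<open>Stability needs sequences that are bounded outright, not just along the
    ultrafilters. The exceptional terms are moved to 0, which no limit notices.\<close>
  define a' where "a' n = (if d (a n) 0 \<le> R then a n else 0)" for n
  define b' where "b' m = (if d (b m) 0 \<le> R then b m else 0)" for m
  have a'_le: "d (a' n) 0 \<le> \<bar>R\<bar>" and b'_le: "d (b' n) 0 \<le> \<bar>R\<bar>" for n
    by (auto simp: a'_def b'_def)
  have bnd: "\<bar>d (a' n) (b' m)\<bar> \<le> 2 * \<bar>R\<bar>" for n m
    using d.triangle[of "a' n" 0 "b' m"] a'_le[of n] b'_le[of m] by (simp add: d.commute)
  have "range a' \<subseteq> d.mcball 0 \<bar>R\<bar>" "range b' \<subseteq> d.mcball 0 \<bar>R\<bar>"
    using a'_le b'_le by (auto simp: d.commute)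
  then have "d.mbounded (range a')" "d.mbounded (range b')" unfolding d.mbounded_def by blast+
  then have st: "Lim U (\<lambda>n. Lim V (\<lambda>m. d (a' n) (b' m))) = Lim V (\<lambda>m. Lim U (\<lambda>n. d (a' n) (b' m)))"
    using stable U V unfolding stable_metric_def by blast
  define A where "A n = Lim V (\<lambda>m. d (a' n) (b' m))" for n
  define B where "B m = Lim U (\<lambda>n. d (a' n) (b' m))" for m
  have lim: "(f \<longlongrightarrow> Lim W f) W" if W: "ultrafilter W" "\<And>n. \<bar>f n\<bar> \<le> c" for W c and f :: "nat \<Rightarrow> real"
  proof -
    obtain x where x: "(f \<longlongrightarrow> x) W" using ultrafilter_bounded_limit[OF W(1), of f c] W(2) by auto
    then show ?thesis using tendsto_Lim[OF ultrafilter_not_bot[OF W(1)] x] by simp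
  qed
  have A: "((\<lambda>m. d (a' n) (b' m)) \<longlongrightarrow> A n) V" for n unfolding A_def by (rule lim[OF V bnd])
  have B: "((\<lambda>n. d (a' n) (b' m)) \<longlongrightarrow> B m) U" for m unfolding B_def by (rule lim[OF U bnd])
  have "\<bar>A n\<bar> \<le> 2 * \<bar>R\<bar>" for n by (rule tendsto_abs_le[OF A Vnb]) (intro always_eventually allI bnd)
  then have Al: "(A \<longlongrightarrow> Lim U A) U" by (rule lim[OF U])
  have "\<bar>B m\<bar> \<le> 2 * \<bar>R\<bar>" for m by (rule tendsto_abs_le[OF B Unb]) (intro always_eventually allI bnd)
  then have Bl: "(B \<longlongrightarrow> Lim V B) V" by (rule lim[OF V])
  have "Lim U A = Lim V B" using st by (simp only: A_def[abs_def] B_def[abs_def])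
  define \<phi> where "\<phi> t = max 0 (1 - t / 2 ^ j)" for t :: real
  have \<phi>: "((\<lambda>x. \<phi> (f x)) \<longlongrightarrow> \<phi> y) W" if "(f \<longlongrightarrow> y) W" for f y and W :: "nat filter"
    unfolding \<phi>_def by (intro tendsto_intros that) simp
  have ev_a: "eventually (\<lambda>n. a' n = a n) U" using aR by eventually_elim (simp add: a'_def)
  have ev_b: "eventually (\<lambda>m. b' m = b m) V" using bR by eventually_elim (simp add: b'_def)
  have "eventually (\<lambda>n. \<phi> (A n) = \<alpha> n) U"
    using ev_a
  proof eventually_elim
    case (elim n)
    have "((\<lambda>m. \<phi> (d (a' n) (b' m))) \<longlongrightarrow> \<alpha> n) V"
      by (rule Lim_transform_eventually[OF \<alpha>(1)])
        (use ev_b in eventually_elim, use elim in \<open>simp add: k_def \<phi>_def\<close>)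
    with \<phi>[OF A] show ?case by (rule tendsto_unique[OF Vnb])
  qed
  from Lim_transform_eventually[OF \<phi>[OF Al] this] have "l = \<phi> (Lim U A)"
    by (rule tendsto_unique[OF Unb \<alpha>(2)])
  moreover have "eventually (\<lambda>m. \<phi> (B m) = \<beta> m) V"
    using ev_b
  proof eventually_elim
    case (elim m)
    have "((\<lambda>n. \<phi> (d (a' n) (b' m))) \<longlongrightarrow> \<beta> m) U"
      by (rule Lim_transform_eventually[OF \<beta>(1)])
        (use ev_a in eventually_elim, use elim in \<open>simp add: k_def \<phi>_def\<close>)
    with \<phi>[OF B] show ?case by (rule tendsto_unique[OF Unb])
  qed
  from Lim_transform_eventually[OF \<phi>[OF Bl] this] have "l' = \<phi> (Lim V B)"
    by (rule tendsto_unique[OF Vnb \<beta>(2)])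
  ultimately show ?thesis using \<open>Lim U A = Lim V B\<close> by simp
qed

text \<open>Along an ultrafilter a sequence is either eventually in some ball or eventually outside
  every ball. Symmetry of the kernel handles the case where only the second sequence
  escapes.\<close>

lemma double_limits_k: "double_limits UNIV (k j)"
  unfolding double_limits_def
proof (intro allI impI, elim conjE)
  fix a b :: "nat \<Rightarrow> 'g" and U V \<alpha> \<beta> l l'
  assume U: "ultrafilter U" and V: "ultrafilter V"
    and "\<forall>n. ((\<lambda>m. k j (a n) (b m)) \<longlongrightarrow> \<alpha> n) V" and \<alpha>l: "(\<alpha> \<longlongrightarrow> l) U"
    and "\<forall>m. ((\<lambda>n. k j (a n) (b m)) \<longlongrightarrow> \<beta> m) U" and \<beta>l: "(\<beta> \<longlongrightarrow> l') V"
  then have \<alpha>: "((\<lambda>m. k j (a n) (b m)) \<longlongrightarrow> \<alpha> n) V" and \<beta>: "((\<lambda>n. k j (a n) (b m)) \<longlongrightarrow> \<beta> m) U" for n m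
    by blast+
  have \<alpha>': "((\<lambda>m. k j (b m) (a n)) \<longlongrightarrow> \<alpha> n) V" and \<beta>': "((\<lambda>n. k j (b m) (a n)) \<longlongrightarrow> \<beta> m) U" for n m
    using \<alpha>[of n] \<beta>[of m] by (simp_all add: k_commute[of j "b _"])
  show "l = l'"
  proof (cases "\<exists>R. eventually (\<lambda>n. d (a n) 0 \<le> R) U")
    case False
    then have "eventually (\<lambda>n. R < d (a n) 0) U" for R
      using ultrafilter_not_eventually[OF U, of "\<lambda>m. d (a m) 0 \<le> R"] by (simp add: not_le)
    from double_limit_unbounded[OF U V \<alpha> \<alpha>l \<beta> \<beta>l this] show ?thesis by simp
  next
    case aR: True
    show ?thesis
    proof (cases "\<exists>R. eventually (\<lambda>n. d (b n) 0 \<le> R) V")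
      case False
      then have "eventually (\<lambda>n. R < d (b n) 0) V" for R
        using ultrafilter_not_eventually[OF V, of "\<lambda>m. d (b m) 0 \<le> R"] by (simp add: not_le)
      from double_limit_unbounded[OF V U \<beta>' \<beta>l \<alpha>' \<alpha>l this] show ?thesis by simp
    next
      case True
      with aR obtain R R' where R: "eventually (\<lambda>n. d (a n) 0 \<le> R) U" "eventually (\<lambda>m. d (b m) 0 \<le> R') V"
        by blast
      have "eventually (\<lambda>n. d (a n) 0 \<le> max R R') U" "eventually (\<lambda>m. d (b m) 0 \<le> max R R') V"
        using R by (auto elim: eventually_mono)
      from double_limit_bounded[OF U V \<alpha> \<alpha>l \<beta> \<beta>l this] show ?thesis .
    qed
  qed
qed

sublocale disc_sequence "\<lambda>j. contraction_image (k j)"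
  by standard (rule weakly_compact_disc_contraction_image[OF double_limits_k k_bounds(3)])

section \<open>Translations and the cocycle estimates\<close>

definition \<pi> :: "'g \<Rightarrow> (nat \<Rightarrow> 'g \<Rightarrow> real) \<Rightarrow> nat \<Rightarrow> 'g \<Rightarrow> real" where
  "\<pi> g f = (\<lambda>j x. f j (- g + x))"

lemma \<pi>_zero: "\<pi> 0 f = f"
  by (simp add: \<pi>_def)

lemma \<pi>_add: "\<pi> (g + h) f = \<pi> g (\<pi> h f)"
  by (simp only: \<pi>_def minus_add add.assoc)

lemma \<pi>_plus: "\<pi> g (f + f') = \<pi> g f + \<pi> g f'"
  and \<pi>_diff: "\<pi> g (f - f') = \<pi> g f - \<pi> g f'"
  and \<pi>_scale: "\<pi> g (c *\<^sub>R f) = c *\<^sub>R \<pi> g f"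
  by (simp_all add: \<pi>_def fun_eq_iff scaleR_fun_def)

lemma \<pi>_inverse: "\<pi> (- g) (\<pi> g f) = f" "\<pi> g (\<pi> (- g) f) = f"
  by (simp_all add: \<pi>_add[symmetric] \<pi>_zero)

lemma bfun_shift: "u \<in> bfun \<Longrightarrow> (\<lambda>x :: 'g. u (g + x)) \<in> bfun"
  unfolding bfun_def by blast

text \<open>By left-invariance of \<open>d\<close>, a translation of the first argument of the
  kernel can be moved to the second, where it is absorbed into the functional.\<close>

lemma contraction_image_shift:
  assumes "w \<in> contraction_image (k j)"
  shows "(\<lambda>x. w (- g + x)) \<in> contraction_image (k j)"
proof -
  obtain \<mu> where \<mu>: "contraction \<mu>" "w = (\<lambda>y. \<mu> (k j y))" using assms by (auto simp: contraction_image_def)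
  have "contraction (\<lambda>u. \<mu> (\<lambda>x. u (g + x)))"
    unfolding contraction_def linear_map_on_def
  proof (intro conjI ballI allI impI)
    fix u v :: "'g \<Rightarrow> real" assume "u \<in> bfun" "v \<in> bfun"
    from contraction_add[OF \<mu>(1) this[THEN bfun_shift]]
    show "\<mu> (\<lambda>x. (u + v) (g + x)) = \<mu> (\<lambda>x. u (g + x)) + \<mu> (\<lambda>x. v (g + x))"
      by (simp add: plus_fun_def)
  next
    fix u :: "'g \<Rightarrow> real" and c assume "u \<in> bfun"
    then have "(\<lambda>x. u (g + x)) \<in> bfun" by (rule bfun_shift)
    from contraction_scale[OF \<mu>(1) this, of c]
    show "\<mu> (\<lambda>x. (c *\<^sub>R u) (g + x)) = c *\<^sub>R \<mu> (\<lambda>x. u (g + x))"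
      by (simp add: scaleR_fun_def)
  next
    fix u :: "'g \<Rightarrow> real" and c assume "\<forall>x. \<bar>u x\<bar> \<le> c"
    then show "\<bar>\<mu> (\<lambda>x. u (g + x))\<bar> \<le> c" by (intro contraction_bound[OF \<mu>(1)]) simp
  qed
  moreover have "(\<lambda>x. w (- g + x)) = (\<lambda>y. \<mu> (\<lambda>x. k j y (g + x)))"
    by (simp add: \<mu> k_shift[abs_def])
  ultimately show ?thesis by (rule contraction_imageI[of "\<lambda>u. \<mu> (\<lambda>x. u (g + x))"])
qed

lemma gauge_le_shift:
  assumes "gauge_le (contraction_image (k j)) \<alpha> \<beta> f r"
  shows "gauge_le (contraction_image (k j)) \<alpha> \<beta> (\<lambda>x. f (- g + x)) r"
proof -
  obtain s t w where "0 \<le> s" "0 \<le> t" "w \<in> contraction_image (k j)" "\<alpha> * s + \<beta> * t \<le> r"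
    "\<forall>x. \<bar>f x - s * w x\<bar> \<le> t"
    using assms unfolding gauge_le_def by blast
  then show ?thesis
    unfolding gauge_le_def using contraction_image_shift[of w j g]
    by (intro exI[of _ s] exI[of _ t] exI[of _ "\<lambda>x. w (- g + x)"]) simp
qed

lemma p_\<pi>: "p i (\<pi> g f) = p i f"
proof -
  have "gauge_le (contraction_image (k j)) \<alpha> \<beta> (\<pi> g f j) r \<longleftrightarrow>
      gauge_le (contraction_image (k j)) \<alpha> \<beta> (f j) r" for j \<alpha> \<beta> r
    using gauge_le_shift[of j \<alpha> \<beta> "f j" r g] gauge_le_shift[of j \<alpha> \<beta> "\<pi> g f j" r "- g"]
    by (auto simp: \<pi>_def add.assoc[symmetric])
  then show ?thesis by (simp add: p_def gauge_def)
qed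

lemma N_\<pi>: "N (\<pi> g f) = N f"
  by (simp add: N_def p_\<pi>)

lemma X_\<pi>: "f \<in> X \<Longrightarrow> \<pi> g f \<in> X"
  using bfun_shift[of "f _" "- g"] by (simp add: X_def V_def p_\<pi>) (simp add: \<pi>_def)

definition \<Phi> :: "nat \<Rightarrow> 'g \<Rightarrow> real" where
  "\<Phi> j x = k j x 0"

definition b :: "'g \<Rightarrow> nat \<Rightarrow> 'g \<Rightarrow> real" where
  "b g = \<pi> g \<Phi> - \<Phi>"

lemma \<pi>_\<Phi>: "\<pi> g \<Phi> j x = k j x g"
  by (simp add: \<pi>_def \<Phi>_def k_shift)

lemma b_apply: "b g j x = k j x g - k j x 0"
  by (simp add: b_def \<pi>_\<Phi>) (simp add: \<Phi>_def)

lemma b_zero: "b 0 = 0"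
  by (simp add: b_def \<pi>_zero)

lemma b_add: "b (g + h) = \<pi> g (b h) + b g"
  by (simp add: b_def \<pi>_add \<pi>_diff)

lemma k_section_V: "(\<lambda>j x. k j x g) \<in> V"
  using k_bounds(3) by (auto simp: V_def intro: bfunI)

lemma p_k_section: "p (j, n) (\<lambda>j x. k j x g) \<le> 1 / 4 ^ n"
  unfolding p_def fst_conv snd_conv
  by (rule compact_disc.gauge_disc[OF disc], rule contraction_imageI[OF contraction_eval[of g]]) simp

lemma b_eq: "b g = (\<lambda>j x. k j x g) + (-1) *\<^sub>R (\<lambda>j x. k j x 0)"
  by (simp add: fun_eq_iff b_apply scaleR_fun_def)

lemma b_V: "b g \<in> V"
  unfolding b_eq
  by (intro subspace_add[OF subspace_V] subspace_scale[OF subspace_V] k_section_V)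

lemma d_lipschitz: "\<bar>d x g - d x 0\<bar> \<le> d g 0"
  using d.triangle[of x g 0] d.triangle[of x 0 g] by (simp add: d.commute)

lemma p_b_sup: "p (j, n) (b g) \<le> 2 ^ n * (d g 0 / 2 ^ j)"
proof -
  have max_lipschitz: "\<bar>max 0 u - max 0 v\<bar> \<le> \<bar>u - v\<bar>" for u v :: real by linarith
  have "\<bar>b g j x\<bar> \<le> d g 0 / 2 ^ j" for x
  proof -
    have "\<bar>b g j x\<bar> \<le> \<bar>(1 - d x g / 2 ^ j) - (1 - d x 0 / 2 ^ j)\<bar>"
      unfolding b_apply k_def by (rule max_lipschitz)
    also have "\<dots> = \<bar>d x g - d x 0\<bar> / 2 ^ j"
      by (simp add: abs_minus_commute diff_divide_distrib[symmetric])
    also have "\<dots> \<le> d g 0 / 2 ^ j" by (intro divide_right_mono d_lipschitz) simp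
    finally show ?thesis .
  qed
  then show ?thesis using p_le_sup[of "b g" "(j, n)" "d g 0 / 2 ^ j"] by simp
qed

lemma p_b_disc: "p (j, n) (b g) \<le> 2 / 4 ^ n"
proof -
  have "p (j, n) (b g) \<le> p (j, n) (\<lambda>j x. k j x g) + p (j, n) ((-1) *\<^sub>R (\<lambda>j x. k j x 0))"
    unfolding b_eq by (intro p_add k_section_V subspace_scale[OF subspace_V])
  also have "p (j, n) ((-1) *\<^sub>R (\<lambda>j x. k j x 0)) = p (j, n) (\<lambda>j x. k j x 0)"
    by (subst p_scale[OF k_section_V]) simp
  also have "p (j, n) (\<lambda>j x. k j x g) + p (j, n) (\<lambda>j x. k j x 0) \<le> 2 / 4 ^ n"
    using p_k_section[of j n g] p_k_section[of j n 0] by simp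
  finally show ?thesis .
qed

text \<open>Neither estimate is summable alone: \<open>p_b_sup\<close> grows with \<open>n\<close>
  and \<open>p_b_disc\<close> does not decay in \<open>j\<close>. Their product decays geometrically
  in both indices.\<close>

lemma p_b_squared: "(p (j, n) (b g))\<^sup>2 \<le> 2 * d g 0 * ((1 / 2) ^ j * (1 / 2) ^ n)"
proof -
  have "(p (j, n) (b g))\<^sup>2 \<le> (2 / 4 ^ n) * (2 ^ n * (d g 0 / 2 ^ j))"
    unfolding power2_eq_square
    by (intro mult_mono p_b_disc p_b_sup p_nonneg[OF b_V]) simp
  also have "(4::real) ^ n = 2 ^ n * 2 ^ n" by (simp flip: power_mult_distrib)
  finally show ?thesis by (simp add: power_divide mult.commute)
qed

lemma geometric_sum_le: "(\<Sum>n<m. (1 / 2) ^ n) \<le> (2 :: real)"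
  by (simp add: sum_gp_strict)

lemma L2_b:
  assumes I: "finite I"
  shows "L2_set (\<lambda>i. p i (b g)) I \<le> sqrt (8 * d g 0)"
proof -
  obtain A B where AB: "fst ` I \<subseteq> {..<A}" "snd ` I \<subseteq> {..<B}"
    using I finite_nat_iff_bounded[of "fst ` I"] finite_nat_iff_bounded[of "snd ` I"] by auto
  have "(\<Sum>i\<in>I. (p i (b g))\<^sup>2) \<le> (\<Sum>i\<in>{..<A} \<times> {..<B}. (p i (b g))\<^sup>2)"
    using AB by (intro sum_mono2) force+
  also have "\<dots> \<le> (\<Sum>i\<in>{..<A} \<times> {..<B}. 2 * d g 0 * ((1 / 2) ^ fst i * (1 / 2) ^ snd i))"
    by (intro sum_mono) (use p_b_squared in auto)
  also have "\<dots> = 2 * d g 0 * (\<Sum>i\<in>{..<A} \<times> {..<B}. (1 / 2) ^ fst i * (1 / 2) ^ snd i)"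
    by (rule sum_distrib_left[symmetric])
  also have "(\<Sum>i\<in>{..<A} \<times> {..<B}. (1 / 2) ^ fst i * (1 / 2) ^ snd i) =
      (\<Sum>j<A. (1 / 2 :: real) ^ j) * (\<Sum>n<B. (1 / 2) ^ n)"
    by (simp add: sum_product sum.cartesian_product case_prod_unfold)
  \<comment> \<open>Each geometric sum is at most 2; with the factor 2 of \<open>p_b_squared\<close>
    this is the 8 in the claim.\<close>
  also have "2 * d g 0 * \<dots> \<le> 2 * d g 0 * (2 * 2)"
    by (intro mult_left_mono mult_mono geometric_sum_le sum_nonneg) simp_all
  finally have "(\<Sum>i\<in>I. (p i (b g))\<^sup>2) \<le> 8 * d g 0" by simp
  then show ?thesis by (simp add: L2_set_def)
qed

lemma b_X: "b g \<in> X"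
  by (rule X_I[OF b_V L2_b])

lemma N_b_le: "N (b g) \<le> sqrt (8 * d g 0)"
  by (rule N_leI[OF L2_b])

text \<open>For each j < m the tents at scale \<open>2 ^ j\<close> around \<open>g\<close> and
  around 0 have disjoint peaks: \<open>b g j\<close> takes the value -1 at 0. Each of the m
  coordinates \<open>(j, 0)\<close> therefore contributes at least 1 to the squared norm.\<close>

lemma N_b_ge:
  assumes "2 ^ m \<le> d g 0"
  shows "real m \<le> (N (b g))\<^sup>2"
proof -
  let ?I = "(\<lambda>j. (j, 0)) ` {..<m}"
  have one: "1 \<le> p (j, 0) (b g)" if "j < m" for j
  proof -
    have "(2::real) ^ j \<le> 2 ^ m" using that by (intro power_increasing) auto
    then have "2 ^ j \<le> d g 0" using assms by (rule order_trans)
    then have "b g j 0 = -1" by (simp add: b_apply k_far d.commute) (simp add: k_def)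
    then show ?thesis using pointwise_le_p[OF b_V, of g j 0] by simp
  qed
  have "real m = (\<Sum>j<m. 1\<^sup>2)" by simp
  also have "\<dots> \<le> (\<Sum>j<m. (p (j, 0) (b g))\<^sup>2)" by (intro sum_mono power_mono) (auto intro: one)
  also have "\<dots> = (L2_set (\<lambda>i. p i (b g)) ?I)\<^sup>2"
    unfolding L2_set_squared by (subst sum.reindex) (auto simp: inj_on_def)
  also have "\<dots> \<le> (N (b g))\<^sup>2" by (intro power_mono L2_le_N b_X L2_set_nonneg) simp
  finally show ?thesis .
qed

end

section \<open>The affine action\<close>

context stable_metric_group
begin

text \<open>The vectors with a continuous orbit form a closed invariant subspace, which contains every \<open>b h\<close>.\<close>

definition Y :: "(nat \<Rightarrow> 'g \<Rightarrow> real) set" where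
  "Y = {f \<in> X. ((\<lambda>g. N (\<pi> g f - f)) \<longlongrightarrow> 0) (nhds 0)}"

lemma Y_X: "Y \<subseteq> X"
  by (auto simp: Y_def)

lemma Y_tendsto: "f \<in> Y \<Longrightarrow> ((\<lambda>g. N (\<pi> g f - f)) \<longlongrightarrow> 0) (nhds 0)"
  by (simp add: Y_def)

lemma diff_X: "f \<in> X \<Longrightarrow> g \<in> X \<Longrightarrow> f - g \<in> X"
  by (rule subspace_diff[OF subspace_X])

lemma N_triangle3:
  assumes "f \<in> X" "g \<in> X" "h \<in> X"
  shows "N (f + g + h) \<le> N f + N g + N h"
  using N_add[OF X_add[OF assms(1,2)] assms(3)] N_add[OF assms(1,2)] by linarith

lemma N_minus: "f \<in> X \<Longrightarrow> N (g - f) = N (f - g)" if "g \<in> X"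
  using N_scale[OF diff_X[of f g], of "-1"] that by simp

lemma tendsto_zero_le:
  fixes f h :: "'b \<Rightarrow> real"
  assumes "(h \<longlongrightarrow> 0) F" "\<And>x. 0 \<le> f x" "\<And>x. f x \<le> h x"
  shows "(f \<longlongrightarrow> 0) F"
  by (rule tendsto_sandwich[OF _ _ tendsto_const assms(1)]) (simp_all add: assms)

lemma subspace_Y: "subspace Y"
  unfolding subspace_def
proof (intro conjI ballI allI)
  have "\<pi> g 0 - 0 = 0" for g by (simp add: \<pi>_def fun_eq_iff)
  then show "0 \<in> Y" by (simp add: Y_def zero_X N_zero)
  fix f f' assume f: "f \<in> Y" "f' \<in> Y"
  then have fX: "f \<in> X" "f' \<in> X" using Y_X by auto
  have "((\<lambda>g. N (\<pi> g (f + f') - (f + f'))) \<longlongrightarrow> 0) (nhds 0)"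
  proof (rule tendsto_zero_le)
    show "((\<lambda>g. N (\<pi> g f - f) + N (\<pi> g f' - f')) \<longlongrightarrow> 0) (nhds 0)"
      using tendsto_add[OF Y_tendsto[OF f(1)] Y_tendsto[OF f(2)]] by simp
    fix g
    show "0 \<le> N (\<pi> g (f + f') - (f + f'))" by (intro N_nonneg diff_X X_\<pi> X_add fX)
    have eq: "\<pi> g (f + f') - (f + f') = (\<pi> g f - f) + (\<pi> g f' - f')" by (simp add: \<pi>_plus)
    show "N (\<pi> g (f + f') - (f + f')) \<le> N (\<pi> g f - f) + N (\<pi> g f' - f')"
      unfolding eq by (intro N_add diff_X X_\<pi> fX)
  qed
  then show "f + f' \<in> Y" by (simp add: Y_def X_add fX)
next
  fix f and c :: real assume f: "f \<in> Y"
  then have fX: "f \<in> X" using Y_X by auto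
  have "N (\<pi> g (c *\<^sub>R f) - c *\<^sub>R f) = \<bar>c\<bar> * N (\<pi> g f - f)" for g
    unfolding \<pi>_scale scaleR_diff_right[symmetric] by (intro N_scale diff_X X_\<pi> fX)
  then have "((\<lambda>g. N (\<pi> g (c *\<^sub>R f) - c *\<^sub>R f)) \<longlongrightarrow> 0) (nhds 0)"
    using tendsto_mult_left[OF Y_tendsto[OF f], of "\<bar>c\<bar>"] by simp
  then show "c *\<^sub>R f \<in> Y" by (simp add: Y_def X_scale fX)
qed

text \<open>An e / 3 argument that is uniform in \<open>g\<close>, because \<open>\<pi> g\<close> is
  an isometry.\<close>

lemma closed_Y:
  assumes f: "f \<in> X" and close: "\<And>e. e > 0 \<Longrightarrow> \<exists>h\<in>Y. N (h - f) < e"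
  shows "f \<in> Y"
proof -
  have "((\<lambda>g. N (\<pi> g f - f)) \<longlongrightarrow> 0) (nhds 0)"
  proof (rule tendstoI)
    fix e :: real assume e: "e > 0"
    obtain h where h: "h \<in> Y" "N (h - f) < e / 3" using close[of "e/3"] e by auto
    then have hX: "h \<in> X" using Y_X by auto
    have "eventually (\<lambda>g. N (\<pi> g h - h) < e / 3) (nhds 0)"
      using order_tendstoD(2)[OF Y_tendsto[OF h(1)], of "e/3"] e by simp
    then show "eventually (\<lambda>g. dist (N (\<pi> g f - f)) 0 < e) (nhds 0)"
    proof eventually_elim
      case (elim g)
      have eq: "\<pi> g f - f = \<pi> g (f - h) + (\<pi> g h - h) + (h - f)" by (simp add: \<pi>_diff)
      have "N (\<pi> g f - f) \<le> N (\<pi> g (f - h)) + N (\<pi> g h - h) + N (h - f)"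
        unfolding eq by (intro N_triangle3 diff_X X_\<pi> f hX)
      also have "N (\<pi> g (f - h)) = N (h - f)" unfolding N_\<pi> by (rule N_minus[OF f hX])
      finally have "N (\<pi> g f - f) < e" using elim h(2) by linarith
      moreover have "0 \<le> N (\<pi> g f - f)" by (intro N_nonneg diff_X X_\<pi> f)
      ultimately show ?case by simp
    qed
  qed
  with f show ?thesis by (simp add: Y_def)
qed

text \<open>In a noncommutative group, moving \<open>\<pi> h\<close> across \<open>\<pi> g\<close>
  replaces \<open>g\<close> by a conjugate, which still tends to 0.\<close>

lemma tendsto_conjugate: "((\<lambda>g :: 'g. - h + g + h) \<longlongrightarrow> 0) (nhds 0)"
proof -
  have "((\<lambda>g :: 'g. - h + g + h) \<longlongrightarrow> - h + 0 + h) (nhds 0)"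
    by (intro tendsto_intros filterlim_ident)
  then show ?thesis by simp
qed

lemma \<pi>_Y: "f \<in> Y \<Longrightarrow> \<pi> h f \<in> Y"
proof -
  assume f: "f \<in> Y"
  have "N (\<pi> g (\<pi> h f) - \<pi> h f) = N (\<pi> (- h + g + h) f - f)" for g
  proof -
    have "\<pi> h (\<pi> (- h + g + h) f - f) = \<pi> g (\<pi> h f) - \<pi> h f"
      unfolding \<pi>_diff \<pi>_add[symmetric] by (simp add: add.assoc[symmetric])
    then show ?thesis using N_\<pi> by metis
  qed
  then have "((\<lambda>g. N (\<pi> g (\<pi> h f) - \<pi> h f)) \<longlongrightarrow> 0) (nhds 0)"
    using filterlim_compose[OF Y_tendsto[OF f] tendsto_conjugate[of h]] by simp
  then show ?thesis using f X_\<pi> by (simp add: Y_def)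
qed

text \<open>Here the compatibility of \<open>d\<close> with the topology of the group yields
  continuity: balls around 0 are open neighbourhoods.\<close>

lemma tendsto_d: "((\<lambda>g. d g 0) \<longlongrightarrow> 0) (nhds 0)"
proof (rule tendstoI)
  fix e :: real assume e: "e > 0"
  have "openin d.mtopology (d.mball 0 e)" by (rule d.openin_mball)
  then have "open (d.mball 0 e)"
    using compatible unfolding compatible_metric_def by (metis open_openin)
  then show "eventually (\<lambda>g. dist (d g 0) 0 < e) (nhds 0)"
    using e by (auto simp: eventually_nhds d.commute intro!: exI[of _ "d.mball 0 e"])
qed

lemma tendsto_N_b: "((\<lambda>g. N (b g)) \<longlongrightarrow> 0) (nhds 0)"
proof (rule tendsto_zero_le)
  have "((\<lambda>g. sqrt (8 * d g 0)) \<longlongrightarrow> sqrt (8 * 0)) (nhds 0)"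
    by (intro tendsto_intros tendsto_d)
  then show "((\<lambda>g. sqrt (8 * d g 0)) \<longlongrightarrow> 0) (nhds 0)" by simp
qed (simp_all add: N_nonneg b_X N_b_le)

lemma b_Y: "b h \<in> Y"
proof -
  have "((\<lambda>g. N (\<pi> g (b h) - b h)) \<longlongrightarrow> 0) (nhds 0)"
  proof (rule tendsto_zero_le)
    show "((\<lambda>g. N (b (- h + g + h)) + N (b g)) \<longlongrightarrow> 0) (nhds 0)"
      using tendsto_add[OF filterlim_compose[OF tendsto_N_b tendsto_conjugate[of h]] tendsto_N_b] by simp
    fix g
    show "0 \<le> N (\<pi> g (b h) - b h)" by (intro N_nonneg diff_X X_\<pi> b_X)
    \<comment> \<open>Expanding the cocycle in these two ways expresses
      \<open>\<pi> g (b h) - b h\<close> through \<open>b\<close> at \<open>g\<close> and at its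
      conjugate, both of which tend to 0.\<close>
    have "g + h = h + (- h + g + h)" by (simp add: add.assoc[symmetric])
    then have "\<pi> g (b h) + b g = \<pi> h (b (- h + g + h)) + b h" using b_add by metis
    then have eq: "\<pi> g (b h) - b h = \<pi> h (b (- h + g + h)) + (-1) *\<^sub>R b g"
      by (simp add: algebra_simps)
    have "N (\<pi> g (b h) - b h) \<le> N (\<pi> h (b (- h + g + h))) + N ((-1) *\<^sub>R b g)"
      unfolding eq by (intro N_add X_\<pi> X_scale b_X)
    also have "N ((-1) *\<^sub>R b g) = N (b g)" by (subst N_scale[OF b_X]) simp
    finally show "N (\<pi> g (b h) - b h) \<le> N (b (- h + g + h)) + N (b g)"
      unfolding N_\<pi> .
  qed
  then show ?thesis using b_X by (simp add: Y_def)
qed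

section \<open>Joint continuity and properness of the affine action\<close>

definition act :: "'g \<Rightarrow> (nat \<Rightarrow> 'g \<Rightarrow> real) \<Rightarrow> nat \<Rightarrow> 'g \<Rightarrow> real" where
  "act g f = \<pi> g f + b g"

lemma act_zero: "act 0 f = f"
  by (simp add: act_def \<pi>_zero b_zero)

lemma act_add: "act (g + h) f = act g (act h f)"
  by (simp add: act_def \<pi>_add \<pi>_plus b_add add.assoc)

lemma act_diff: "act g f - act g f' = \<pi> g (f - f')"
  by (simp add: act_def \<pi>_diff)

lemma act_Y: "f \<in> Y \<Longrightarrow> act g f \<in> Y"
  unfolding act_def by (intro subspace_add[OF subspace_Y] \<pi>_Y b_Y)

lemma affine_action: "affine_isometric_action_on Y N act"
proof -
  have "bij_betw (\<pi> g) Y Y" for g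
    by (rule bij_betw_byWitness[of _ "\<pi> (- g)"]) (auto simp: \<pi>_inverse \<pi>_Y)
  then have "isometric_linear_representation_on Y N \<pi>"
    by (simp add: isometric_linear_representation_on_def linear_map_on_def \<pi>_plus \<pi>_scale N_\<pi>
        \<pi>_zero \<pi>_add)
  moreover have "\<forall>g f. b (g + f) = \<pi> g (b f) + b g" using b_add by blast
  ultimately show ?thesis
    unfolding affine_isometric_action_on_def using b_Y act_zero act_add act_def by blast
qed

lemma tendsto_act:
  assumes "f \<in> Y"
  shows "((\<lambda>g. N (act g f - f)) \<longlongrightarrow> 0) (nhds 0)"
proof (rule tendsto_zero_le)
  have f: "f \<in> X" using assms Y_X by auto
  show "((\<lambda>g. N (\<pi> g f - f) + N (b g)) \<longlongrightarrow> 0) (nhds 0)"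
    using tendsto_add[OF Y_tendsto[OF assms] tendsto_N_b] by simp
  fix g
  have eq: "act g f - f = (\<pi> g f - f) + b g" by (simp add: act_def)
  show "N (act g f - f) \<le> N (\<pi> g f - f) + N (b g)"
    unfolding eq by (intro N_add diff_X X_\<pi> f b_X)
  show "0 \<le> N (act g f - f)" using act_Y[OF assms] Y_X f by (intro N_nonneg diff_X) auto
qed

lemma normed_Y: "normed_space_on Y N"
  by (rule normed_space_X[OF Y_X subspace_Y])

sublocale Y: Metric_space Y "norm_dist Y N"
  by (rule Metric_space_norm_dist[OF normed_Y])

text \<open>Isometry reduces joint continuity to orbit continuity at the unit. Inserting
  \<open>act g \<xi>0\<close> bounds the distance between \<open>act g0 \<xi>0\<close> and
  \<open>act g \<xi>\<close> by the displacement of \<open>\<xi>0\<close> under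
  \<open>- g0 + g\<close> plus the distance of \<open>\<xi>0\<close> and
  \<open>\<xi>\<close>.\<close>

lemma continuous_action: "continuous_action_on Y N act"
  unfolding continuous_action_on_def continuous_map_def
proof (intro conjI allI impI)
  let ?T = "prod_topology (euclidean :: 'g topology) Y.mtopology"
  show "(\<lambda>(g, \<xi>). act g \<xi>) \<in> topspace ?T \<rightarrow> topspace Y.mtopology"
    by (auto simp: act_Y)
  fix W assume W: "openin Y.mtopology W"
  show "openin ?T {z \<in> topspace ?T. (case z of (g, \<xi>) \<Rightarrow> act g \<xi>) \<in> W}"
  proof (subst openin_subopen, intro ballI)
    fix z assume z: "z \<in> {z \<in> topspace ?T. (case z of (g, \<xi>) \<Rightarrow> act g \<xi>) \<in> W}"
    then obtain g0 \<xi>0 where z_eq: "z = (g0, \<xi>0)" and \<xi>0: "\<xi>0 \<in> Y" and "act g0 \<xi>0 \<in> W" by auto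
    then obtain e where e: "e > 0" "Y.mball (act g0 \<xi>0) e \<subseteq> W"
      using W unfolding Y.openin_mtopology by blast
    have "((\<lambda>g. - g0 + g) \<longlongrightarrow> - g0 + g0) (nhds g0)"
      by (intro tendsto_intros filterlim_ident)
    then have "((\<lambda>g. - g0 + g) \<longlongrightarrow> 0) (nhds g0)" by simp
    from filterlim_compose[OF tendsto_act[OF \<xi>0] this]
    have "eventually (\<lambda>g. N (act (- g0 + g) \<xi>0 - \<xi>0) < e / 2) (nhds g0)"
      using e by (auto dest!: order_tendstoD(2)[where a = "e / 2"])
    then obtain A where A: "open A" "g0 \<in> A" "\<And>g. g \<in> A \<Longrightarrow> N (act (- g0 + g) \<xi>0 - \<xi>0) < e / 2"
      by (auto simp: eventually_nhds)
    have near: "act g \<xi> \<in> W" if g: "g \<in> A" and \<xi>: "\<xi> \<in> Y.mball \<xi>0 (e / 2)" for g \<xi>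
    proof -
      have \<xi>Y: "\<xi> \<in> Y" and d: "N (\<xi>0 - \<xi>) < e / 2" using \<xi> \<xi>0
        by (simp_all add: norm_dist_def split: if_splits)
      have X: "\<xi> \<in> X" "\<xi>0 \<in> X" "act (- g0 + g) \<xi>0 \<in> X" using \<xi>Y \<xi>0 act_Y Y_X by auto
      have "act g \<xi>0 = act g0 (act (- g0 + g) \<xi>0)"
        unfolding act_add[symmetric] by (simp add: add.assoc[symmetric])
      then have "act g0 \<xi>0 - act g \<xi> = \<pi> g0 (\<xi>0 - act (- g0 + g) \<xi>0) + \<pi> g (\<xi>0 - \<xi>)"
        unfolding act_diff[symmetric] by simp
      then have "N (act g0 \<xi>0 - act g \<xi>) \<le> N (\<xi>0 - act (- g0 + g) \<xi>0) + N (\<xi>0 - \<xi>)"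
        using N_add[OF X_\<pi>[OF diff_X[OF X(2,3)]] X_\<pi>[OF diff_X[OF X(2,1)]], of g0 g] by (simp add: N_\<pi>)
      also have "N (\<xi>0 - act (- g0 + g) \<xi>0) = N (act (- g0 + g) \<xi>0 - \<xi>0)"
        by (rule N_minus[OF X(2,3)])
      finally have "N (act g0 \<xi>0 - act g \<xi>) < e" using A(3)[OF g] d by linarith
      then have "act g \<xi> \<in> Y.mball (act g0 \<xi>0) e" using act_Y \<xi>Y \<xi>0 by (simp add: norm_dist_def)
      then show ?thesis using e by blast
    qed
    have "openin ?T (A \<times> Y.mball \<xi>0 (e / 2))"
      unfolding openin_prod_Times_iff using A(1) by (simp add: Y.openin_mball)
    moreover have "z \<in> A \<times> Y.mball \<xi>0 (e / 2)" using A(2) \<xi>0 e by (simp add: z_eq)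
    moreover have "A \<times> Y.mball \<xi>0 (e / 2) \<subseteq> {z \<in> topspace ?T. (case z of (g, \<xi>) \<Rightarrow> act g \<xi>) \<in> W}"
      using near by auto
    ultimately show "\<exists>T. openin ?T T \<and> z \<in> T \<and>
        T \<subseteq> {z \<in> topspace ?T. (case z of (g, \<xi>) \<Rightarrow> act g \<xi>) \<in> W}" by blast
  qed
qed

text \<open>The linear part moves \<open>\<xi>\<close> by at most \<open>2 * N \<xi>\<close>, so the
  displacement of any point differs from the displacement \<open>b\<close> of the origin by a
  constant, and \<open>N_b_ge\<close> makes the latter unbounded as \<open>d (g n) 0\<close>
  grows.\<close>

lemma proper_action:
  assumes "metrically_proper_metric d"
  shows "metrically_proper_action_on Y N act"
  unfolding metrically_proper_action_on_def
proof (intro ballI allI impI)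
  fix \<xi> and g :: "nat \<Rightarrow> 'g" assume \<xi>: "\<xi> \<in> Y" and "tends_to_infinity g"
  then have d_inf: "filterlim (\<lambda>n. d (g n) 0) at_top sequentially"
    using assms by (simp add: metrically_proper_metric_def)
  have X: "\<xi> \<in> X" using \<xi> Y_X by auto
  show "filterlim (\<lambda>n. N (act (g n) \<xi> - \<xi>)) at_top sequentially"
    unfolding filterlim_at_top
  proof
    fix Z :: real
    \<comment> \<open>\<open>m\<close> is a lower bound for the squared norm of
      \<open>b (g n)\<close> once \<open>d (g n) 0\<close> reaches \<open>2 ^ m\<close>; the term
      \<open>2 * N \<xi>\<close> pays for the displacement of \<open>\<xi>\<close> by the linear
      part.\<close>
    obtain m :: nat where m: "(\<bar>Z\<bar> + 2 * N \<xi>)\<^sup>2 \<le> real m" using real_arch_simple by blast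
    have "eventually (\<lambda>n. 2 ^ m \<le> d (g n) 0) sequentially"
      using d_inf by (simp add: filterlim_at_top)
    then show "eventually (\<lambda>n. Z \<le> N (act (g n) \<xi> - \<xi>)) sequentially"
    proof eventually_elim
      case (elim n)
      have "(\<bar>Z\<bar> + 2 * N \<xi>)\<^sup>2 \<le> (N (b (g n)))\<^sup>2" using m N_b_ge[OF elim] by linarith
      then have "\<bar>Z\<bar> + 2 * N \<xi> \<le> N (b (g n))" by (rule power2_le_imp_le) (rule N_nonneg[OF b_X])
      moreover have eq: "b (g n) = (act (g n) \<xi> - \<xi>) + \<xi> + (-1) *\<^sub>R \<pi> (g n) \<xi>" by (simp add: act_def)
      have "N (b (g n)) \<le> N (act (g n) \<xi> - \<xi>) + N \<xi> + N ((-1) *\<^sub>R \<pi> (g n) \<xi>)"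
        by (subst eq) (intro N_triangle3 diff_X X_scale X_\<pi> X subsetD[OF Y_X act_Y[OF \<xi>]])
      moreover have "N ((-1) *\<^sub>R \<pi> (g n) \<xi>) = N \<xi>" by (subst N_scale[OF X_\<pi>[OF X]]) (simp add: N_\<pi>)
      ultimately show ?case by linarith
    qed
  qed
qed

end

theorem corollary5:
  fixes d :: "'g::topological_group_add \<Rightarrow> 'g \<Rightarrow> real"
  assumes "compatible_metric d" and "left_invariant d"
    and "metrically_proper_metric d" and "stable_metric UNIV d"
  shows "\<exists>(X :: (nat \<Rightarrow> 'g \<Rightarrow> real) set) N \<alpha>.
           banach_space_on X N \<and> reflexive_on X N \<and>
           affine_isometric_action_on X N (\<alpha> :: 'g \<Rightarrow> _) \<and>
           continuous_action_on X N \<alpha> \<and> metrically_proper_action_on X N \<alpha>"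
proof -
  interpret stable_metric_group d
    using assms(1,2,4) by unfold_locales
  show ?thesis
    using banach_closed_subspace[OF subspace_Y Y_X closed_Y]
      reflexive_closed_subspace[OF subspace_Y Y_X closed_Y]
      affine_action continuous_action proper_action[OF assms(3)] by blast
qed

end
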